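(* Let $\mathsf H$ be a separable Hilbert space, let $\phi:\mathcal P_2(\mathsf H)\to(-\infty,+\infty]$ be proper, $W_2$-lower semicontinuous and convex along generalized geodesics, let $\tau>0$ and $\mu_0\in\mathcal P_2(\mathsf H)$, and let $(\mu^k_\tau)_{k\in\mathbb N}$ be a solution to the Proximal Point Algorithm $$\mu^0_\tau=\mu_0,\qquad \mu^{k+1}_\tau\in J_\tau(\mu^k_\tau)\quad(k=0,1,2,\dots).$$ Then $\operatorname{argmin}\phi\neq\emptyset$ if and only if $(\mu^k_\tau)_{k\in\mathbb N}$ is bounded in $(\mathcal P_2(\mathsf H),W_2)$. If this is the case, there exists the limit $\mu:=\lim_{k\to\infty}\mu^k_\tau$ in $\mathcal P_2^w(\mathsf H)$ and $\mu\in\operatorname{argmin}\phi$.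
   Context: $(\mathsf H,|\cdot|)$ is a separable Hilbert space. $\mathcal P_2(\mathsf H)$ is the set of Borel probability measures $\mu$ on $\mathsf H$ with $\int|x|^2\,\mathrm d\mu<\infty$. $\Gamma(\mu^1,\dots,\mu^N)$ is the set of Borel probability measures on $\mathsf H^N$ with marginals $\mu^1,\dots,\mu^N$; $W_2^2(\mu,\nu)=\min\{\int|x_1-x_2|^2\,\mathrm d\boldsymbol\mu:\boldsymbol\mu\in\Gamma(\mu,\nu)\}$; $\Gamma_o(\mu,\nu)$ is the set of minimizers (optimal plans). $\mathcal P_2^w(\mathsf H)$ is the set $\mathcal P_2(\mathsf H)$ endowed with the coarsest topology making all maps $\mu\mapsto\int\zeta\,\mathrm d\mu$ continuous, where $\zeta:\mathsf H\to\mathbb R$ ranges over the sequentially weakly continuous functions with $\lim_{|x|\to\infty}\zeta(x)/(1+|x|^2)=0$. $D(\phi)=\{\mu\in\mathcal P_2(\mathsf H):\phi(\mu)<\infty\}$; $\phi$ is proper if $D(\phi)\ne\emptyset$; $\operatorname{argmin}\phi$ is the set of minimizers of $\phi$ in $\mathcal P_2(\mathsf H)$. $\phi$ is convex along generalized geodesics if for every $\nu,\mu_0,\mu_1\in D(\phi)$ there exists $\boldsymbol\gamma\in\Gamma(\nu,\mu_0,\mu_1)$ with $\pi^{1,2}_\sharp\boldsymbol\gamma\in\Gamma_o(\nu,\mu_0)$ and $\pi^{1,3}_\sharp\boldsymbol\gamma\in\Gamma_o(\nu,\mu_1)$ such that, setting $\mu_t^{2\to3}:=(\pi_t^{2\to3})_\sharp\boldsymbol\gamma$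 with $\pi_t^{2\to3}(x_1,x_2,x_3)=(1-t)x_2+tx_3$, one has $\phi(\mu_t^{2\to3})\le(1-t)\phi(\mu_0)+t\phi(\mu_1)$ for every $t\in[0,1]$. Here $\pi^{i,j}$ is the projection on the $i$-th and $j$-th coordinates and $\sharp$ denotes push-forward. For $\tau>0$ and $\mu\in\mathcal P_2(\mathsf H)$, $J_\tau(\mu)$ is the set of minimizers over $\nu\in\mathcal P_2(\mathsf H)$ of $\Phi_\tau(\mu,\nu):=\phi(\nu)+\frac1{2\tau}W_2^2(\nu,\mu)$. *)

theory Defs
  imports "HOL-Probability.Probability"
begin

text \<open>A separable real Hilbert space is a type of sort \<open>{real_inner, polish_space}\<close>: completeness
  and second countability, which for a metric space is the same as separability. The Borel
  measures on the powers \<open>H \<times> H\<close> and \<open>H \<times> H \<times> H\<close> are those of the product topology.\<close>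

definition P2 :: "'a::{real_inner, polish_space} measure set" where
  "P2 = {\<mu>. sets \<mu> = sets borel \<and> prob_space \<mu> \<and> integrable \<mu> (\<lambda>x. (norm x)\<^sup>2)}"

definition couplings2 ::
  "'a::{real_inner, polish_space} measure \<Rightarrow> 'a measure \<Rightarrow> ('a \<times> 'a) measure set" where
  "couplings2 \<mu> \<nu> = {\<gamma>. sets \<gamma> = sets borel \<and> prob_space \<gamma> \<and>
     distr \<gamma> borel fst = \<mu> \<and> distr \<gamma> borel snd = \<nu>}"

definition couplings3 ::
  "'a::{real_inner, polish_space} measure \<Rightarrow> 'a measure \<Rightarrow> 'a measure \<Rightarrow> ('a \<times> 'a \<times> 'a) measure set" where
  "couplings3 \<mu>1 \<mu>2 \<mu>3 = {\<gamma>. sets \<gamma> = sets borel \<and> prob_space \<gamma> \<and>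
     distr \<gamma> borel (\<lambda>(x1, x2, x3). x1) = \<mu>1 \<and>
     distr \<gamma> borel (\<lambda>(x1, x2, x3). x2) = \<mu>2 \<and>
     distr \<gamma> borel (\<lambda>(x1, x2, x3). x3) = \<mu>3}"

definition quadratic_cost :: "('a::{real_inner, polish_space} \<times> 'a) measure \<Rightarrow> ennreal" where
  "quadratic_cost \<gamma> = (\<integral>\<^sup>+ (x1, x2). ennreal ((norm (x1 - x2))\<^sup>2) \<partial>\<gamma>)"

text \<open>On \<^const>\<open>P2\<close> there is always a coupling of finite cost and the infimum is attained, so
  that \<^const>\<open>enn2real\<close> loses nothing there and the infimum is a minimum.\<close>

definition W2 :: "'a::{real_inner, polish_space} measure \<Rightarrow> 'a measure \<Rightarrow> real" where
  "W2 \<mu> \<nu> = sqrt (enn2real (INF \<gamma>\<in>couplings2 \<mu> \<nu>. quadratic_cost \<gamma>))"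

definition optimal_plans ::
  "'a::{real_inner, polish_space} measure \<Rightarrow> 'a measure \<Rightarrow> ('a \<times> 'a) measure set" where
  "optimal_plans \<mu> \<nu> = {\<gamma> \<in> couplings2 \<mu> \<nu>.
     \<forall>\<gamma>'\<in>couplings2 \<mu> \<nu>. quadratic_cost \<gamma> \<le> quadratic_cost \<gamma>'}"

definition W2_bounded :: "'a::{real_inner, polish_space} measure set \<Rightarrow> bool" where
  "W2_bounded S \<longleftrightarrow> S \<subseteq> P2 \<and> (\<exists>\<nu>\<in>P2. \<exists>C. \<forall>\<mu>\<in>S. W2 \<nu> \<mu> \<le> C)"

definition weakly_tendsto :: "(nat \<Rightarrow> 'a::{real_inner, polish_space}) \<Rightarrow> 'a \<Rightarrow> bool" where
  "weakly_tendsto X x \<longleftrightarrow> (\<forall>y. (\<lambda>n. inner (X n) y) \<longlonglongrightarrow> inner x y)"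

definition seq_weakly_continuous :: "('a::{real_inner, polish_space} \<Rightarrow> real) \<Rightarrow> bool" where
  "seq_weakly_continuous \<zeta> \<longleftrightarrow>
     (\<forall>X x. weakly_tendsto X x \<longrightarrow> (\<lambda>n. \<zeta> (X n)) \<longlonglongrightarrow> \<zeta> x)"

text \<open>Every test function is norm continuous, hence Borel, and at most of quadratic growth (weakly
  convergent subsequences show that it is bounded on bounded sets). It is therefore integrable
  with respect to all measures in \<^const>\<open>P2\<close>.\<close>

definition weak_test_functions :: "('a::{real_inner, polish_space} \<Rightarrow> real) set" where
  "weak_test_functions = {\<zeta>. seq_weakly_continuous \<zeta> \<and>
     ((\<lambda>x. \<zeta> x / (1 + (norm x)\<^sup>2)) \<longlongrightarrow> 0) at_infinity}"

definition P2w :: "'a::{real_inner, polish_space} measure topology" where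
  "P2w = topology_generated_by
     {{\<mu> \<in> P2. (\<integral>x. \<zeta> x \<partial>\<mu>) \<in> U} | \<zeta> U. \<zeta> \<in> weak_test_functions \<and> open U}"

text \<open>A functional on \<^const>\<open>P2\<close> is a total function on measures of which only the values on
  \<^const>\<open>P2\<close> are used.\<close>

definition eff_domain :: "('a::{real_inner, polish_space} measure \<Rightarrow> ereal) \<Rightarrow> 'a measure set" where
  "eff_domain \<phi> = {\<mu> \<in> P2. \<phi> \<mu> < \<infinity>}"

definition proper :: "('a::{real_inner, polish_space} measure \<Rightarrow> ereal) \<Rightarrow> bool" where
  "proper \<phi> \<longleftrightarrow> eff_domain \<phi> \<noteq> {}"

definition argmin_P2 :: "('a::{real_inner, polish_space} measure \<Rightarrow> ereal) \<Rightarrow> 'a measure set" where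
  "argmin_P2 \<phi> = {\<mu> \<in> P2. \<forall>\<nu>\<in>P2. \<phi> \<mu> \<le> \<phi> \<nu>}"

definition W2_lsc :: "('a::{real_inner, polish_space} measure \<Rightarrow> ereal) \<Rightarrow> bool" where
  "W2_lsc \<phi> \<longleftrightarrow> (\<forall>\<mu>\<in>P2. \<forall>c<\<phi> \<mu>. \<exists>\<delta>>0. \<forall>\<nu>\<in>P2. W2 \<mu> \<nu> < \<delta> \<longrightarrow> c < \<phi> \<nu>)"

definition convex_along_generalized_geodesics ::
  "('a::{real_inner, polish_space} measure \<Rightarrow> ereal) \<Rightarrow> bool" where
  "convex_along_generalized_geodesics \<phi> \<longleftrightarrow>
     (\<forall>\<nu>\<in>eff_domain \<phi>. \<forall>\<mu>0\<in>eff_domain \<phi>. \<forall>\<mu>1\<in>eff_domain \<phi>.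
        \<exists>\<gamma>\<in>couplings3 \<nu> \<mu>0 \<mu>1.
          distr \<gamma> borel (\<lambda>(x1, x2, x3). (x1, x2)) \<in> optimal_plans \<nu> \<mu>0 \<and>
          distr \<gamma> borel (\<lambda>(x1, x2, x3). (x1, x3)) \<in> optimal_plans \<nu> \<mu>1 \<and>
          (\<forall>t\<in>{0..1}.
             \<phi> (distr \<gamma> borel (\<lambda>(x1, x2, x3). (1 - t) *\<^sub>R x2 + t *\<^sub>R x3))
               \<le> ereal (1 - t) * \<phi> \<mu>0 + ereal t * \<phi> \<mu>1))"

definition prox_functional ::
  "('a::{real_inner, polish_space} measure \<Rightarrow> ereal) \<Rightarrow> real \<Rightarrow> 'a measure \<Rightarrow> 'a measure \<Rightarrow> ereal" where
  "prox_functional \<phi> \<tau> \<mu> \<nu> = \<phi> \<nu> + ereal (1 / (2 * \<tau>) * (W2 \<nu> \<mu>)\<^sup>2)"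

definition prox ::
  "('a::{real_inner, polish_space} measure \<Rightarrow> ereal) \<Rightarrow> real \<Rightarrow> 'a measure \<Rightarrow> 'a measure set" where
  "prox \<phi> \<tau> \<mu> = argmin_P2 (prox_functional \<phi> \<tau> \<mu>)"

end

theory Submission
  imports Defs
begin

text \<open>Proximal steps satisfy the discrete evolution variational inequality
  \<open>2 \<tau> (\<phi> \<mu>' - \<phi> \<nu>) \<le> W\<^sup>2 (\<mu>, \<nu>) - W\<^sup>2 (\<mu>', \<nu>)\<close>. Hence the iterates are Fejer monotone with
  respect to the minimizers, and the values of \<open>\<phi>\<close> along them decrease to the infimum of \<open>\<phi>\<close>.
  A sequence with bounded second moments has a subsequence which is represented by random
  variables converging weakly almost everywhere: coding points by digits reduces this to the
  theorems of Helly and Skorohod on the real line. As sublevels of \<open>\<phi>\<close> are closed under weak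
  limits, every weak limit point of a bounded sequence of iterates is a minimizer. The Opial
  property, \<open>liminf (W\<^sup>2 (\<mu>\<^sub>n, \<nu>) - W\<^sup>2 (\<mu>\<^sub>n, \<mu>)) \<ge> W\<^sup>2 (\<mu>, \<nu>)\<close> if \<open>\<mu>\<^sub>n\<close> converges weakly to \<open>\<mu>\<close>, together with
  Fejer monotonicity, shows that there is only one limit point. Optimal plans are never
  constructed: between measures of finite \<open>\<phi>\<close> they are part of the convexity hypothesis.\<close>

section \<open>A subsequence with stabilising digits\<close>

text \<open>The obstacle is that a weak limit is not known to have finite \<phi> until sublevels are
  shown to be weakly closed. Until then it can be neither base nor endpoint of a generalized
  geodesic, and no optimal plan ending in it is at hand. All generalized geodesics therefore have
  their base along the sequence, and only the limits of the resulting plans are compared with the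
  limit point. Second moments may drop under weak convergence, so squared distances have no reason
  to pass to the limit. The difference does: |x - a|^2 - |x|^2 = |a|^2 - 2 <x, a> is weakly
  continuous in x, even if a varies in norm at the same time. This is why limits are taken of
  squared distances minus second moments, and why the plans must converge strongly in the
  coordinates whose marginal is fixed. In the coding, only 0 and 1 occur as digits in base 3. The
  codes thus lie on a Cantor set, where nearby codes share their first digits; in base 2 a carry
  could change all of them.\<close>

definition ternary_code :: "(nat \<Rightarrow> bool) \<Rightarrow> real" where
  "ternary_code b = (\<Sum>i. of_bool (b i) / 3 ^ Suc i)"

lemma sums_inverse_powers_3: "(\<lambda>i. 1 / 3 ^ Suc i) sums (1 / 2 :: real)"
proof -
  have "(\<lambda>i. (1 / 3) * (1 / 3) ^ i) sums ((1 / 3) * (1 / (1 - 1 / 3)) :: real)"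
    by (intro sums_mult geometric_sums) auto
  then show ?thesis by (simp add: power_one_over divide_simps)
qed

lemma summable_ternary_code: "summable (\<lambda>i. of_bool (b i) / 3 ^ Suc i :: real)"
  by (rule summable_comparison_test[OF _ sums_summable[OF sums_inverse_powers_3]])
    (auto intro!: exI[of _ 0])

lemma ternary_code_bounds: "0 \<le> ternary_code b" "ternary_code b \<le> 1 / 2"
proof -
  show "0 \<le> ternary_code b"
    unfolding ternary_code_def by (rule suminf_nonneg[OF summable_ternary_code]) auto
  show "ternary_code b \<le> 1 / 2"
    unfolding ternary_code_def sums_unique[OF sums_inverse_powers_3]
    by (rule suminf_le[OF _ summable_ternary_code sums_summable[OF sums_inverse_powers_3]]) auto
qed

lemma ternary_code_rec:
  "ternary_code b = (of_bool (b 0) + ternary_code (\<lambda>n. b (Suc n))) / 3"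
proof -
  have "ternary_code b = (\<Sum>i. of_bool (b (Suc i)) / 3 ^ Suc (Suc i)) + of_bool (b 0) / 3"
    unfolding ternary_code_def using suminf_split_head[OF summable_ternary_code[of b]] by simp
  also have "(\<Sum>i. of_bool (b (Suc i)) / 3 ^ Suc (Suc i)) = ternary_code (\<lambda>n. b (Suc n)) / (3::real)"
    unfolding ternary_code_def
    using suminf_divide[OF summable_ternary_code[of "\<lambda>n. b (Suc n)"], of 3]
    by (simp add: mult.commute mult.assoc)
  finally show ?thesis by (simp add: add_divide_distrib)
qed

text \<open>The threshold 1/4 is the middle of the gap that separates codes with first digit 0 from
  those with first digit 1; the recursion iterates the expanding map that drops the first digit. It
  is total on the reals, so that its measurability can be stated on \<open>borel\<close>.\<close>

primrec ternary_decode :: "nat \<Rightarrow> real \<Rightarrow> bool" where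
  "ternary_decode 0 y \<longleftrightarrow> y > 1 / 4"
| "ternary_decode (Suc n) y \<longleftrightarrow> ternary_decode n (3 * y - of_bool (y > 1 / 4))"

lemma ternary_code_gap: "ternary_code b \<le> 1 / 6 \<or> ternary_code b \<ge> 1 / 3"
  and ternary_code_first: "ternary_code b > 1 / 4 \<longleftrightarrow> b 0"
  using ternary_code_bounds[of "\<lambda>n. b (Suc n)"] ternary_code_rec[of b] by (cases "b 0"; simp)+

lemma ternary_code_tail:
  "3 * ternary_code b - of_bool (ternary_code b > 1 / 4) = ternary_code (\<lambda>n. b (Suc n))"
  unfolding ternary_code_first using ternary_code_rec[of b] by simp

lemma ternary_decode_code: "ternary_decode n (ternary_code b) \<longleftrightarrow> b n"
proof (induction n arbitrary: b)
  case 0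
  show ?case using ternary_code_first[of b] by simp
next
  case (Suc n)
  show ?case using Suc[of "\<lambda>n. b (Suc n)"] by (simp only: ternary_decode.simps ternary_code_tail)
qed

lemma measurable_ternary_decode [measurable]: "Measurable.pred borel (ternary_decode n)"
proof (induction n)
  case (Suc n)
  note [measurable] = Suc
  show ?case by simp
qed simp

text \<open>The codes avoid the gap between 1/6 and 1/3, so each digit is a continuous function of them.\<close>

lemma convergent_ternary_code_first:
  assumes "convergent (\<lambda>k. ternary_code (b k))"
  shows "\<exists>v. \<forall>\<^sub>F k in sequentially. b k 0 = v"
proof -
  \<comment> \<open>1/6 is the width of the gap, so codes that are closer than this lie on the same
    side of it.\<close>
  have "\<exists>N. \<forall>m\<ge>N. \<forall>n\<ge>N. dist (ternary_code (b m)) (ternary_code (b n)) < 1 / 6"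
    using convergent_Cauchy[OF assms] unfolding Cauchy_def
    by (metis zero_less_divide_1_iff zero_less_numeral)
  then obtain N where
    N: "\<And>m n. m \<ge> N \<Longrightarrow> n \<ge> N \<Longrightarrow> dist (ternary_code (b m)) (ternary_code (b n)) < 1 / 6"
    by blast
  have "b m 0 = b N 0" if "m \<ge> N" for m
    using N[OF that order_refl] ternary_code_gap[of "b m"] ternary_code_gap[of "b N"]
      ternary_code_first[of "b m"] ternary_code_first[of "b N"]
    by (auto simp: dist_real_def)
  then show ?thesis by (auto simp: eventually_sequentially)
qed

text \<open>Once the first digit is constant, dropping it is an affine map of the code. The codes of
  the tails converge again, and the induction hypothesis applies to them.\<close>

lemma convergent_ternary_code_digit:
  assumes "convergent (\<lambda>k. ternary_code (b k))"
  shows "\<exists>v. \<forall>\<^sub>F k in sequentially. b k n = v"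
  using assms
proof (induction n arbitrary: b)
  case 0
  then show ?case by (rule convergent_ternary_code_first)
next
  case (Suc n)
  obtain v where v: "\<forall>\<^sub>F k in sequentially. b k 0 = v"
    using convergent_ternary_code_first[OF Suc.prems] by blast
  obtain l where "(\<lambda>k. ternary_code (b k)) \<longlonglongrightarrow> l"
    using Suc.prems by (auto simp: convergent_def)
  then have "(\<lambda>k. 3 * ternary_code (b k) - of_bool v) \<longlonglongrightarrow> 3 * l - of_bool v"
    by (intro tendsto_intros)
  moreover have "\<forall>\<^sub>F k in sequentially.
      3 * ternary_code (b k) - of_bool v = ternary_code (\<lambda>n. b k (Suc n))"
    using v by eventually_elim (simp only: ternary_code_tail[symmetric] ternary_code_first)
  ultimately have "(\<lambda>k. ternary_code (\<lambda>n. b k (Suc n))) \<longlonglongrightarrow> 3 * l - of_bool v"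
    by (rule Lim_transform_eventually)
  then have "convergent (\<lambda>k. ternary_code (\<lambda>n. b k (Suc n)))" by (auto simp: convergent_def)
  from Suc.IH[OF this] show ?case .
qed

section \<open>Recovering a point from its digits\<close>

lemma dense_sequence:
  obtains D :: "nat \<Rightarrow> 'a::{metric_space, second_countable_topology}"
  where "\<And>x e. e > 0 \<Longrightarrow> \<exists>i. dist (D i) x < e"
proof -
  obtain C :: "'a set" where C: "countable C" "\<And>U. open U \<Longrightarrow> U \<noteq> {} \<Longrightarrow> \<exists>c\<in>C. c \<in> U"
    using countable_dense_setE by blast
  have "C \<noteq> {}" using C(2)[of UNIV] by auto
  then have "range (from_nat_into C) = C" using C(1) by (rule range_from_nat_into)
  moreover have "\<exists>c\<in>C. dist c x < e" if "e > 0" for x e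
  proof -
    have "ball x e \<noteq> {}" using that by simp
    then obtain c where "c \<in> C" "c \<in> ball x e" using C(2)[OF open_ball] by blast
    then show ?thesis by (auto simp: dist_commute)
  qed
  ultimately show ?thesis using that[of "from_nat_into C"] by (metis rangeE)
qed

text \<open>Digits that record membership in small balls around a dense sequence determine the
  point: \<open>a m y\<close> is the first centre whose ball of radius \<open>1 / Suc m\<close> is
  reported by \<open>y\<close>. As \<open>d\<close> is Borel on the whole line, random reals can be
  turned back into random points without any discussion of the range of the code.\<close>

lemma Borel_left_inverse_ternary_code:
  fixes B :: "nat \<Rightarrow> 'a::polish_space set" and D :: "nat \<Rightarrow> 'a"
  assumes balls: "\<And>i m. \<exists>j. B j = ball (D i) (1 / Suc m)"
    and dense: "\<And>x e. e > 0 \<Longrightarrow> \<exists>i. dist (D i) x < e"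
  obtains d where "d \<in> borel_measurable borel" "\<And>x. d (ternary_code (\<lambda>j. x \<in> B j)) = x"
proof -
  obtain J where J: "\<And>i m. B (J i m) = ball (D i) (1 / Suc m)" using balls by metis
  define a where "a m y = D (LEAST i. ternary_decode (J i m) y)" for m y
  have [measurable]: "a m \<in> borel_measurable borel" for m
  proof -
    have "(\<lambda>y. LEAST i. ternary_decode (J i m) y) \<in> measurable borel (count_space UNIV)"
      by measurable
    then show ?thesis unfolding a_def by (rule measurable_compose) simp
  qed
  \<comment> \<open>Off the range of the code the centres need not converge; the default
    \<open>D 0\<close> makes the limit exist at every real.\<close>
  define a' where "a' m y = (if Cauchy (\<lambda>m. a m y) then a m y else D 0)" for m y
  have a'_meas: "a' m \<in> borel_measurable borel" for m
    unfolding a'_def by measurable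
  have "convergent (\<lambda>m. a' m y)" for y
    by (cases "Cauchy (\<lambda>m. a m y)") (auto simp: a'_def intro: Cauchy_convergent convergent_const)
  then obtain d where d: "\<And>y. (\<lambda>m. a' m y) \<longlonglongrightarrow> d y" unfolding convergent_def by metis
  show ?thesis
  proof
    show "d \<in> borel_measurable borel"
      by (rule borel_measurable_LIMSEQ_metric[of a']) (use a'_meas d in auto)
    fix x
    let ?y = "ternary_code (\<lambda>j. x \<in> B j)"
    have "dist (a m ?y) x < 1 / Suc m" for m
    proof -
      obtain i where "dist (D i) x < 1 / Suc m" using dense[of "1 / Suc m" x] by auto
      then have "x \<in> B (J i m)" by (simp add: J)
      then have "x \<in> B (J (LEAST i. x \<in> B (J i m)) m)" by (rule LeastI)
      then show ?thesis by (simp add: a_def ternary_decode_code J)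
    qed
    then have "(\<lambda>m. dist (a m ?y) x) \<longlonglongrightarrow> 0"
      by (intro tendsto_sandwich[OF _ _ tendsto_const LIMSEQ_Suc[OF lim_inverse_n']])
        (auto simp: less_imp_le)
    then have lim: "(\<lambda>m. a m ?y) \<longlonglongrightarrow> x" by (rule tendsto_dist_iff[THEN iffD2])
    then have "Cauchy (\<lambda>m. a m ?y)" by (rule LIMSEQ_imp_Cauchy)
    then have "(\<lambda>m. a' m ?y) \<longlonglongrightarrow> x" using lim by (simp add: a'_def)
    with d show "d ?y = x" using LIMSEQ_unique by blast
  qed
qed

text \<open>The codes lie in a bounded interval, so their laws are tight whatever the measures
  \<open>M n\<close> are. Convergence of the codes makes every digit stabilise. The sets
  \<open>B i\<close> are free: they are the questions whose answers are to stabilise, and each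
  application chooses those that force the convergence it wants.\<close>

lemma subsequence_with_stabilising_digits:
  fixes M :: "nat \<Rightarrow> 'a::polish_space measure" and B :: "nat \<Rightarrow> 'a set"
  assumes sets_M: "\<And>n. sets (M n) = sets borel" and prob_M: "\<And>n. prob_space (M n)"
    and B: "\<And>i. B i \<in> sets borel"
  obtains r :: "nat \<Rightarrow> nat" and \<Omega> :: "real measure" and X :: "nat \<Rightarrow> real \<Rightarrow> 'a"
  where "strict_mono r" "prob_space \<Omega>" "\<And>n. X n \<in> measurable \<Omega> borel"
    "\<And>n. distr \<Omega> borel (X n) = M (r n)"
    "AE \<omega> in \<Omega>. \<forall>i. \<exists>v. \<forall>\<^sub>F n in sequentially. (X n \<omega> \<in> B i) = v"
proof -
  obtain D :: "nat \<Rightarrow> 'a" where dense: "\<And>x e. e > 0 \<Longrightarrow> \<exists>i. dist (D i) x < e"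
    by (rule dense_sequence) blast
  \<comment> \<open>Even digits are the prescribed sets, odd digits the balls that make the code
    invertible.\<close>
  define B' where "B' k = (if even k then B (k div 2)
     else case prod_decode (k div 2) of (i, m) \<Rightarrow> ball (D i) (1 / Suc m))" for k
  have B'_even: "B' (2 * i) = B i" for i by (simp add: B'_def)
  have B'_odd: "B' (Suc (2 * prod_encode (i, m))) = ball (D i) (1 / Suc m)" for i m
    by (simp add: B'_def)
  have B'_meas [measurable]: "B' k \<in> sets borel" for k
    using B by (auto simp: B'_def split: prod.split)
  define c where "c x = ternary_code (\<lambda>j. x \<in> B' j)" for x
  have c_meas [measurable]: "c \<in> borel_measurable borel"
    unfolding c_def ternary_code_def by measurable
  obtain d where d_meas [measurable]: "d \<in> borel_measurable borel" and dc: "\<And>x. d (c x) = x"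
    using Borel_left_inverse_ternary_code[of B' D] B'_odd dense unfolding c_def by metis
  have cM: "c \<in> measurable (M n) borel" for n
    using c_meas by (simp cong: measurable_cong_sets add: sets_M)
  define \<rho> where "\<rho> n = distr (M n) borel c" for n
  have real_\<rho>: "real_distribution (\<rho> n)" for n
    unfolding \<rho>_def real_distribution_def real_distribution_axioms_def
    using prob_space.prob_space_distr[OF prob_M cM] by simp
  have "tight \<rho>"
    unfolding tight_def
  proof (intro conjI allI impI)
    fix e :: real assume "e > 0"
    have "measure (\<rho> n) {-1<..1} = 1" for n
    proof -
      have "c -` {-1<..1} \<inter> space (M n) = space (M n)"
      proof -
        have "c x \<in> {-1<..1}" for x
          using ternary_code_bounds[of "\<lambda>j. x \<in> B' j"] by (simp add: c_def)
        then show ?thesis by blast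
      qed
      then show ?thesis unfolding \<rho>_def using cM prob_space.prob_space[OF prob_M]
        by (simp add: measure_distr)
    qed
    then show "\<exists>a b. a < b \<and> (\<forall>n. 1 - e < measure (\<rho> n) {a<..b})"
      using \<open>e > 0\<close> by (intro exI[of _ "-1"] exI[of _ 1]) auto
  qed (rule real_\<rho>)
  then obtain r \<rho>' where r: "strict_mono r" "real_distribution \<rho>'" "weak_conv_m (\<rho> \<circ> r) \<rho>'"
    using tight_imp_convergent_subsubsequence[of \<rho> id] by (auto simp: strict_mono_def)
  obtain \<Omega> :: "real measure" and Y where \<Omega>: "prob_space \<Omega>"
    and Y [measurable]: "\<And>n. Y n \<in> measurable \<Omega> borel"
    and distr_Y: "\<And>n. distr \<Omega> borel (Y n) = \<rho> (r n)"
    and conv: "\<And>\<omega>. \<omega> \<in> space \<Omega> \<Longrightarrow> convergent (\<lambda>n. Y n \<omega>)"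
  proof -
    have "\<And>n. real_distribution ((\<rho> \<circ> r) n)" by (simp add: real_\<rho>)
    from Skorohod[OF this r(2,3)] obtain \<Omega> :: "real measure" and Y Y' where
      "prob_space \<Omega>" "\<And>n. Y n \<in> measurable \<Omega> borel"
      "\<And>n. distr \<Omega> borel (Y n) = (\<rho> \<circ> r) n"
      "\<And>\<omega>. \<omega> \<in> space \<Omega> \<Longrightarrow> (\<lambda>n. Y n \<omega>) \<longlonglongrightarrow> Y' \<omega>"
      by metis
    then show ?thesis
      by (intro that[of \<Omega> Y]) (unfold convergent_def comp_def, blast+)
  qed
  interpret prob_space \<Omega> by (rule \<Omega>)
  show ?thesis
  proof (rule that[of r \<Omega> "\<lambda>n \<omega>. d (Y n \<omega>)"])
    show "(\<lambda>\<omega>. d (Y n \<omega>)) \<in> measurable \<Omega> borel" for n by measurable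
    show "distr \<Omega> borel (\<lambda>\<omega>. d (Y n \<omega>)) = M (r n)" for n
    proof -
      have "distr \<Omega> borel (\<lambda>\<omega>. d (Y n \<omega>)) = distr (\<rho> (r n)) borel d"
        by (simp add: distr_Y[symmetric] distr_distr comp_def)
      also have "\<dots> = distr (M (r n)) borel (\<lambda>x. d (c x))"
        unfolding \<rho>_def by (subst distr_distr) (auto simp: comp_def cM)
      also have "\<dots> = M (r n)" unfolding dc
        by (rule distr_id2) (simp add: sets_M)
      finally show ?thesis .
    qed
    \<comment> \<open>\<open>Y n\<close> has the law of a code, hence is almost surely the code of
      the point to which it decodes. Only therefore do the digits of the decoded points inherit the
      convergence of \<open>Y n\<close>.\<close>
    have "AE y in \<rho> (r n). c (d y) = y" for n
      unfolding \<rho>_def by (subst AE_distr_iff) (auto simp: dc cM)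
    then have "AE \<omega> in \<Omega>. c (d (Y n \<omega>)) = Y n \<omega>" for n
      unfolding distr_Y[symmetric] by (subst (asm) AE_distr_iff) auto
    then have "AE \<omega> in \<Omega>. \<forall>n. c (d (Y n \<omega>)) = Y n \<omega>" by (simp add: AE_all_countable)
    then show "AE \<omega> in \<Omega>. \<forall>i. \<exists>v. \<forall>\<^sub>F n in sequentially. (d (Y n \<omega>) \<in> B i) = v"
      using AE_space
    proof eventually_elim
      case (elim \<omega>)
      then have "convergent (\<lambda>n. c (d (Y n \<omega>)))" using conv by simp
      then show ?case
        unfolding c_def by (subst B'_even[symmetric]) (intro allI convergent_ternary_code_digit)
    qed
  qed (use r \<Omega> in auto)
qed

section \<open>Almost surely weakly convergent representations\<close>

text \<open>If \<open>x\<close> represents \<open>L\<close>, then \<open>J z\<close> equals |z -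
  x|^2 - |x|^2, so \<open>x\<close> is sought as a minimiser of \<open>J\<close>. The parallelogram
  identity makes a minimising sequence Cauchy, and the variation of \<open>J\<close> in direction
  \<open>w\<close> at the limit yields the equation.\<close>

lemma Riesz_representation:
  fixes L :: "'a::{real_inner, complete_space} \<Rightarrow> real"
  assumes "linear L" and bound: "\<And>z. \<bar>L z\<bar> \<le> K * norm z"
  shows "\<exists>x. \<forall>z. L z = inner x z"
proof -
  interpret L: linear L by fact
  have "bounded_linear L"
    using bound by (intro bounded_linear_intro[of _ K] L.add L.scale) (auto simp: mult.commute)
  then have L_lim: "(\<lambda>n. L (z n)) \<longlonglongrightarrow> L l" if "z \<longlonglongrightarrow> l" for z l
    using that by (rule bounded_linear.tendsto)
  define J where "J z = (norm z)\<^sup>2 - 2 * L z" for z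
  have J_lower: "- K\<^sup>2 \<le> J z" for z
  proof -
    have "0 \<le> (norm z - K)\<^sup>2" by simp
    then show ?thesis using bound[of z] unfolding J_def power2_diff by (simp add: algebra_simps)
  qed
  define m where "m = Inf (range J)"
  have m_le: "m \<le> J z" for z
    unfolding m_def by (rule cInf_lower) (use J_lower in \<open>auto intro!: bdd_belowI[of _ "- K\<^sup>2"]\<close>)
  have "\<exists>z. J z < m + 1 / Suc n" for n
    using cInf_lessD[of "range J" "m + 1 / Suc n"] by (auto simp: m_def)
  then obtain z where z: "\<And>n. J (z n) < m + 1 / Suc n" by metis
  have par: "(norm (z i - z j))\<^sup>2 \<le> 2 / Suc i + 2 / Suc j" for i j
  proof -
    have "(norm (z i - z j))\<^sup>2 = 2 * J (z i) + 2 * J (z j) - 4 * J ((1 / 2) *\<^sub>R (z i + z j))"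
      unfolding J_def L.scale L.add norm_scaleR power_mult_distrib power2_norm_eq_inner
      by (simp add: inner_diff_left inner_diff_right inner_add_left inner_add_right inner_commute
        algebra_simps power2_eq_square)
    then show ?thesis using z[of i] z[of j] m_le[of "(1 / 2) *\<^sub>R (z i + z j)"] by simp
  qed
  have "Cauchy z"
  proof (rule metric_CauchyI)
    fix e :: real assume "e > 0"
    obtain N where N: "4 / e\<^sup>2 < real N" using reals_Archimedean2 by blast
    have "dist (z i) (z j) < e" if "i \<ge> N" "j \<ge> N" for i j
    proof -
      have "2 / Suc k < e\<^sup>2 / 2" if "k \<ge> N" for k
      proof -
        have "4 / e\<^sup>2 < Suc k" using N that by linarith
        then show ?thesis using \<open>e > 0\<close> by (simp add: field_simps)
      qed
      from this[OF that(1)] this[OF that(2)] have "(norm (z i - z j))\<^sup>2 < e\<^sup>2"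
        using par[of i j] by linarith
      then show ?thesis
        using \<open>e > 0\<close> unfolding dist_norm by (metis less_imp_le power_less_imp_less_base)
    qed
    then show "\<exists>M. \<forall>m\<ge>M. \<forall>n\<ge>M. dist (z m) (z n) < e" by blast
  qed
  then obtain x where x: "z \<longlonglongrightarrow> x" using Cauchy_convergent unfolding convergent_def by blast
  have "(\<lambda>n. J (z n)) \<longlonglongrightarrow> J x" unfolding J_def by (intro tendsto_intros x L_lim)
  moreover have "(\<lambda>n. m + 1 / Suc n) \<longlonglongrightarrow> m + 0"
    by (intro tendsto_intros LIMSEQ_Suc[OF lim_inverse_n'])
  ultimately have "J x \<le> m" using z by (auto intro: LIMSEQ_le less_imp_le)
  have "L w = inner x w" for w
  proof -
    define a where "a = inner x w - L w"
    define q where "q = (norm w)\<^sup>2"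
    \<comment> \<open>At this \<open>t\<close> the increment of \<open>J\<close> is a negative
      multiple of the square of \<open>a\<close>. The added 1 keeps the quotient meaningful for
      \<open>w = 0\<close>.\<close>
    define t where "t = - a / (q + 1)"
    have "q \<ge> 0" by (simp add: q_def)
    have "J (x + t *\<^sub>R w) = J x + 2 * t * a + t\<^sup>2 * q"
      unfolding J_def L.add L.scale a_def q_def power2_norm_eq_inner
      by (simp add: inner_add_left inner_add_right inner_commute algebra_simps power2_eq_square)
    then have "0 \<le> 2 * t * a + t\<^sup>2 * q" using m_le[of "x + t *\<^sub>R w"] \<open>J x \<le> m\<close> by linarith
    then have "0 \<le> (2 * t * a + t\<^sup>2 * q) * (q + 1)\<^sup>2" using \<open>q \<ge> 0\<close> by simp
    also have "\<dots> = 2 * (t * (q + 1)) * a * (q + 1) + (t * (q + 1))\<^sup>2 * q"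
      by (simp add: algebra_simps power2_eq_square)
    also have "t * (q + 1) = - a" using \<open>q \<ge> 0\<close> by (simp add: t_def)
    also have "2 * - a * a * (q + 1) + (- a)\<^sup>2 * q = - a\<^sup>2 * (q + 2)"
      by (simp add: algebra_simps power2_eq_square)
    finally have "a\<^sup>2 * (q + 2) \<le> 0" by simp
    then have "a\<^sup>2 \<le> 0" using \<open>q \<ge> 0\<close> by (auto simp: mult_le_0_iff)
    then show ?thesis by (simp add: a_def)
  qed
  then show ?thesis by blast
qed

text \<open>The norm bound makes the pairings equicontinuous in the second argument, so that
  convergence on a dense sequence spreads to all vectors. The limit is a bounded linear functional
  and is represented by a vector.\<close>

lemma weak_limit_exists:
  fixes x :: "nat \<Rightarrow> 'a::{real_inner, polish_space}"
  assumes bound: "\<And>n. norm (x n) \<le> K"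
    and dense: "\<And>z e. e > 0 \<Longrightarrow> \<exists>i::nat. dist (D i) z < e"
    and conv: "\<And>i. convergent (\<lambda>n. inner (x n) (D i))"
  shows "\<exists>l. weakly_tendsto x l"
proof -
  have "K \<ge> 0" using norm_ge_zero[of "x 0"] bound[of 0] by linarith
  have conv': "convergent (\<lambda>n. inner (x n) z)" for z
  proof -
    have "Cauchy (\<lambda>n. inner (x n) z)"
    proof (rule metric_CauchyI)
      fix e :: real assume "e > 0"
      then have "e / (4 * (K + 1)) > 0" using \<open>K \<ge> 0\<close> by simp
      then obtain i where i: "dist (D i) z < e / (4 * (K + 1))" using dense by blast
      have close: "\<bar>inner (x n) z - inner (x n) (D i)\<bar> \<le> e / 4" for n
      proof -
        have "\<bar>inner (x n) (z - D i)\<bar> \<le> norm (x n) * norm (z - D i)" by (rule Cauchy_Schwarz_ineq2)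
        also have "\<dots> \<le> (K + 1) * (e / (4 * (K + 1)))"
          using bound[of n] i \<open>K \<ge> 0\<close> by (intro mult_mono) (auto simp: dist_norm norm_minus_commute)
        also have "\<dots> = e / 4" using \<open>K \<ge> 0\<close> by (simp add: field_simps)
        finally show ?thesis by (simp add: inner_diff_right)
      qed
      obtain N where N: "\<And>m n. m \<ge> N \<Longrightarrow> n \<ge> N \<Longrightarrow> dist (inner (x m) (D i)) (inner (x n) (D i)) < e / 4"
        using metric_CauchyD[OF convergent_Cauchy[OF conv[of i]], of "e / 4"] \<open>e > 0\<close> by auto
      have "dist (inner (x m) z) (inner (x n) z) < e" if "m \<ge> N" "n \<ge> N" for m n
        using N[OF that] close[of m] close[of n] \<open>e > 0\<close> unfolding dist_real_def by linarith
      then show "\<exists>M. \<forall>m\<ge>M. \<forall>n\<ge>M. dist (inner (x m) z) (inner (x n) z) < e" by blast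
    qed
    then show ?thesis by (rule Cauchy_convergent)
  qed
  define L where "L z = lim (\<lambda>n. inner (x n) z)" for z
  have L: "(\<lambda>n. inner (x n) z) \<longlonglongrightarrow> L z" for z
    using conv' unfolding L_def by (simp add: convergent_LIMSEQ_iff)
  have "linear L"
  proof (rule linearI)
    fix a b show "L (a + b) = L a + L b"
      using tendsto_add[OF L L, of a b] L[of "a + b"] by (auto simp: inner_add_right intro: LIMSEQ_unique)
  next
    fix r b show "L (r *\<^sub>R b) = r *\<^sub>R L b"
      using tendsto_mult_left[OF L, of r b] L[of "r *\<^sub>R b"] by (auto intro: LIMSEQ_unique)
  qed
  moreover have "\<bar>L z\<bar> \<le> K * norm z" for z
  proof (rule LIMSEQ_le_const2)
    show "(\<lambda>n. \<bar>inner (x n) z\<bar>) \<longlonglongrightarrow> \<bar>L z\<bar>" by (intro tendsto_rabs L)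
    have "\<bar>inner (x n) z\<bar> \<le> K * norm z" for n
      by (rule order_trans[OF Cauchy_Schwarz_ineq2 mult_right_mono[OF bound norm_ge_zero]])
    then show "\<exists>N. \<forall>n\<ge>N. \<bar>inner (x n) z\<bar> \<le> K * norm z" by blast
  qed
  ultimately obtain l where "\<And>z. L z = inner l z" using Riesz_representation by blast
  then show ?thesis using L unfolding weakly_tendsto_def by metis
qed

text \<open>For the converse, approximating \<open>v\<close> itself by members of the sequence gives
  \<open>inner v v \<le> r * norm v\<close>. Countably many linear conditions thus describe a ball,
  which is what measurability needs.\<close>

lemma norm_le_iff_dense:
  fixes v :: "'a::real_inner"
  assumes dense: "\<And>z e. e > 0 \<Longrightarrow> \<exists>i::nat. dist (D i) z < e" and "r \<ge> 0"
  shows "norm v \<le> r \<longleftrightarrow> (\<forall>i. inner v (D i) \<le> r * norm (D i))"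
proof
  assume "norm v \<le> r"
  then show "\<forall>i. inner v (D i) \<le> r * norm (D i)"
    by (meson mult_right_mono norm_cauchy_schwarz norm_ge_zero order_trans)
next
  assume *: "\<forall>i. inner v (D i) \<le> r * norm (D i)"
  have "\<exists>i. dist (D i) v < 1 / Suc n" for n using dense[of "1 / Suc n" v] by simp
  then obtain f where f: "\<And>n. dist (D (f n)) v < 1 / Suc n" by metis
  have "(\<lambda>n. D (f n)) \<longlonglongrightarrow> v"
    by (rule tendsto_dist_iff[THEN iffD2],
        rule tendsto_sandwich[OF _ _ tendsto_const LIMSEQ_Suc[OF lim_inverse_n']])
      (use f in \<open>auto simp: less_imp_le\<close>)
  then have "inner v v \<le> r * norm v"
    by (intro LIMSEQ_le[OF tendsto_inner[OF tendsto_const] tendsto_mult_left[OF tendsto_norm]])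
      (use * in auto)
  then show "norm v \<le> r"
    by (cases "v = 0") (use \<open>r \<ge> 0\<close> in \<open>auto simp: power2_norm_eq_inner[symmetric] power2_eq_square\<close>)
qed

text \<open>Pettis measurability: an open set is a countable union of balls, and each ball is cut
  out by countably many conditions on inner products. It serves for the measurability of weak limits
  and, applied to the identity, to show that half-spaces generate the Borel sets.\<close>

lemma borel_measurable_if_inner_measurable:
  fixes f :: "'b \<Rightarrow> 'a::{real_inner, polish_space}"
  assumes meas [measurable]: "\<And>z. (\<lambda>x. inner (f x) z) \<in> borel_measurable M"
  shows "f \<in> borel_measurable M"
proof (rule borel_measurableI)
  obtain D :: "nat \<Rightarrow> 'a" where D: "\<And>x e. e > 0 \<Longrightarrow> \<exists>i. dist (D i) x < e"
    by (rule dense_sequence) blast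
  have [measurable]: "(\<lambda>x. norm (f x - c)) \<in> borel_measurable M" for c
  proof (subst borel_measurable_iff_le, intro allI)
    fix r :: real
    show "{x \<in> space M. norm (f x - c) \<le> r} \<in> sets M"
    proof (cases "r \<ge> 0")
      case True
      have "{x \<in> space M. norm (f x - c) \<le> r} =
          {x \<in> space M. \<forall>i. inner (f x) (D i) - inner c (D i) \<le> r * norm (D i)}"
        using norm_le_iff_dense[OF D True, of _] by (auto simp: inner_diff_left)
      also have "\<dots> \<in> sets M" by measurable
      finally show ?thesis .
    next
      case False
      then have "{x \<in> space M. norm (f x - c) \<le> r} = {}"
        using norm_ge_zero order_trans by blast
      then show ?thesis by (simp only: sets.empty_sets)
    qed
  qed
  fix U :: "'a set" assume "open U"
  have "x \<in> U \<longleftrightarrow> (\<exists>i m. ball (D i) (1 / Suc m) \<subseteq> U \<and> norm (x - D i) < 1 / Suc m)" for x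
  proof
    assume "x \<in> U"
    then obtain e where e: "e > 0" "ball x e \<subseteq> U" using \<open>open U\<close> openE by blast
    obtain m where m: "1 / Suc m < e / 2" using e(1) by (meson half_gt_zero nat_approx_posE)
    obtain i where i: "dist (D i) x < 1 / Suc m" using D[of "1 / Suc m" x] by auto
    have "ball (D i) (1 / Suc m) \<subseteq> ball x e"
    proof
      fix y assume "y \<in> ball (D i) (1 / Suc m)"
      then show "y \<in> ball x e"
        using i m dist_triangle[of x y "D i"] by (simp add: dist_commute)
    qed
    then show "\<exists>i m. ball (D i) (1 / Suc m) \<subseteq> U \<and> norm (x - D i) < 1 / Suc m"
      using e(2) i by (intro exI[of _ i] exI[of _ m]) (simp add: dist_norm norm_minus_commute)
  qed (auto simp: dist_norm norm_minus_commute)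
  then have "f -` U \<inter> space M =
      {x \<in> space M. \<exists>i m. ball (D i) (1 / Suc m) \<subseteq> U \<and> norm (f x - D i) < 1 / Suc m}"
    by auto
  also have "\<dots> \<in> sets M" by measurable
  finally show "f -` U \<inter> space M \<in> sets M" .
qed

text \<open>A convergent subsequence tells on which side of a rational its terms finally lie. A
  truth value that stabilises for the whole sequence must agree with it.\<close>

lemma convergent_if_rational_comparisons_stabilise:
  fixes s :: "nat \<Rightarrow> real"
  assumes bound: "\<And>n. \<bar>s n\<bar> \<le> K"
    and stab: "\<And>q::rat. \<exists>v. \<forall>\<^sub>F n in sequentially. (s n > of_rat q) = v"
  shows "convergent s"
proof -
  have "bounded (range s)" using bound by (auto intro!: boundedI[of _ K])
  then obtain l r where r: "strict_mono r" "(s \<circ> r) \<longlonglongrightarrow> l"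
    using bounded_imp_convergent_subsequence by blast
  have ev: "\<forall>\<^sub>F n in sequentially. P n"
    if "\<forall>\<^sub>F n in sequentially. P n = v" "\<forall>\<^sub>F n in sequentially. P (r n)" for P v
  proof -
    have "\<forall>\<^sub>F n in sequentially. P (r n) = v" using eventually_subseq[OF r(1) that(1)] .
    with that(2) have "\<forall>\<^sub>F n in sequentially. v" by eventually_elim simp
    then have v by simp
    then show ?thesis using that(1) by simp
  qed
  have "s \<longlonglongrightarrow> l"
  proof (rule order_tendstoI)
    fix a assume "a < l"
    then obtain q where q: "a < of_rat q" "of_rat q < l" using of_rat_dense by blast
    obtain v where v: "\<forall>\<^sub>F n in sequentially. (s n > of_rat q) = v" using stab by blast
    have "\<forall>\<^sub>F n in sequentially. s (r n) > of_rat q"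
      using order_tendstoD(1)[OF r(2) q(2)] by simp
    from ev[OF v this] show "\<forall>\<^sub>F n in sequentially. a < s n"
      by eventually_elim (use q in linarith)
  next
    fix a assume "l < a"
    then obtain q where q: "l < of_rat q" "of_rat q < a" using of_rat_dense by blast
    obtain v where "\<forall>\<^sub>F n in sequentially. (s n > of_rat q) = v" using stab by blast
    then have v: "\<forall>\<^sub>F n in sequentially. (\<not> s n > of_rat q) = (\<not> v)" by eventually_elim simp
    have "\<forall>\<^sub>F n in sequentially. \<not> s (r n) > of_rat q"
      using order_tendstoD(2)[OF r(2) q(1)] by eventually_elim simp
    from ev[OF v this] show "\<forall>\<^sub>F n in sequentially. s n < a"
      by eventually_elim (use q in linarith)
  qed
  then show ?thesis by (auto simp: convergent_def)
qed

section \<open>Weak lower semicontinuity of the norm and boundedness\<close>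

lemma weakly_tendsto_norm_liminf:
  assumes "weakly_tendsto x l"
  shows "ennreal ((norm l)\<^sup>2) \<le> liminf (\<lambda>n. ennreal ((norm (x n))\<^sup>2))"
  unfolding le_Liminf_iff
proof (intro allI impI)
  fix y assume y: "y < ennreal ((norm l)\<^sup>2)"
  then obtain r where r: "y = ennreal r" "r \<ge> 0" by (cases y) auto
  with y have rl: "r < (norm l)\<^sup>2" by (simp add: ennreal_less_iff)
  then have sl: "sqrt r < norm l" by (simp add: real_less_lsqrt r)
  then have "norm l > 0" using r by (meson le_less_trans real_sqrt_ge_zero)
  have "(\<lambda>n. inner (x n) l) \<longlonglongrightarrow> inner l l" using assms unfolding weakly_tendsto_def by blast
  moreover have "sqrt r * norm l < inner l l"
    using sl \<open>norm l > 0\<close> by (simp add: power2_norm_eq_inner[symmetric] power2_eq_square)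
  ultimately have "\<forall>\<^sub>F n in sequentially. sqrt r * norm l < inner (x n) l"
    by (rule order_tendstoD)
  then show "\<forall>\<^sub>F n in sequentially. y < ennreal ((norm (x n))\<^sup>2)"
  proof eventually_elim
    case (elim n)
    have "sqrt r * norm l < norm (x n) * norm l"
      using elim norm_cauchy_schwarz[of "x n" l] by linarith
    then have "sqrt r < norm (x n)" using \<open>norm l > 0\<close> by simp
    then have "(sqrt r)\<^sup>2 < (norm (x n))\<^sup>2" using r by (intro power_strict_mono) auto
    then show ?case using r by (simp add: ennreal_less_iff)
  qed
qed

lemma integral_le_iff_nn_integral:
  fixes f :: "'b \<Rightarrow> real"
  assumes "f \<in> borel_measurable M" "\<And>x. f x \<ge> 0" "C \<ge> 0"
  shows "(integrable M f \<and> integral\<^sup>L M f \<le> C) \<longleftrightarrow> (\<integral>\<^sup>+ x. ennreal (f x) \<partial>M) \<le> ennreal C"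
proof
  assume *: "integrable M f \<and> integral\<^sup>L M f \<le> C"
  then have "(\<integral>\<^sup>+ x. ennreal (f x) \<partial>M) = ennreal (integral\<^sup>L M f)"
    using assms by (intro nn_integral_eq_integral) auto
  then show "(\<integral>\<^sup>+ x. ennreal (f x) \<partial>M) \<le> ennreal C" using * by (simp add: ennreal_leI)
next
  assume *: "(\<integral>\<^sup>+ x. ennreal (f x) \<partial>M) \<le> ennreal C"
  then have i: "integrable M f"
    using assms by (intro integrableI_nonneg) (auto intro: le_less_trans)
  then have "(\<integral>\<^sup>+ x. ennreal (f x) \<partial>M) = ennreal (integral\<^sup>L M f)"
    using assms by (intro nn_integral_eq_integral) auto
  then show "integrable M f \<and> integral\<^sup>L M f \<le> C" using * i assms by (simp add: ennreal_le_iff)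
qed

lemma weak_Fatou:
  fixes X :: "nat \<Rightarrow> 'b \<Rightarrow> 'a::{real_inner, polish_space}"
  assumes [measurable]: "\<And>n. X n \<in> borel_measurable M" "Y \<in> borel_measurable M"
    and moment: "\<And>n. integrable M (\<lambda>\<omega>. (norm (X n \<omega>))\<^sup>2)" "\<And>n. (\<integral>\<omega>. (norm (X n \<omega>))\<^sup>2 \<partial>M) \<le> C"
    and weak: "AE \<omega> in M. weakly_tendsto (\<lambda>n. X n \<omega>) (Y \<omega>)"
  shows "integrable M (\<lambda>\<omega>. (norm (Y \<omega>))\<^sup>2)" "(\<integral>\<omega>. (norm (Y \<omega>))\<^sup>2 \<partial>M) \<le> C"
proof -
  have "C \<ge> 0" by (rule order_trans[OF _ moment(2)[of 0]]) simp
  have le: "(\<integral>\<^sup>+ \<omega>. ennreal ((norm (X n \<omega>))\<^sup>2) \<partial>M) \<le> ennreal C" for n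
    by (subst integral_le_iff_nn_integral[symmetric]) (use moment \<open>C \<ge> 0\<close> in auto)
  have "(\<integral>\<^sup>+ \<omega>. ennreal ((norm (Y \<omega>))\<^sup>2) \<partial>M) \<le> (\<integral>\<^sup>+ \<omega>. liminf (\<lambda>n. ennreal ((norm (X n \<omega>))\<^sup>2)) \<partial>M)"
  proof (rule nn_integral_mono_AE)
    show "AE \<omega> in M. ennreal ((norm (Y \<omega>))\<^sup>2) \<le> liminf (\<lambda>n. ennreal ((norm (X n \<omega>))\<^sup>2))"
      using weak by eventually_elim (rule weakly_tendsto_norm_liminf)
  qed
  also have "\<dots> \<le> liminf (\<lambda>n. \<integral>\<^sup>+ \<omega>. ennreal ((norm (X n \<omega>))\<^sup>2) \<partial>M)"
    by (rule nn_integral_liminf) measurable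
  also have "\<dots> \<le> liminf (\<lambda>n::nat. ennreal C)" by (rule Liminf_mono) (use le in auto)
  also have "\<dots> = ennreal C" by (simp add: Liminf_const)
  finally have "integrable M (\<lambda>\<omega>. (norm (Y \<omega>))\<^sup>2) \<and> (\<integral>\<omega>. (norm (Y \<omega>))\<^sup>2 \<partial>M) \<le> C"
    by (subst integral_le_iff_nn_integral) (use \<open>C \<ge> 0\<close> in auto)
  then show "integrable M (\<lambda>\<omega>. (norm (Y \<omega>))\<^sup>2)" "(\<integral>\<omega>. (norm (Y \<omega>))\<^sup>2 \<partial>M) \<le> C" by auto
qed

text \<open>A finite liminf bounds the norms only along a subsequence; that a comparison with one
  large rational stabilises extends the bound to the whole tail.\<close>

lemma bounded_if_norm_comparisons_stabilise:
  fixes x :: "nat \<Rightarrow> 'a::real_normed_vector"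
  assumes stab: "\<And>q::rat. \<exists>v. \<forall>\<^sub>F n in sequentially. (norm (x n) > of_rat q) = v"
    and fin: "liminf (\<lambda>n. ennreal ((norm (x n))\<^sup>2)) < \<infinity>"
  shows "\<exists>K. \<forall>n. norm (x n) \<le> K"
proof -
  obtain c where c: "c \<ge> 0" "liminf (\<lambda>n. ennreal ((norm (x n))\<^sup>2)) = ennreal c"
    using fin by (cases "liminf (\<lambda>n. ennreal ((norm (x n))\<^sup>2))") auto
  obtain k :: nat where k: "k > c" using reals_Archimedean2 by blast
  \<comment> \<open>The threshold is at least 1, so a norm above it has a square above
    \<open>k\<close>, and \<open>k\<close> exceeds the liminf.\<close>
  obtain v where v: "\<forall>\<^sub>F n in sequentially. (norm (x n) > of_rat (of_nat (Suc k))) = v"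
    using stab by blast
  have "\<not> v"
  proof
    assume v
    have "\<forall>\<^sub>F n in sequentially. ennreal k \<le> ennreal ((norm (x n))\<^sup>2)"
      using v
    proof eventually_elim
      case (elim n)
      then have "real (Suc k) < norm (x n)" using \<open>v\<close> by (simp only: of_rat_of_nat_eq)
      then have "real (Suc k) * 1 \<le> norm (x n) * norm (x n)"
        by (intro mult_mono) auto
      then show ?case by (intro ennreal_leI) (simp add: power2_eq_square)
    qed
    then have "ennreal k \<le> liminf (\<lambda>n. ennreal ((norm (x n))\<^sup>2))" by (rule Liminf_bounded)
    then show False using c k by (simp add: ennreal_le_iff2)
  qed
  then obtain N where N: "\<And>n. n \<ge> N \<Longrightarrow> norm (x n) \<le> Suc k"
    using v unfolding eventually_sequentially of_rat_of_nat_eq by (auto simp del: of_nat_Suc simp: not_less)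
  define K where "K = max (real (Suc k)) (Max ((\<lambda>n. norm (x n)) ` {..N}))"
  have "norm (x n) \<le> K" for n
  proof (cases "n \<ge> N")
    case True
    then show ?thesis using N[of n] by (simp add: K_def)
  next
    case False
    then have "norm (x n) \<le> Max ((\<lambda>n. norm (x n)) ` {..N})" by (intro Max_ge) auto
    then show ?thesis by (simp add: K_def)
  qed
  then show ?thesis by blast
qed

lemma P2D:
  assumes "\<mu> \<in> P2"
  shows "sets \<mu> = sets borel" "prob_space \<mu>" "integrable \<mu> (\<lambda>x. (norm x)\<^sup>2)" "space \<mu> = UNIV"
proof -
  show "sets \<mu> = sets borel" "prob_space \<mu>" "integrable \<mu> (\<lambda>x. (norm x)\<^sup>2)"
    using assms by (auto simp: P2_def)
  from sets_eq_imp_space_eq[OF this(1)] show "space \<mu> = UNIV" by simp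
qed

lemma P2_moment_of_law:
  assumes "X \<in> borel_measurable M" "distr M borel X = \<mu>" "\<mu> \<in> P2"
  shows "integrable M (\<lambda>\<omega>. (norm (X \<omega>))\<^sup>2)"
    "(\<integral>\<omega>. (norm (X \<omega>))\<^sup>2 \<partial>M) = (\<integral>x. (norm x)\<^sup>2 \<partial>\<mu>)"
  using P2D(3)[OF assms(3)] assms(1) unfolding assms(2)[symmetric]
  by (simp_all add: integrable_distr_eq integral_distr)

text \<open>The digits compare the norm and the pairings with a dense sequence with all rationals.
  Fatou's lemma makes the liminf of the squared norms finite almost everywhere, the norm digits turn
  this into boundedness, and the pairing digits then give a weak limit. Only second moments are
  controlled, as suits a space whose balls are weakly but not norm compact.\<close>

theorem weak_Skorohod_Prokhorov:
  fixes M :: "nat \<Rightarrow> 'a::{real_inner, polish_space} measure"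
  assumes P2: "\<And>n. M n \<in> P2" and moment: "\<And>n. (\<integral>x. (norm x)\<^sup>2 \<partial>M n) \<le> C"
  obtains r :: "nat \<Rightarrow> nat" and \<Omega> :: "real measure" and X :: "nat \<Rightarrow> real \<Rightarrow> 'a" and Y
  where "strict_mono r" "prob_space \<Omega>" "\<And>n. X n \<in> borel_measurable \<Omega>"
    "\<And>n. distr \<Omega> borel (X n) = M (r n)"
    "Y \<in> borel_measurable \<Omega>" "AE \<omega> in \<Omega>. weakly_tendsto (\<lambda>n. X n \<omega>) (Y \<omega>)"
proof -
  obtain D :: "nat \<Rightarrow> 'a" where D: "\<And>x e. e > 0 \<Longrightarrow> \<exists>i. dist (D i) x < e"
    by (rule dense_sequence) blast
  \<comment> \<open>First index 0 encodes the norm and \<open>Suc i\<close> the pairing with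
    \<open>D i\<close>.\<close>
  define B where "B k = (case from_nat k :: nat \<times> rat of (i, q) \<Rightarrow>
     if i = 0 then {x. norm x > of_rat q} else {x. inner x (D (i - 1)) > of_rat q})" for k
  have B_norm: "B (to_nat (0::nat, q)) = {x. norm x > of_rat q}" for q :: rat
    by (simp add: B_def)
  have B_inner: "B (to_nat (Suc i, q)) = {x. inner x (D i) > of_rat q}" for i and q :: rat
    by (simp add: B_def)
  have "B k \<in> sets borel" for k
    unfolding B_def by (auto split: prod.split)
  then obtain r and \<Omega> :: "real measure" and X where r: "strict_mono r" and \<Omega>: "prob_space \<Omega>"
    and X [measurable]: "\<And>n. X n \<in> measurable \<Omega> borel"
    and distr_X: "\<And>n. distr \<Omega> borel (X n) = M (r n)"
    and stab: "AE \<omega> in \<Omega>. \<forall>i. \<exists>v. \<forall>\<^sub>F n in sequentially. (X n \<omega> \<in> B i) = v"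
    using subsequence_with_stabilising_digits[of M B] P2D[OF P2] by blast
  have "(\<integral>x. (norm x)\<^sup>2 \<partial>M 0) \<ge> 0" by simp
  then have "C \<ge> 0" using moment[of 0] by linarith
  have "(\<integral>\<^sup>+ \<omega>. liminf (\<lambda>n. ennreal ((norm (X n \<omega>))\<^sup>2)) \<partial>\<Omega>)
      \<le> liminf (\<lambda>n. \<integral>\<^sup>+ \<omega>. ennreal ((norm (X n \<omega>))\<^sup>2) \<partial>\<Omega>)"
    by (rule nn_integral_liminf) measurable
  also have "\<dots> \<le> liminf (\<lambda>n::nat. ennreal C)"
  proof (rule Liminf_mono, rule always_eventually, rule allI)
    fix n
    show "(\<integral>\<^sup>+ \<omega>. ennreal ((norm (X n \<omega>))\<^sup>2) \<partial>\<Omega>) \<le> ennreal C"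
      by (subst integral_le_iff_nn_integral[symmetric])
        (use P2_moment_of_law[OF X distr_X P2] moment \<open>C \<ge> 0\<close> in auto)
  qed
  also have "\<dots> < \<infinity>" by (simp add: Liminf_const)
  finally have "AE \<omega> in \<Omega>. liminf (\<lambda>n. ennreal ((norm (X n \<omega>))\<^sup>2)) \<noteq> \<infinity>"
    by (intro nn_integral_PInf_AE) auto
  with stab have "AE \<omega> in \<Omega>. \<exists>l. weakly_tendsto (\<lambda>n. X n \<omega>) l"
  proof eventually_elim
    case (elim \<omega>)
    have n: "\<exists>v. \<forall>\<^sub>F n in sequentially. (norm (X n \<omega>) > of_rat q) = v" for q :: rat
      using elim(1)[rule_format, of "to_nat (0::nat, q)"] unfolding B_norm by simp
    have i: "\<exists>v. \<forall>\<^sub>F n in sequentially. (inner (X n \<omega>) (D i) > of_rat q) = v" for i and q :: rat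
      using elim(1)[rule_format, of "to_nat (Suc i, q)"] unfolding B_inner by simp
    obtain K where K: "\<And>n. norm (X n \<omega>) \<le> K"
      using bounded_if_norm_comparisons_stabilise[OF n] elim(2) by (auto simp: top.not_eq_extremum)
    have "convergent (\<lambda>n. inner (X n \<omega>) (D i))" for i
    proof (rule convergent_if_rational_comparisons_stabilise[OF _ i])
      show "\<bar>inner (X n \<omega>) (D i)\<bar> \<le> K * norm (D i)" for n
        by (rule order_trans[OF Cauchy_Schwarz_ineq2 mult_right_mono[OF K norm_ge_zero]])
    qed
    then show ?case by (intro weak_limit_exists[OF K D])
  qed
  then obtain N where N: "{\<omega> \<in> space \<Omega>. \<not> (\<exists>l. weakly_tendsto (\<lambda>n. X n \<omega>) l)} \<subseteq> N"
    "emeasure \<Omega> N = 0" "N \<in> sets \<Omega>" by (rule AE_E)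
  note [measurable] = N(3)
  \<comment> \<open>With the value 0 on the null set, every pairing of \<open>Y\<close> is
    everywhere the limit of measurable functions.\<close>
  define Y where "Y \<omega> = (if \<omega> \<in> N then 0 else SOME l. weakly_tendsto (\<lambda>n. X n \<omega>) l)" for \<omega>
  have Y: "weakly_tendsto (\<lambda>n. X n \<omega>) (Y \<omega>)" if "\<omega> \<in> space \<Omega>" "\<omega> \<notin> N" for \<omega>
  proof -
    have "\<exists>l. weakly_tendsto (\<lambda>n. X n \<omega>) l" using that N(1) by blast
    from someI_ex[OF this] show ?thesis using that by (simp add: Y_def)
  qed
  have "Y \<in> borel_measurable \<Omega>"
  proof (rule borel_measurable_if_inner_measurable)
    fix z
    show "(\<lambda>\<omega>. inner (Y \<omega>) z) \<in> borel_measurable \<Omega>"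
    proof (rule borel_measurable_LIMSEQ_real)
      show "(\<lambda>n. if \<omega> \<in> N then 0 else inner (X n \<omega>) z) \<longlonglongrightarrow> inner (Y \<omega>) z"
        if "\<omega> \<in> space \<Omega>" for \<omega>
        using Y[OF that] by (cases "\<omega> \<in> N") (auto simp: weakly_tendsto_def, simp add: Y_def)
    qed measurable
  qed
  moreover have "AE \<omega> in \<Omega>. weakly_tendsto (\<lambda>n. X n \<omega>) (Y \<omega>)"
    by (rule AE_I'[of N]) (use N Y in \<open>auto simp: null_sets_def\<close>)
  ultimately show ?thesis using that r \<Omega> X distr_X by blast
qed

section \<open>Weak convergence and test functions\<close>

text \<open>Vitali's theorem, with uniform integrability expressed as domination by one integrable
  function up to errors of small integral. Young's inequality and the growth condition on test
  functions deliver bounds of exactly this shape.\<close>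

lemma L1_convergence_uniformly_integrable:
  fixes g :: "nat \<Rightarrow> 'b \<Rightarrow> real"
  assumes meas [measurable]: "\<And>n. g n \<in> borel_measurable M"
    and lim: "AE \<omega> in M. (\<lambda>n. g n \<omega>) \<longlonglongrightarrow> 0"
    and ui: "\<And>e. e > 0 \<Longrightarrow> \<exists>h Z. integrable M h \<and> (\<forall>n. integrable M (Z n) \<and> (\<integral>\<omega>. Z n \<omega> \<partial>M) \<le> e \<and>
        (\<forall>\<omega>. 0 \<le> Z n \<omega> \<and> \<bar>g n \<omega>\<bar> \<le> h \<omega> + Z n \<omega>))"
  shows "\<And>n. integrable M (g n)" "(\<lambda>n. \<integral>\<omega>. g n \<omega> \<partial>M) \<longlonglongrightarrow> 0"
proof -
  show int: "integrable M (g n)" for n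
  proof -
    obtain h and Z :: "nat \<Rightarrow> 'b \<Rightarrow> real" where h: "integrable M h" "integrable M (Z n)"
      "\<And>\<omega>. \<bar>g n \<omega>\<bar> \<le> h \<omega> + Z n \<omega>" using ui[OF zero_less_one] by metis
    show ?thesis
      by (rule Bochner_Integration.integrable_bound[OF Bochner_Integration.integrable_add[OF h(1,2)]])
        (use h(3) in \<open>auto intro: order_trans[OF _ abs_ge_self]\<close>)
  qed
  show "(\<lambda>n. \<integral>\<omega>. g n \<omega> \<partial>M) \<longlonglongrightarrow> 0"
  proof (rule LIMSEQ_I)
    fix e :: real assume "e > 0"
    then obtain h and Z :: "nat \<Rightarrow> 'b \<Rightarrow> real" where h [measurable]: "integrable M h"
      and Z: "\<And>n. integrable M (Z n)" "\<And>n. (\<integral>\<omega>. Z n \<omega> \<partial>M) \<le> e / 2"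
        "\<And>n \<omega>. 0 \<le> Z n \<omega>" "\<And>n \<omega>. \<bar>g n \<omega>\<bar> \<le> h \<omega> + Z n \<omega>"
      using ui[of "e / 2"] half_gt_zero[OF \<open>e > 0\<close>] by metis
    \<comment> \<open>Dominated convergence handles the part of \<open>g n\<close> below
      \<open>h\<close>; what exceeds it is at most \<open>Z n\<close>.\<close>
    define k where "k n \<omega> = min \<bar>g n \<omega>\<bar> \<bar>h \<omega>\<bar>" for n \<omega>
    have [measurable]: "k n \<in> borel_measurable M" for n unfolding k_def by measurable
    have k_int: "integrable M (k n)" for n
      by (rule Bochner_Integration.integrable_bound[OF integrable_abs[OF h]]) (auto simp: k_def)
    have "(\<lambda>n. \<integral>\<omega>. k n \<omega> \<partial>M) \<longlonglongrightarrow> (\<integral>\<omega>. 0 \<partial>M)"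
    proof (rule integral_dominated_convergence[where w = "\<lambda>\<omega>. \<bar>h \<omega>\<bar>"])
      show "AE \<omega> in M. (\<lambda>n. k n \<omega>) \<longlonglongrightarrow> 0"
        using lim
      proof eventually_elim
        case (elim \<omega>)
        have "(\<lambda>n. min \<bar>g n \<omega>\<bar> \<bar>h \<omega>\<bar>) \<longlonglongrightarrow> min \<bar>0\<bar> \<bar>h \<omega>\<bar>"
          by (intro tendsto_min tendsto_rabs elim tendsto_const)
        then show ?case by (simp add: k_def)
      qed
    qed (use h in \<open>auto simp: k_def\<close>)
    then obtain N where N: "\<And>n. n \<ge> N \<Longrightarrow> \<bar>\<integral>\<omega>. k n \<omega> \<partial>M\<bar> < e / 2"
      using LIMSEQ_D[of "\<lambda>n. \<integral>\<omega>. k n \<omega> \<partial>M" 0 "e / 2"] \<open>e > 0\<close> by auto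
    have "norm ((\<integral>\<omega>. g n \<omega> \<partial>M) - 0) < e" if "n \<ge> N" for n
    proof -
      have "\<bar>\<integral>\<omega>. g n \<omega> \<partial>M\<bar> \<le> (\<integral>\<omega>. \<bar>g n \<omega>\<bar> \<partial>M)" by (rule integral_abs_bound)
      also have "\<dots> \<le> (\<integral>\<omega>. k n \<omega> + Z n \<omega> \<partial>M)"
      proof (rule integral_mono)
        show "\<bar>g n \<omega>\<bar> \<le> k n \<omega> + Z n \<omega>" for \<omega>
          using Z(3,4)[where n = n and \<omega> = \<omega>] by (auto simp: k_def)
      qed (use int k_int Z in auto)
      also have "\<dots> = (\<integral>\<omega>. k n \<omega> \<partial>M) + (\<integral>\<omega>. Z n \<omega> \<partial>M)" using k_int Z(1) by simp
      also have "\<dots> < e" using N[OF that] Z(2)[of n] by linarith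
      finally show ?thesis by simp
    qed
    then show "\<exists>N. \<forall>n\<ge>N. norm ((\<integral>\<omega>. g n \<omega> \<partial>M) - 0) < e" by blast
  qed
qed

text \<open>Young's inequality without the sharp constants. The small weight goes to the factor
  whose second moments are merely bounded.\<close>

lemma inner_le_weighted:
  fixes x y :: "'a::real_inner"
  assumes "\<delta> > 0"
  shows "\<bar>inner x y\<bar> \<le> \<delta> * (norm x)\<^sup>2 + (norm y)\<^sup>2 / \<delta>"
proof -
  have "0 \<le> (\<delta> * norm x - norm y)\<^sup>2" by simp
  then have "2 * \<delta> * (norm x * norm y) \<le> \<delta>\<^sup>2 * (norm x)\<^sup>2 + (norm y)\<^sup>2"
    by (simp add: power2_eq_square algebra_simps)
  moreover have "0 \<le> \<delta> * (norm x * norm y)" using assms by simp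
  ultimately have "\<delta> * (norm x * norm y) \<le> \<delta>\<^sup>2 * (norm x)\<^sup>2 + (norm y)\<^sup>2" by linarith
  also have "\<dots> = \<delta> * (\<delta> * (norm x)\<^sup>2 + (norm y)\<^sup>2 / \<delta>)"
    using assms by (simp add: power2_eq_square algebra_simps)
  finally have "norm x * norm y \<le> \<delta> * (norm x)\<^sup>2 + (norm y)\<^sup>2 / \<delta>" using assms by simp
  then show ?thesis using Cauchy_Schwarz_ineq2[of x y] by linarith
qed

section \<open>Square integrable random vectors\<close>

lemma norm_add_diff_sq_le:
  fixes x y :: "'a::real_normed_vector"
  shows norm_add_sq_le: "(norm (x + y))\<^sup>2 \<le> 2 * (norm x)\<^sup>2 + 2 * (norm y)\<^sup>2"
    and norm_diff_sq_le: "(norm (x - y))\<^sup>2 \<le> 2 * (norm x)\<^sup>2 + 2 * (norm y)\<^sup>2"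
proof -
  have *: "(norm x + norm y)\<^sup>2 \<le> 2 * (norm x)\<^sup>2 + 2 * (norm y)\<^sup>2"
    using zero_le_power2[of "norm x - norm y"] unfolding power2_sum power2_diff by linarith
  show "(norm (x + y))\<^sup>2 \<le> 2 * (norm x)\<^sup>2 + 2 * (norm y)\<^sup>2"
    by (rule order_trans[OF power_mono[OF norm_triangle_ineq] *]) simp
  show "(norm (x - y))\<^sup>2 \<le> 2 * (norm x)\<^sup>2 + 2 * (norm y)\<^sup>2"
    by (rule order_trans[OF power_mono[OF norm_triangle_ineq4] *]) simp
qed

lemma square_integrable_scaleR:
  fixes X :: "'b \<Rightarrow> 'a::real_normed_vector"
  assumes "integrable M (\<lambda>\<omega>. (norm (X \<omega>))\<^sup>2)"
  shows "integrable M (\<lambda>\<omega>. (norm (c *\<^sub>R X \<omega>))\<^sup>2)"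
  using assms by (simp add: power_mult_distrib)

lemma square_integrable_add_diff:
  fixes X Y :: "'b \<Rightarrow> 'a::{real_normed_vector, second_countable_topology}"
  assumes [measurable]: "X \<in> borel_measurable M" "Y \<in> borel_measurable M"
    and int: "integrable M (\<lambda>\<omega>. (norm (X \<omega>))\<^sup>2)" "integrable M (\<lambda>\<omega>. (norm (Y \<omega>))\<^sup>2)"
  shows square_integrable_add: "integrable M (\<lambda>\<omega>. (norm (X \<omega> + Y \<omega>))\<^sup>2)"
    and square_integrable_diff: "integrable M (\<lambda>\<omega>. (norm (X \<omega> - Y \<omega>))\<^sup>2)"
proof -
  have i: "integrable M (\<lambda>\<omega>. 2 * (norm (X \<omega>))\<^sup>2 + 2 * (norm (Y \<omega>))\<^sup>2)" using int by simp
  show "integrable M (\<lambda>\<omega>. (norm (X \<omega> + Y \<omega>))\<^sup>2)"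
    by (rule Bochner_Integration.integrable_bound[OF i]) (use norm_add_sq_le in auto)
  show "integrable M (\<lambda>\<omega>. (norm (X \<omega> - Y \<omega>))\<^sup>2)"
    by (rule Bochner_Integration.integrable_bound[OF i]) (use norm_diff_sq_le in auto)
qed

lemma square_integrable_inner:
  fixes X Y :: "'b \<Rightarrow> 'a::{real_inner, second_countable_topology}"
  assumes [measurable]: "X \<in> borel_measurable M" "Y \<in> borel_measurable M"
    and int: "integrable M (\<lambda>\<omega>. (norm (X \<omega>))\<^sup>2)" "integrable M (\<lambda>\<omega>. (norm (Y \<omega>))\<^sup>2)"
  shows "integrable M (\<lambda>\<omega>. inner (X \<omega>) (Y \<omega>))"
proof -
  have i: "integrable M (\<lambda>\<omega>. 1 * (norm (X \<omega>))\<^sup>2 + (norm (Y \<omega>))\<^sup>2 / 1)" using int by simp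
  show ?thesis
    by (rule Bochner_Integration.integrable_bound[OF i])
      (use inner_le_weighted[of 1] in \<open>auto intro: order_trans[OF _ abs_ge_self]\<close>)
qed

lemma norm_diff_sq_expand:
  fixes x y :: "'a::real_inner"
  shows "(norm (x - y))\<^sup>2 = (norm x)\<^sup>2 + (norm y)\<^sup>2 - 2 * inner x y"
  unfolding power2_norm_eq_inner by (simp add: inner_diff_left inner_diff_right inner_commute)

lemma integral_norm_diff_sq:
  fixes X Y :: "'b \<Rightarrow> 'a::{real_inner, second_countable_topology}"
  assumes "X \<in> borel_measurable M" "Y \<in> borel_measurable M"
    and "integrable M (\<lambda>\<omega>. (norm (X \<omega>))\<^sup>2)" "integrable M (\<lambda>\<omega>. (norm (Y \<omega>))\<^sup>2)"
  shows "(\<integral>\<omega>. (norm (X \<omega> - Y \<omega>))\<^sup>2 \<partial>M) =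
    (\<integral>\<omega>. (norm (X \<omega>))\<^sup>2 \<partial>M) + (\<integral>\<omega>. (norm (Y \<omega>))\<^sup>2 \<partial>M) - 2 * (\<integral>\<omega>. inner (X \<omega>) (Y \<omega>) \<partial>M)"
  unfolding norm_diff_sq_expand using assms square_integrable_inner[OF assms] by simp

text \<open>Almost sure convergence of the pairings becomes convergence of integrals: Young's
  inequality dominates them by a multiple of the fixed square of \<open>Y\<close> plus a small
  multiple of the bounded second moments.\<close>

lemma inner_weak_limit:
  fixes X :: "nat \<Rightarrow> 'b \<Rightarrow> 'a::{real_inner, polish_space}"
  assumes [measurable]: "\<And>n. X n \<in> borel_measurable M" "X' \<in> borel_measurable M" "Y \<in> borel_measurable M"
    and moment: "\<And>n. integrable M (\<lambda>\<omega>. (norm (X n \<omega>))\<^sup>2)" "\<And>n. (\<integral>\<omega>. (norm (X n \<omega>))\<^sup>2 \<partial>M) \<le> C"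
    and weak: "AE \<omega> in M. weakly_tendsto (\<lambda>n. X n \<omega>) (X' \<omega>)"
    and Y: "integrable M (\<lambda>\<omega>. (norm (Y \<omega>))\<^sup>2)"
  shows "(\<lambda>n. \<integral>\<omega>. inner (X n \<omega>) (Y \<omega>) \<partial>M) \<longlonglongrightarrow> (\<integral>\<omega>. inner (X' \<omega>) (Y \<omega>) \<partial>M)"
proof -
  have X': "integrable M (\<lambda>\<omega>. (norm (X' \<omega>))\<^sup>2)" "(\<integral>\<omega>. (norm (X' \<omega>))\<^sup>2 \<partial>M) \<le> C"
    using weak_Fatou[of X M X' C] moment weak by auto
  have "C \<ge> 0" by (rule order_trans[OF _ moment(2)[of 0]]) simp
  have "(\<lambda>n. \<integral>\<omega>. inner (X n \<omega> - X' \<omega>) (Y \<omega>) \<partial>M) \<longlonglongrightarrow> 0"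
  proof (rule L1_convergence_uniformly_integrable(2))
    show "(\<lambda>\<omega>. inner (X n \<omega> - X' \<omega>) (Y \<omega>)) \<in> borel_measurable M" for n by measurable
    show "AE \<omega> in M. (\<lambda>n. inner (X n \<omega> - X' \<omega>) (Y \<omega>)) \<longlonglongrightarrow> 0"
      using weak
    proof eventually_elim
      case (elim \<omega>)
      then have "(\<lambda>n. inner (X n \<omega>) (Y \<omega>)) \<longlonglongrightarrow> inner (X' \<omega>) (Y \<omega>)"
        unfolding weakly_tendsto_def by blast
      from tendsto_diff[OF this tendsto_const[of "inner (X' \<omega>) (Y \<omega>)"]]
      show ?case by (simp add: inner_diff_left)
    qed
    fix e :: real assume "e > 0"
    \<comment> \<open>The integral of \<open>Z n\<close> is at most 4 C \<delta>, since
      \<open>X'\<close> obeys the bound \<open>C\<close> as well. The added 1 covers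
      \<open>C = 0\<close>.\<close>
    define \<delta> where "\<delta> = e / (4 * C + 1)"
    have "\<delta> > 0" using \<open>e > 0\<close> \<open>C \<ge> 0\<close> by (simp add: \<delta>_def)
    define h where "h \<omega> = (norm (Y \<omega>))\<^sup>2 / \<delta>" for \<omega>
    define Z where "Z n \<omega> = \<delta> * (2 * (norm (X n \<omega>))\<^sup>2 + 2 * (norm (X' \<omega>))\<^sup>2)" for n \<omega>
    have "(\<integral>\<omega>. Z n \<omega> \<partial>M) \<le> e" for n
    proof -
      have "(\<integral>\<omega>. Z n \<omega> \<partial>M) =
          \<delta> * (2 * (\<integral>\<omega>. (norm (X n \<omega>))\<^sup>2 \<partial>M) + 2 * (\<integral>\<omega>. (norm (X' \<omega>))\<^sup>2 \<partial>M))"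
        unfolding Z_def using moment(1) X'(1) by simp
      also have "\<dots> \<le> \<delta> * (4 * C + 1)"
        using moment(2)[of n] X'(2) \<open>\<delta> > 0\<close> by (intro mult_left_mono) auto
      also have "\<dots> = e" using \<open>C \<ge> 0\<close> by (simp add: \<delta>_def)
      finally show ?thesis .
    qed
    moreover have "0 \<le> Z n \<omega>" for n \<omega> using \<open>\<delta> > 0\<close> by (simp add: Z_def)
    moreover have "\<bar>inner (X n \<omega> - X' \<omega>) (Y \<omega>)\<bar> \<le> h \<omega> + Z n \<omega>" for n \<omega>
      using inner_le_weighted[OF \<open>\<delta> > 0\<close>, of "X n \<omega> - X' \<omega>" "Y \<omega>"]
        mult_left_mono[OF norm_diff_sq_le[of "X n \<omega>" "X' \<omega>"], of \<delta>] \<open>\<delta> > 0\<close>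
      unfolding h_def Z_def by linarith
    moreover have "integrable M h" "integrable M (Z n)" for n
      unfolding h_def Z_def using Y moment(1) X'(1) by auto
    ultimately show "\<exists>h Z. integrable M h \<and> (\<forall>n. integrable M (Z n) \<and> (\<integral>\<omega>. Z n \<omega> \<partial>M) \<le> e \<and>
        (\<forall>\<omega>. 0 \<le> Z n \<omega> \<and> \<bar>inner (X n \<omega> - X' \<omega>) (Y \<omega>)\<bar> \<le> h \<omega> + Z n \<omega>))"
      by blast
  qed
  moreover have "(\<integral>\<omega>. inner (X n \<omega> - X' \<omega>) (Y \<omega>) \<partial>M) =
      (\<integral>\<omega>. inner (X n \<omega>) (Y \<omega>) \<partial>M) - (\<integral>\<omega>. inner (X' \<omega>) (Y \<omega>) \<partial>M)" for n
    unfolding inner_diff_left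
    by (intro Bochner_Integration.integral_diff square_integrable_inner) (use moment X' Y in auto)
  ultimately show ?thesis by (simp add: LIM_zero_iff)
qed

text \<open>Replacing \<open>Y n\<close> by \<open>Y'\<close> costs a pairing of a bounded with a
  vanishing factor; after that the second factor is fixed.\<close>

lemma inner_weak_strong_limit:
  fixes X :: "nat \<Rightarrow> 'b \<Rightarrow> 'a::{real_inner, polish_space}"
  assumes [measurable]: "\<And>n. X n \<in> borel_measurable M" "X' \<in> borel_measurable M"
      "\<And>n. Y n \<in> borel_measurable M" "Y' \<in> borel_measurable M"
    and moment: "\<And>n. integrable M (\<lambda>\<omega>. (norm (X n \<omega>))\<^sup>2)" "\<And>n. (\<integral>\<omega>. (norm (X n \<omega>))\<^sup>2 \<partial>M) \<le> C"
    and weak: "AE \<omega> in M. weakly_tendsto (\<lambda>n. X n \<omega>) (X' \<omega>)"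
    and Y: "\<And>n. integrable M (\<lambda>\<omega>. (norm (Y n \<omega>))\<^sup>2)" "integrable M (\<lambda>\<omega>. (norm (Y' \<omega>))\<^sup>2)"
    and strong: "(\<lambda>n. \<integral>\<omega>. (norm (Y n \<omega> - Y' \<omega>))\<^sup>2 \<partial>M) \<longlonglongrightarrow> 0"
  shows "(\<lambda>n. \<integral>\<omega>. inner (X n \<omega>) (Y n \<omega>) \<partial>M) \<longlonglongrightarrow> (\<integral>\<omega>. inner (X' \<omega>) (Y' \<omega>) \<partial>M)"
proof -
  have "C \<ge> 0" by (rule order_trans[OF _ moment(2)[of 0]]) simp
  have lim: "(\<lambda>n. \<integral>\<omega>. inner (X n \<omega>) (Y' \<omega>) \<partial>M) \<longlonglongrightarrow> (\<integral>\<omega>. inner (X' \<omega>) (Y' \<omega>) \<partial>M)"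
    by (rule inner_weak_limit[of X M X' Y' C]) (use moment weak Y in auto)
  have d: "integrable M (\<lambda>\<omega>. (norm (Y n \<omega> - Y' \<omega>))\<^sup>2)" for n
    by (rule square_integrable_diff) (use Y in auto)
  have diff: "(\<lambda>n. \<integral>\<omega>. inner (X n \<omega>) (Y n \<omega> - Y' \<omega>) \<partial>M) \<longlonglongrightarrow> 0"
  proof (rule LIMSEQ_I)
    fix e :: real assume "e > 0"
    define \<delta> where "\<delta> = e / (2 * (C + 1))"
    have "\<delta> > 0" using \<open>e > 0\<close> \<open>C \<ge> 0\<close> by (simp add: \<delta>_def)
    then have "\<delta> * e / 2 > 0" using \<open>e > 0\<close> by simp
    then obtain N where N: "\<And>n. n \<ge> N \<Longrightarrow> \<bar>\<integral>\<omega>. (norm (Y n \<omega> - Y' \<omega>))\<^sup>2 \<partial>M\<bar> < \<delta> * e / 2"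
      using LIMSEQ_D[OF strong, of "\<delta> * e / 2"] by auto
    have "norm ((\<integral>\<omega>. inner (X n \<omega>) (Y n \<omega> - Y' \<omega>) \<partial>M) - 0) < e" if "n \<ge> N" for n
    proof -
      have "\<bar>\<integral>\<omega>. inner (X n \<omega>) (Y n \<omega> - Y' \<omega>) \<partial>M\<bar> \<le> (\<integral>\<omega>. \<bar>inner (X n \<omega>) (Y n \<omega> - Y' \<omega>)\<bar> \<partial>M)"
        by (rule integral_abs_bound)
      also have "\<dots> \<le> (\<integral>\<omega>. \<delta> * (norm (X n \<omega>))\<^sup>2 + (norm (Y n \<omega> - Y' \<omega>))\<^sup>2 / \<delta> \<partial>M)"
        by (rule integral_mono) (use moment d inner_le_weighted[OF \<open>\<delta> > 0\<close>] in
          \<open>auto intro!: square_integrable_inner integrable_abs\<close>)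
      also have "\<dots> = \<delta> * (\<integral>\<omega>. (norm (X n \<omega>))\<^sup>2 \<partial>M) + (\<integral>\<omega>. (norm (Y n \<omega> - Y' \<omega>))\<^sup>2 \<partial>M) / \<delta>"
        using moment d by simp
      also have "\<dots> < e"
      proof -
        have "\<delta> * (\<integral>\<omega>. (norm (X n \<omega>))\<^sup>2 \<partial>M) \<le> \<delta> * (C + 1)"
          using moment(2)[of n] \<open>\<delta> > 0\<close> by (intro mult_left_mono) auto
        also have "\<dots> = e / 2" using \<open>C \<ge> 0\<close> by (simp add: \<delta>_def divide_simps)
        finally have 1: "\<delta> * (\<integral>\<omega>. (norm (X n \<omega>))\<^sup>2 \<partial>M) \<le> e / 2" .
        have "(\<integral>\<omega>. (norm (Y n \<omega> - Y' \<omega>))\<^sup>2 \<partial>M) / \<delta> < (\<delta> * e / 2) / \<delta>"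
          using N[OF that] \<open>\<delta> > 0\<close> by (intro divide_strict_right_mono) linarith+
        also have "\<dots> = e / 2" using \<open>\<delta> > 0\<close> by simp
        finally show ?thesis using 1 by linarith
      qed
      finally show ?thesis by simp
    qed
    then show "\<exists>N. \<forall>n\<ge>N. norm ((\<integral>\<omega>. inner (X n \<omega>) (Y n \<omega> - Y' \<omega>) \<partial>M) - 0) < e" by blast
  qed
  have "(\<integral>\<omega>. inner (X n \<omega>) (Y n \<omega>) \<partial>M) =
      (\<integral>\<omega>. inner (X n \<omega>) (Y n \<omega> - Y' \<omega>) \<partial>M) + (\<integral>\<omega>. inner (X n \<omega>) (Y' \<omega>) \<partial>M)" for n
    by (subst Bochner_Integration.integral_add[symmetric])
      (use moment d Y in \<open>auto intro!: square_integrable_inner simp: inner_diff_right\<close>)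
  then show ?thesis using tendsto_add[OF diff lim] by simp
qed

text \<open>Expanding the square leaves, besides equal second moments, only the pairing with the
  fixed \<open>X'\<close>, whose limit is the second moment of \<open>X'\<close>. Equality of the
  moments holds when all laws agree, which is the case for the fixed marginals of plans.\<close>

lemma Radon_Riesz:
  fixes X :: "nat \<Rightarrow> 'b \<Rightarrow> 'a::{real_inner, polish_space}"
  assumes [measurable]: "\<And>n. X n \<in> borel_measurable M" "X' \<in> borel_measurable M"
    and int: "\<And>n. integrable M (\<lambda>\<omega>. (norm (X n \<omega>))\<^sup>2)" "integrable M (\<lambda>\<omega>. (norm (X' \<omega>))\<^sup>2)"
    and eq: "\<And>n. (\<integral>\<omega>. (norm (X n \<omega>))\<^sup>2 \<partial>M) = (\<integral>\<omega>. (norm (X' \<omega>))\<^sup>2 \<partial>M)"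
    and weak: "AE \<omega> in M. weakly_tendsto (\<lambda>n. X n \<omega>) (X' \<omega>)"
  shows "(\<lambda>n. \<integral>\<omega>. (norm (X n \<omega> - X' \<omega>))\<^sup>2 \<partial>M) \<longlonglongrightarrow> 0"
proof -
  define m where "m = (\<integral>\<omega>. (norm (X' \<omega>))\<^sup>2 \<partial>M)"
  have "(\<lambda>n. \<integral>\<omega>. inner (X n \<omega>) (X' \<omega>) \<partial>M) \<longlonglongrightarrow> (\<integral>\<omega>. inner (X' \<omega>) (X' \<omega>) \<partial>M)"
    by (rule inner_weak_limit[of X M X' X' m]) (use int weak in \<open>auto simp: eq m_def\<close>)
  then have "(\<lambda>n. \<integral>\<omega>. inner (X n \<omega>) (X' \<omega>) \<partial>M) \<longlonglongrightarrow> m"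
    by (simp add: m_def power2_norm_eq_inner)
  then have "(\<lambda>n. m + m - 2 * (\<integral>\<omega>. inner (X n \<omega>) (X' \<omega>) \<partial>M)) \<longlonglongrightarrow> m + m - 2 * m"
    by (intro tendsto_intros)
  then show ?thesis
    by (subst integral_norm_diff_sq) (use int in \<open>auto simp: eq m_def\<close>)
qed

section \<open>Growth of test functions and their integrals\<close>

lemma tendsto_imp_weakly_tendsto: "x \<longlonglongrightarrow> l \<Longrightarrow> weakly_tendsto x l"
  unfolding weakly_tendsto_def by (auto intro!: tendsto_intros)

lemma seq_weakly_continuous_imp_borel:
  assumes "seq_weakly_continuous \<zeta>"
  shows "\<zeta> \<in> borel_measurable borel"
proof (rule borel_measurable_continuous_onI)
  show "continuous_on UNIV \<zeta>"
    unfolding continuous_on_sequentially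
    using assms tendsto_imp_weakly_tendsto by (fastforce simp: seq_weakly_continuous_def comp_def)
qed

lemma bounded_weak_test_function:
  fixes \<zeta> :: "'a::{real_inner, polish_space} \<Rightarrow> real"
  assumes "seq_weakly_continuous \<zeta>" and bound: "\<And>x. \<bar>\<zeta> x\<bar> \<le> K"
  shows "\<zeta> \<in> weak_test_functions"
proof -
  have "((\<lambda>x. \<zeta> x / (1 + (norm x)\<^sup>2)) \<longlongrightarrow> 0) at_infinity"
  proof (rule tendstoI)
    fix e :: real assume "e > 0"
    have "K \<ge> 0" using bound[of 0] by linarith
    \<comment> \<open>The summand 1 gives \<open>norm x \<ge> 1\<close>, so that the square of the
      norm dominates the norm and hence \<open>K / e\<close>.\<close>
    have "dist (\<zeta> x / (1 + (norm x)\<^sup>2)) 0 < e" if "norm x \<ge> K / e + 1" for x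
    proof -
      have "K / e \<ge> 0" using \<open>K \<ge> 0\<close> \<open>e > 0\<close> by simp
      then have "norm x \<ge> 1" using that by linarith
      then have "norm x * 1 \<le> norm x * norm x" by (intro mult_left_mono) auto
      then have "K / e < 1 + (norm x)\<^sup>2" using that unfolding power2_eq_square by linarith
      then have "K < e * (1 + (norm x)\<^sup>2)" using \<open>e > 0\<close> by (simp add: field_simps)
      then have "\<bar>\<zeta> x\<bar> < e * (1 + (norm x)\<^sup>2)" using bound[of x] by linarith
      moreover have "0 < 1 + (norm x)\<^sup>2" by (simp add: add_pos_nonneg)
      ultimately show ?thesis by (simp add: abs_divide divide_less_eq)
    qed
    then show "\<forall>\<^sub>F x in at_infinity. dist (\<zeta> x / (1 + (norm x)\<^sup>2)) 0 < e"
      unfolding eventually_at_infinity by blast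
  qed
  then show ?thesis using assms(1) by (simp add: weak_test_functions_def)
qed

text \<open>The Skorohod representation, applied to point masses, yields weak sequential compactness of
  bounded sets.\<close>

lemma bounded_weakly_convergent_subsequence:
  fixes x :: "nat \<Rightarrow> 'a::{real_inner, polish_space}"
  assumes bound: "\<And>n. norm (x n) \<le> K"
  obtains r l where "strict_mono (r :: nat \<Rightarrow> nat)" "weakly_tendsto (\<lambda>n. x (r n)) l"
proof -
  define M where "M n = return borel (x n)" for n
  have int: "integrable (M n) (\<lambda>y. (norm y)\<^sup>2)" "(\<integral>y. (norm y)\<^sup>2 \<partial>M n) = (norm (x n))\<^sup>2" for n
  proof -
    show "integrable (M n) (\<lambda>y. (norm y)\<^sup>2)"
      by (rule integrableI_nonneg) (auto simp: M_def nn_integral_return)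
    show "(\<integral>y. (norm y)\<^sup>2 \<partial>M n) = (norm (x n))\<^sup>2" unfolding M_def by (rule integral_return) auto
  qed
  have P2: "M n \<in> P2" for n
    unfolding P2_def using int(1) by (auto simp: M_def prob_space_return)
  have moment: "(\<integral>y. (norm y)\<^sup>2 \<partial>M n) \<le> K\<^sup>2" for n
    unfolding int(2) by (rule power_mono[OF bound norm_ge_zero])
  obtain r :: "nat \<Rightarrow> nat" and \<Omega> :: "real measure" and X :: "nat \<Rightarrow> real \<Rightarrow> 'a" and Y
    where r: "strict_mono r" and \<Omega>: "prob_space \<Omega>"
      and X: "\<And>n. X n \<in> borel_measurable \<Omega>" "\<And>n. distr \<Omega> borel (X n) = M (r n)"
      and lim: "AE \<omega> in \<Omega>. weakly_tendsto (\<lambda>n. X n \<omega>) (Y \<omega>)"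
    by (rule weak_Skorohod_Prokhorov[of M "K\<^sup>2", OF P2 moment]) blast
  have "AE \<omega> in \<Omega>. X n \<omega> = x (r n)" for n
  proof -
    have "AE y in distr \<Omega> borel (X n). y = x (r n)"
      unfolding X(2) M_def by (subst AE_return) auto
    then show ?thesis using X(1) by (subst (asm) AE_distr_iff) auto
  qed
  then have "AE \<omega> in \<Omega>. \<forall>n. X n \<omega> = x (r n)" by (simp add: AE_all_countable)
  with lim have "AE \<omega> in \<Omega>. \<exists>l. weakly_tendsto (\<lambda>n. x (r n)) l" by eventually_elim auto
  then have "\<exists>l. weakly_tendsto (\<lambda>n. x (r n)) l"
    using prob_space.AE_const[OF \<Omega>] by simp
  then show ?thesis using that r by blast
qed

text \<open>Far out this is the growth condition; on a ball it needs weak compactness, as balls are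
  not norm compact in infinite dimension. An arbitrarily small \<open>e\<close> is what makes test
  functions uniformly integrable under bounded second moments.\<close>

lemma weak_test_function_bound:
  fixes \<zeta> :: "'a::{real_inner, polish_space} \<Rightarrow> real"
  assumes \<zeta>: "\<zeta> \<in> weak_test_functions" and "e > 0"
  obtains K where "K \<ge> 0" "\<And>x. \<bar>\<zeta> x\<bar> \<le> K + e * (norm x)\<^sup>2"
proof -
  have cont: "seq_weakly_continuous \<zeta>"
    and lim: "((\<lambda>x. \<zeta> x / (1 + (norm x)\<^sup>2)) \<longlongrightarrow> 0) at_infinity"
    using \<zeta> by (auto simp: weak_test_functions_def)
  obtain R where R: "\<And>x. norm x \<ge> R \<Longrightarrow> dist (\<zeta> x / (1 + (norm x)\<^sup>2)) 0 < e"
    using tendstoD[OF lim \<open>e > 0\<close>] unfolding eventually_at_infinity by blast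
  have far: "\<bar>\<zeta> x\<bar> \<le> e + e * (norm x)\<^sup>2" if "norm x \<ge> R" for x
  proof -
    have "0 < 1 + (norm x)\<^sup>2" by (simp add: add_pos_nonneg)
    then show ?thesis using R[OF that] by (simp add: abs_divide divide_less_eq algebra_simps)
  qed
  have "\<exists>K. \<forall>x. norm x \<le> R \<longrightarrow> \<bar>\<zeta> x\<bar> \<le> K"
  proof (rule ccontr)
    assume "\<not> ?thesis"
    then have "\<exists>x. norm x \<le> R \<and> \<bar>\<zeta> x\<bar> > real n" for n by (meson not_le)
    then obtain x where x: "\<And>n. norm (x n) \<le> R" "\<And>n. \<bar>\<zeta> (x n)\<bar> > real n" by metis
    obtain r l where r: "strict_mono (r :: nat \<Rightarrow> nat)" "weakly_tendsto (\<lambda>n. x (r n)) l"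
      by (rule bounded_weakly_convergent_subsequence[OF x(1)])
    have "(\<lambda>n. \<zeta> (x (r n))) \<longlonglongrightarrow> \<zeta> l" using cont r(2) unfolding seq_weakly_continuous_def by blast
    then obtain B where B: "\<And>n. norm (\<zeta> (x (r n))) \<le> B"
      using convergent_imp_Bseq[of "\<lambda>n. \<zeta> (x (r n))"] by (auto simp: convergent_def Bseq_def)
    obtain n where n: "real n > B" using reals_Archimedean2 by blast
    have "real n \<le> real (r n)" using seq_suble[OF r(1), of n] by simp
    then show False using x(2)[of "r n"] B[of n] n by simp
  qed
  then obtain K where K: "\<And>x. norm x \<le> R \<Longrightarrow> \<bar>\<zeta> x\<bar> \<le> K" by blast
  have "\<bar>\<zeta> x\<bar> \<le> (\<bar>K\<bar> + e) + e * (norm x)\<^sup>2" for x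
  proof (cases "norm x \<ge> R")
    case True
    then show ?thesis using far[OF True] by simp
  next
    case False
    have "0 \<le> e * (norm x)\<^sup>2" using \<open>e > 0\<close> by simp
    then show ?thesis using K[of x] False \<open>e > 0\<close> by linarith
  qed
  then show ?thesis using that[of "\<bar>K\<bar> + e"] \<open>e > 0\<close> by auto
qed

lemma weak_test_function_integral_limit:
  fixes X :: "nat \<Rightarrow> 'b \<Rightarrow> 'a::{real_inner, polish_space}"
  assumes "prob_space M" and [measurable]: "\<And>n. X n \<in> borel_measurable M" "X' \<in> borel_measurable M"
    and moment: "\<And>n. integrable M (\<lambda>\<omega>. (norm (X n \<omega>))\<^sup>2)" "\<And>n. (\<integral>\<omega>. (norm (X n \<omega>))\<^sup>2 \<partial>M) \<le> C"
    and weak: "AE \<omega> in M. weakly_tendsto (\<lambda>n. X n \<omega>) (X' \<omega>)"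
    and \<zeta>: "\<zeta> \<in> weak_test_functions"
  shows "(\<lambda>n. \<integral>\<omega>. \<zeta> (X n \<omega>) \<partial>M) \<longlonglongrightarrow> (\<integral>\<omega>. \<zeta> (X' \<omega>) \<partial>M)"
proof -
  interpret prob_space M by fact
  have X': "integrable M (\<lambda>\<omega>. (norm (X' \<omega>))\<^sup>2)" "(\<integral>\<omega>. (norm (X' \<omega>))\<^sup>2 \<partial>M) \<le> C"
    using weak_Fatou[of X M X' C] moment weak by auto
  have "C \<ge> 0" by (rule order_trans[OF _ moment(2)[of 0]]) simp
  have cont: "seq_weakly_continuous \<zeta>" using \<zeta> by (simp add: weak_test_functions_def)
  have [measurable]: "\<zeta> \<in> borel_measurable borel" by (rule seq_weakly_continuous_imp_borel[OF cont])
  have int: "integrable M (\<lambda>\<omega>. \<zeta> (Z \<omega>))"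
    if [measurable]: "Z \<in> borel_measurable M" and Z: "integrable M (\<lambda>\<omega>. (norm (Z \<omega>))\<^sup>2)" for Z
  proof -
    obtain K where "\<And>x. \<bar>\<zeta> x\<bar> \<le> K + 1 * (norm x)\<^sup>2" using weak_test_function_bound[OF \<zeta>, of 1] by auto
    moreover have "integrable M (\<lambda>\<omega>. K + 1 * (norm (Z \<omega>))\<^sup>2)" using Z by simp
    ultimately show ?thesis
      by (elim Bochner_Integration.integrable_bound) (auto intro: order_trans[OF _ abs_ge_self])
  qed
  have "(\<lambda>n. \<integral>\<omega>. \<zeta> (X n \<omega>) - \<zeta> (X' \<omega>) \<partial>M) \<longlonglongrightarrow> 0"
  proof (rule L1_convergence_uniformly_integrable(2))
    show "(\<lambda>\<omega>. \<zeta> (X n \<omega>) - \<zeta> (X' \<omega>)) \<in> borel_measurable M" for n by measurable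
    show "AE \<omega> in M. (\<lambda>n. \<zeta> (X n \<omega>) - \<zeta> (X' \<omega>)) \<longlonglongrightarrow> 0"
      using weak
    proof eventually_elim
      case (elim \<omega>)
      then have "(\<lambda>n. \<zeta> (X n \<omega>)) \<longlonglongrightarrow> \<zeta> (X' \<omega>)"
        using cont unfolding seq_weakly_continuous_def by blast
      then show ?case by (rule LIM_zero)
    qed
    fix e :: real assume "e > 0"
    define \<delta> where "\<delta> = e / (C + 1)"
    have "\<delta> > 0" using \<open>e > 0\<close> \<open>C \<ge> 0\<close> by (simp add: \<delta>_def)
    obtain K where K: "\<And>x. \<bar>\<zeta> x\<bar> \<le> K + \<delta> * (norm x)\<^sup>2"
      using weak_test_function_bound[OF \<zeta> \<open>\<delta> > 0\<close>] by blast
    define h where "h \<omega> = 2 * K + \<delta> * (norm (X' \<omega>))\<^sup>2" for \<omega>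
    define Z where "Z n \<omega> = \<delta> * (norm (X n \<omega>))\<^sup>2" for n \<omega>
    have "(\<integral>\<omega>. Z n \<omega> \<partial>M) \<le> e" for n
    proof -
      have "(\<integral>\<omega>. Z n \<omega> \<partial>M) = \<delta> * (\<integral>\<omega>. (norm (X n \<omega>))\<^sup>2 \<partial>M)"
        unfolding Z_def using moment(1) by simp
      also have "\<dots> \<le> \<delta> * (C + 1)"
        using moment(2)[of n] \<open>\<delta> > 0\<close> by (intro mult_left_mono) auto
      also have "\<dots> = e" using \<open>C \<ge> 0\<close> by (simp add: \<delta>_def)
      finally show ?thesis .
    qed
    moreover have "0 \<le> Z n \<omega>" for n \<omega> using \<open>\<delta> > 0\<close> by (simp add: Z_def)
    moreover have "\<bar>\<zeta> (X n \<omega>) - \<zeta> (X' \<omega>)\<bar> \<le> h \<omega> + Z n \<omega>" for n \<omega>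
      using K[of "X n \<omega>"] K[of "X' \<omega>"] unfolding h_def Z_def by linarith
    moreover have "integrable M h" "integrable M (Z n)" for n
      unfolding h_def Z_def using moment(1) X'(1) by auto
    ultimately show "\<exists>h Z. integrable M h \<and> (\<forall>n. integrable M (Z n) \<and> (\<integral>\<omega>. Z n \<omega> \<partial>M) \<le> e \<and>
        (\<forall>\<omega>. 0 \<le> Z n \<omega> \<and> \<bar>\<zeta> (X n \<omega>) - \<zeta> (X' \<omega>)\<bar> \<le> h \<omega> + Z n \<omega>))"
      by blast
  qed
  then show ?thesis using int moment(1) X'(1) by (simp add: LIM_zero_iff)
qed

text \<open>Finite intersections of open half-spaces form an intersection-stable generator of the
  Borel sets. Their indicators are pointwise limits of products of clipped affine functions, which
  are bounded and weakly continuous and so are test functions.\<close>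

lemma P2_eqI:
  fixes \<mu> \<nu> :: "'a::{real_inner, polish_space} measure"
  assumes P2: "\<mu> \<in> P2" "\<nu> \<in> P2"
    and eq: "\<And>\<zeta>. \<zeta> \<in> weak_test_functions \<Longrightarrow> (\<integral>x. \<zeta> x \<partial>\<mu>) = (\<integral>x. \<zeta> x \<partial>\<nu>)"
  shows "\<mu> = \<nu>"
proof -
  interpret \<mu>: prob_space \<mu> by (rule P2D[OF P2(1)])
  interpret \<nu>: prob_space \<nu> by (rule P2D[OF P2(2)])
  define H :: "('a \<times> real) set \<Rightarrow> 'a set" where "H P = {x. \<forall>p\<in>P. inner x (fst p) > snd p}" for P
  define G where "G = H ` {P. finite P}"
  have H_Int: "H P \<inter> H Q = H (P \<union> Q)" for P Q unfolding H_def by blast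
  \<comment> \<open>Measurability of the identity says that the generated sigma-algebra contains all
    Borel sets.\<close>
  have "id \<in> borel_measurable (sigma UNIV G)"
  proof (rule borel_measurable_if_inner_measurable, subst borel_measurable_iff_greater, intro allI)
    fix z a
    have "{x. a < inner x z} = H {(z, a)}" by (simp add: H_def)
    then show "{x \<in> space (sigma UNIV G). a < inner (id x) z} \<in> sets (sigma UNIV G)"
      by (auto simp: G_def)
  qed
  then have "A \<in> sigma_sets UNIV G" if "A \<in> sets borel" for A
    using measurable_sets[OF _ that, of id "sigma UNIV G"] by simp
  moreover have "H P \<in> sets borel" if "finite P" for P
  proof -
    have "open (\<Inter>p\<in>P. {x. inner x (fst p) > snd p})"
      using that by (intro open_INT ballI open_Collect_less continuous_intros) auto
    also have "(\<Inter>p\<in>P. {x. inner x (fst p) > snd p}) = H P"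
      by (auto simp: H_def)
    finally have "open (H P)" .
    then show ?thesis by simp
  qed
  then have "sigma_sets UNIV G \<subseteq> sets borel"
    using sets.sigma_sets_subset[of G borel] by (auto simp: G_def)
  ultimately have sets: "sets borel = sigma_sets UNIV G"
    by (intro equalityI subsetI) (assumption | erule subsetD)+
  have emeasure_H: "emeasure \<mu> (H P) = emeasure \<nu> (H P)" if fin: "finite P" for P
  proof -
    define g where "g m x = (\<Prod>p\<in>P. min 1 (max 0 (real m * (inner x (fst p) - snd p))))" for m :: nat and x :: 'a
    have g01: "0 \<le> g m x" "g m x \<le> 1" for m x
      unfolding g_def by (auto intro!: prod_nonneg prod_le_1)
    have cont: "seq_weakly_continuous (g m)" for m
      unfolding seq_weakly_continuous_def
    proof (intro allI impI)
      fix X and x :: 'a assume X: "weakly_tendsto X x"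
      show "(\<lambda>n. g m (X n)) \<longlonglongrightarrow> g m x"
        unfolding g_def
        by (intro tendsto_prod tendsto_min tendsto_max tendsto_mult tendsto_diff tendsto_const
          X[unfolded weakly_tendsto_def, rule_format])
    qed
    have test: "g m \<in> weak_test_functions" for m
      by (rule bounded_weak_test_function[OF cont, of _ 1]) (use g01 in \<open>auto simp: abs_le_iff intro: order_trans\<close>)
    have [measurable]: "g m \<in> borel_measurable borel" for m
      by (rule seq_weakly_continuous_imp_borel[OF cont])
    have lim: "(\<lambda>m. g m x) \<longlonglongrightarrow> indicator (H P) x" for x
    proof -
      have single: "(\<lambda>m. min 1 (max 0 (real m * t))) \<longlonglongrightarrow> (if t > 0 then 1 else 0)" for t :: real
      proof (cases "t > 0")
        case True
        obtain N where N: "1 / t < real N" using reals_Archimedean2 by blast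
        have "min 1 (max 0 (real m * t)) = 1" if "m \<ge> N" for m
        proof -
          have "1 / t < real m" using N that by linarith
          then have "1 < real m * t" using True by (simp add: field_simps)
          then show ?thesis by simp
        qed
        then have "\<forall>\<^sub>F m in sequentially. min 1 (max 0 (real m * t)) = 1"
          unfolding eventually_sequentially by blast
        then show ?thesis using True by (simp add: tendsto_eventually)
      next
        case False
        then have "real m * t \<le> 0" for m by (simp add: mult_nonneg_nonpos)
        then show ?thesis using False by (simp add: max_absorb1)
      qed
      have "(\<lambda>m. g m x) \<longlonglongrightarrow> (\<Prod>p\<in>P. if inner x (fst p) - snd p > 0 then 1 else 0)"
        unfolding g_def by (intro tendsto_prod single)
      also have "(\<Prod>p\<in>P. if inner x (fst p) - snd p > 0 then 1 else 0) = (indicator (H P) x :: real)"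
      proof (cases "x \<in> H P")
        case True
        then show ?thesis by (simp add: H_def)
      next
        case False
        then have "\<exists>p\<in>P. (if inner x (fst p) - snd p > 0 then 1 else 0) = (0::real)"
          by (auto simp: H_def not_less)
        from prod_zero[OF fin this] show ?thesis using False by simp
      qed
      finally show ?thesis .
    qed
    have HP [measurable]: "H P \<in> sets borel" using sets fin by (auto simp: G_def)
    have "(\<lambda>m. \<integral>x. g m x \<partial>\<rho>) \<longlonglongrightarrow> (\<integral>x. indicator (H P) x \<partial>\<rho>)" if \<rho>: "\<rho> \<in> P2" for \<rho>
    proof -
      interpret \<rho>: prob_space \<rho> by (rule P2D[OF \<rho>])
      have [measurable_cong]: "sets \<rho> = sets borel" by (rule P2D[OF \<rho>])
      show ?thesis
        by (rule integral_dominated_convergence[where w = "\<lambda>_. 1"]) (use lim g01 in auto)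
    qed
    from LIMSEQ_unique[OF this[OF P2(1)]] this[OF P2(2)]
    have "(\<integral>x. indicator (H P) x \<partial>\<mu>) = (\<integral>x. indicator (H P) x \<partial>\<nu> :: real)"
      unfolding eq[OF test] by blast
    then have "measure \<mu> (H P) = measure \<nu> (H P)"
      using HP P2D[OF P2(1)] P2D[OF P2(2)] by simp
    then show ?thesis by (simp add: \<mu>.emeasure_eq_measure \<nu>.emeasure_eq_measure)
  qed
  show ?thesis
  proof (rule measure_eqI_generator_eq[of G UNIV _ _ "\<lambda>_. UNIV"])
    show "Int_stable G" unfolding Int_stable_def G_def using H_Int by auto
    show "emeasure \<mu> X = emeasure \<nu> X" if "X \<in> G" for X using that emeasure_H by (auto simp: G_def)
    have "H {} = UNIV" by (simp add: H_def)
    then show "range (\<lambda>_. UNIV) \<subseteq> G" by (auto simp: G_def)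
  qed (use P2D[OF P2(1)] P2D[OF P2(2)] sets in \<open>auto\<close>)
qed

text \<open>The sets from which the topology is generated form a subbase, and convergence can be
  tested on a subbase. Thus convergence in the topology becomes convergence of real sequences, one
  for each test function.\<close>

lemma limitin_P2w_iff:
  fixes M :: "nat \<Rightarrow> 'a::{real_inner, polish_space} measure"
  assumes P2: "\<And>n. M n \<in> P2"
  shows "limitin P2w M \<mu> sequentially \<longleftrightarrow>
    \<mu> \<in> P2 \<and> (\<forall>\<zeta>\<in>weak_test_functions. (\<lambda>n. \<integral>x. \<zeta> x \<partial>M n) \<longlonglongrightarrow> (\<integral>x. \<zeta> x \<partial>\<mu>))"
proof -
  define B where "B = {{\<mu> \<in> P2. (\<integral>x. \<zeta> x \<partial>\<mu>) \<in> U} | (\<zeta> :: 'a \<Rightarrow> real) U. \<zeta> \<in> weak_test_functions \<and> open U}"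
  have P2w: "P2w = topology_generated_by B" by (simp add: P2w_def B_def)
  \<comment> \<open>The zero function with \<open>U = UNIV\<close> shows that \<open>P2\<close> is
    itself a generating set, hence the whole \<open>topspace\<close>.\<close>
  have zero: "(\<lambda>x::'a. 0) \<in> weak_test_functions"
    by (rule bounded_weak_test_function[of _ 0]) (auto simp: seq_weakly_continuous_def)
  have "P2 \<in> B"
    unfolding B_def using zero by (intro CollectI exI[of _ "\<lambda>x. 0"] exI[of _ UNIV]) auto
  have "\<Union> B \<subseteq> P2" by (auto simp: B_def)
  then have "\<Union> B = P2" using Union_upper[OF \<open>P2 \<in> B\<close>] by (rule equalityI)
  then have top: "topspace (P2w :: 'a measure topology) = P2"
    by (simp add: P2w topology_generated_by_topspace)
  show ?thesis
  proof (intro iffI conjI ballI)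
    assume lim: "limitin P2w M \<mu> sequentially"
    then show \<mu>: "\<mu> \<in> P2" using top by (simp add: limitin_def)
    fix \<zeta> :: "'a \<Rightarrow> real" assume \<zeta>: "\<zeta> \<in> weak_test_functions"
    show "(\<lambda>n. \<integral>x. \<zeta> x \<partial>M n) \<longlonglongrightarrow> (\<integral>x. \<zeta> x \<partial>\<mu>)"
    proof (rule topological_tendstoI)
      fix U :: "real set" assume U: "open U" "(\<integral>x. \<zeta> x \<partial>\<mu>) \<in> U"
      have "openin P2w {\<mu> \<in> P2. (\<integral>x. \<zeta> x \<partial>\<mu>) \<in> U}"
        unfolding P2w by (rule topology_generated_by_Basis) (use \<zeta> U in \<open>auto simp: B_def\<close>)
      moreover have "\<mu> \<in> {\<mu> \<in> P2. (\<integral>x. \<zeta> x \<partial>\<mu>) \<in> U}" using U \<mu> by simp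
      ultimately have "\<forall>\<^sub>F n in sequentially. M n \<in> {\<mu> \<in> P2. (\<integral>x. \<zeta> x \<partial>\<mu>) \<in> U}"
        using lim unfolding limitin_def by blast
      then show "\<forall>\<^sub>F n in sequentially. (\<integral>x. \<zeta> x \<partial>M n) \<in> U" by eventually_elim simp
    qed
  next
    assume *: "\<mu> \<in> P2 \<and> (\<forall>\<zeta>\<in>weak_test_functions. (\<lambda>n. \<integral>x. \<zeta> x \<partial>M n) \<longlonglongrightarrow> (\<integral>x. \<zeta> x \<partial>\<mu>))"
    then have \<mu>: "\<mu> \<in> P2" by (rule conjunct1)
    note lim = conjunct2[OF *]
    have ev: "\<mu> \<in> U \<Longrightarrow> \<forall>\<^sub>F n in sequentially. M n \<in> U" if "generate_topology_on B U" for U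
      using that
    proof induction
      case (Int a b)
      then show ?case by (auto intro: eventually_conj)
    next
      case (UN K)
      then obtain k where "k \<in> K" "\<mu> \<in> k" by blast
      then have "\<forall>\<^sub>F n in sequentially. M n \<in> k" using UN.IH by blast
      then show ?case by eventually_elim (use \<open>k \<in> K\<close> in blast)
    next
      case (Basis s)
      then obtain \<zeta> :: "'a \<Rightarrow> real" and U where s: "s = {\<mu> \<in> P2. (\<integral>x. \<zeta> x \<partial>\<mu>) \<in> U}"
        "\<zeta> \<in> weak_test_functions" "open U" by (auto simp: B_def)
      have "\<forall>\<^sub>F n in sequentially. (\<integral>x. \<zeta> x \<partial>M n) \<in> U"
        by (rule topological_tendstoD[OF lim[rule_format, OF s(2)] s(3)]) (use Basis.prems s in auto)
      then show ?case by eventually_elim (use P2 s in auto)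
    qed simp
    then show "limitin P2w M \<mu> sequentially"
      unfolding limitin_def top using \<mu> by (auto simp: P2w openin_topology_generated_by_iff)
  qed
qed

lemma limitin_P2w_unique:
  assumes "\<And>n. M n \<in> P2" "limitin P2w M \<mu> sequentially" "limitin P2w M \<nu> sequentially"
  shows "\<mu> = \<nu>"
proof -
  note \<mu> = assms(2)[unfolded limitin_P2w_iff[OF assms(1)]]
  note \<nu> = assms(3)[unfolded limitin_P2w_iff[OF assms(1)]]
  show ?thesis
    by (rule P2_eqI) (use \<mu> \<nu> LIMSEQ_unique in blast)+
qed

lemma limitin_P2w_weak_limit:
  fixes X :: "nat \<Rightarrow> 'b \<Rightarrow> 'a::{real_inner, polish_space}"
  assumes "prob_space \<Omega>" and meas [measurable]: "\<And>n. X n \<in> borel_measurable \<Omega>" "Y \<in> borel_measurable \<Omega>"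
    and law: "\<And>n. distr \<Omega> borel (X n) = M n" and P2: "\<And>n. M n \<in> P2"
    and moment: "\<And>n. (\<integral>x. (norm x)\<^sup>2 \<partial>M n) \<le> C"
    and weak: "AE \<omega> in \<Omega>. weakly_tendsto (\<lambda>n. X n \<omega>) (Y \<omega>)"
  shows "limitin P2w M (distr \<Omega> borel Y) sequentially"
proof -
  interpret prob_space \<Omega> by fact
  note mX = P2_moment_of_law[OF meas(1) law P2]
  have bound: "(\<integral>\<omega>. (norm (X n \<omega>))\<^sup>2 \<partial>\<Omega>) \<le> C" for n using moment mX(2) by simp
  have mY: "integrable \<Omega> (\<lambda>\<omega>. (norm (Y \<omega>))\<^sup>2)"
    by (rule weak_Fatou[OF meas mX(1) bound weak])
  have "distr \<Omega> borel Y \<in> P2"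
    unfolding P2_def using mY by (auto simp: prob_space_distr integrable_distr_eq)
  moreover have "(\<lambda>n. \<integral>x. \<zeta> x \<partial>M n) \<longlonglongrightarrow> (\<integral>x. \<zeta> x \<partial>distr \<Omega> borel Y)" if \<zeta>: "\<zeta> \<in> weak_test_functions" for \<zeta>
  proof -
    have [measurable]: "\<zeta> \<in> borel_measurable borel"
      using \<zeta> by (auto simp: weak_test_functions_def intro: seq_weakly_continuous_imp_borel)
    show ?thesis
      using weak_test_function_integral_limit[OF assms(1) meas mX(1) bound weak \<zeta>]
      by (simp add: law[symmetric] integral_distr)
  qed
  ultimately show ?thesis by (simp add: limitin_P2w_iff[OF P2])
qed

section \<open>Wasserstein distance and weak limits of plans\<close>

text \<open>Pairs and triples of vectors form separable Hilbert spaces again, so the representation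
  theorem applies to plans as it stands.\<close>

instance prod :: (polish_space, polish_space) polish_space ..

definition second_moment :: "'a::{real_inner, polish_space} measure \<Rightarrow> real" where
  "second_moment \<mu> = (\<integral>x. (norm x)\<^sup>2 \<partial>\<mu>)"

lemma second_moment_nonneg: "0 \<le> second_moment \<mu>"
  by (simp add: second_moment_def)

lemma P2_law:
  assumes "X \<in> borel_measurable M" "distr M borel X = \<mu>" "\<mu> \<in> P2"
  shows "integrable M (\<lambda>\<omega>. (norm (X \<omega>))\<^sup>2)"
    "(\<integral>\<omega>. (norm (X \<omega>))\<^sup>2 \<partial>M) = second_moment \<mu>"
  using P2_moment_of_law[OF assms] by (auto simp: second_moment_def)

lemma distr_in_P2:
  fixes X :: "'b \<Rightarrow> 'a::{real_inner, polish_space}"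
  assumes "prob_space M" and [measurable]: "X \<in> borel_measurable M"
    and "integrable M (\<lambda>\<omega>. (norm (X \<omega>))\<^sup>2)"
  shows "distr M borel X \<in> P2"
  unfolding P2_def using assms by (auto simp: prob_space.prob_space_distr integrable_distr_eq)

lemma measurable_fst_borel [measurable]:
    "fst \<in> borel_measurable (borel :: ('a::second_countable_topology \<times> 'b::second_countable_topology) measure)"
  and measurable_snd_borel [measurable]:
    "snd \<in> borel_measurable (borel :: ('a::second_countable_topology \<times> 'b::second_countable_topology) measure)"
  by (intro borel_measurable_continuous_onI continuous_intros)+

lemma quadratic_cost_nn_integral:
  "quadratic_cost \<gamma> = (\<integral>\<^sup>+ z. ennreal ((norm (fst z - snd z))\<^sup>2) \<partial>\<gamma>)"
  unfolding quadratic_cost_def case_prod_beta ..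

lemma distr_Pair_in_couplings2:
  fixes X Y :: "'b \<Rightarrow> 'a::{real_inner, polish_space}"
  assumes "prob_space M" and [measurable]: "X \<in> borel_measurable M" "Y \<in> borel_measurable M"
    and law: "distr M borel X = \<mu>" "distr M borel Y = \<nu>"
  shows "distr M borel (\<lambda>\<omega>. (X \<omega>, Y \<omega>)) \<in> couplings2 \<mu> \<nu>"
  unfolding couplings2_def using assms(1) law
  by (auto simp: distr_distr comp_def prob_space.prob_space_distr)

lemma quadratic_cost_distr_Pair:
  fixes X Y :: "'b \<Rightarrow> 'a::{real_inner, polish_space}"
  assumes [measurable]: "X \<in> borel_measurable M" "Y \<in> borel_measurable M"
    and int: "integrable M (\<lambda>\<omega>. (norm (X \<omega> - Y \<omega>))\<^sup>2)"
  shows "quadratic_cost (distr M borel (\<lambda>\<omega>. (X \<omega>, Y \<omega>))) = ennreal (\<integral>\<omega>. (norm (X \<omega> - Y \<omega>))\<^sup>2 \<partial>M)"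
proof -
  have "quadratic_cost (distr M borel (\<lambda>\<omega>. (X \<omega>, Y \<omega>))) = (\<integral>\<^sup>+ \<omega>. ennreal ((norm (X \<omega> - Y \<omega>))\<^sup>2) \<partial>M)"
    by (subst quadratic_cost_nn_integral) (simp_all add: nn_integral_distr)
  then show ?thesis using int by (simp add: nn_integral_eq_integral)
qed

lemma W2_nonneg: "0 \<le> W2 \<mu> \<nu>"
  by (simp add: W2_def)

lemma W2_sq: "(W2 \<mu> \<nu>)\<^sup>2 = enn2real (INF \<gamma>\<in>couplings2 \<mu> \<nu>. quadratic_cost \<gamma>)"
  by (simp add: W2_def)

lemma W2_sq_le:
  fixes X Y :: "'b \<Rightarrow> 'a::{real_inner, polish_space}"
  assumes "prob_space M" "X \<in> borel_measurable M" "Y \<in> borel_measurable M"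
    and law: "distr M borel X = \<mu>" "distr M borel Y = \<nu>"
    and int: "integrable M (\<lambda>\<omega>. (norm (X \<omega> - Y \<omega>))\<^sup>2)"
  shows "(W2 \<mu> \<nu>)\<^sup>2 \<le> (\<integral>\<omega>. (norm (X \<omega> - Y \<omega>))\<^sup>2 \<partial>M)"
  unfolding W2_sq
proof (rule enn2real_leI)
  show "(INF \<gamma>\<in>couplings2 \<mu> \<nu>. quadratic_cost \<gamma>) \<le> ennreal (\<integral>\<omega>. (norm (X \<omega> - Y \<omega>))\<^sup>2 \<partial>M)"
    unfolding quadratic_cost_distr_Pair[OF assms(2,3) int, symmetric]
    by (rule INF_lower[OF distr_Pair_in_couplings2[OF assms(1-5)]])
qed simp

lemma W2_sq_optimal:
  fixes X Y :: "'b \<Rightarrow> 'a::{real_inner, polish_space}"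
  assumes "X \<in> borel_measurable M" "Y \<in> borel_measurable M"
    and opt: "distr M borel (\<lambda>\<omega>. (X \<omega>, Y \<omega>)) \<in> optimal_plans \<mu> \<nu>"
    and int: "integrable M (\<lambda>\<omega>. (norm (X \<omega> - Y \<omega>))\<^sup>2)"
  shows "(W2 \<mu> \<nu>)\<^sup>2 = (\<integral>\<omega>. (norm (X \<omega> - Y \<omega>))\<^sup>2 \<partial>M)"
proof -
  have "(INF \<gamma>\<in>couplings2 \<mu> \<nu>. quadratic_cost \<gamma>) = quadratic_cost (distr M borel (\<lambda>\<omega>. (X \<omega>, Y \<omega>)))"
    using opt unfolding optimal_plans_def by (intro antisym INF_lower INF_greatest) auto
  then show ?thesis unfolding W2_sq quadratic_cost_distr_Pair[OF assms(1,2) int] by simp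
qed

text \<open>The product measure. The properties are listed instead of membership in
  \<open>couplings2\<close>, so that its sigma-algebra need not be identified with the Borel sets of
  the product topology.\<close>

lemma P2_coupling_exists:
  fixes \<mu> \<nu> :: "'a::{real_inner, polish_space} measure"
  assumes "\<mu> \<in> P2" "\<nu> \<in> P2"
  obtains \<gamma> :: "('a \<times> 'a) measure" where "prob_space \<gamma>" "fst \<in> borel_measurable \<gamma>" "snd \<in> borel_measurable \<gamma>"
    "distr \<gamma> borel fst = \<mu>" "distr \<gamma> borel snd = \<nu>"
proof -
  interpret \<mu>: prob_space \<mu> by (rule P2D[OF assms(1)])
  interpret \<nu>: prob_space \<nu> by (rule P2D[OF assms(2)])
  interpret pair_prob_space \<mu> \<nu> ..
  have s [measurable_cong]: "sets \<mu> = sets borel" "sets \<nu> = sets borel"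
    using P2D[OF assms(1)] P2D[OF assms(2)] by auto
  have f: "fst \<in> borel_measurable (\<mu> \<Otimes>\<^sub>M \<nu>)" and g: "snd \<in> borel_measurable (\<mu> \<Otimes>\<^sub>M \<nu>)"
    by measurable
  have "distr (\<mu> \<Otimes>\<^sub>M \<nu>) borel fst = \<mu>"
    using \<nu>.distr_pair_fst[of \<mu>] s by (metis distr_cong)
  moreover have "distr (\<mu> \<Otimes>\<^sub>M \<nu>) borel snd = \<nu>"
  proof (rule measure_eqI)
    fix A assume "A \<in> sets (distr (\<mu> \<Otimes>\<^sub>M \<nu>) borel snd)"
    then have A: "A \<in> sets \<nu>" using s by simp
    have "snd -` A \<inter> space (\<mu> \<Otimes>\<^sub>M \<nu>) = space \<mu> \<times> A"
      using sets.sets_into_space[OF A] by (auto simp: space_pair_measure)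
    moreover have "emeasure (\<mu> \<Otimes>\<^sub>M \<nu>) (space \<mu> \<times> A) = emeasure \<mu> (space \<mu>) * emeasure \<nu> A"
      by (rule \<nu>.emeasure_pair_measure_Times) (use A in auto)
    ultimately show "emeasure (distr (\<mu> \<Otimes>\<^sub>M \<nu>) borel snd) A = emeasure \<nu> A"
      using A s by (simp add: emeasure_distr[OF g] \<mu>.emeasure_space_1)
  qed (simp add: s)
  ultimately show ?thesis using that f g prob_space_axioms by blast
qed

lemma W2_sq_le_moments:
  assumes "\<mu> \<in> P2" "\<nu> \<in> P2"
  shows "(W2 \<mu> \<nu>)\<^sup>2 \<le> 2 * second_moment \<mu> + 2 * second_moment \<nu>"
proof -
  obtain \<gamma> where \<gamma>: "prob_space \<gamma>" "fst \<in> borel_measurable \<gamma>" "snd \<in> borel_measurable \<gamma>"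
    "distr \<gamma> borel fst = \<mu>" "distr \<gamma> borel snd = \<nu>"
    by (rule P2_coupling_exists[OF assms])
  note f = P2_law[OF \<gamma>(2,4) assms(1)] and s = P2_law[OF \<gamma>(3,5) assms(2)]
  note i = square_integrable_diff[OF \<gamma>(2,3) f(1) s(1)]
  have "(W2 \<mu> \<nu>)\<^sup>2 \<le> (\<integral>z. (norm (fst z - snd z))\<^sup>2 \<partial>\<gamma>)" by (rule W2_sq_le[OF \<gamma> i])
  also have "\<dots> \<le> (\<integral>z. 2 * (norm (fst z))\<^sup>2 + 2 * (norm (snd z))\<^sup>2 \<partial>\<gamma>)"
    by (intro integral_mono i norm_diff_sq_le) (use f s in simp)
  also have "\<dots> = 2 * second_moment \<mu> + 2 * second_moment \<nu>" using f s by simp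
  finally show ?thesis .
qed

lemma second_moment_le_W2:
  assumes P2: "\<mu> \<in> P2" "\<nu> \<in> P2" and le: "W2 \<nu> \<mu> \<le> C"
  shows "second_moment \<mu> \<le> 2 * second_moment \<nu> + 2 * (C\<^sup>2 + 1)"
proof -
  \<comment> \<open>This plan only shows that the infimum is finite, so that \<open>enn2real\<close>
    can be undone.\<close>
  obtain \<gamma>0 where \<gamma>0: "prob_space \<gamma>0" "fst \<in> borel_measurable \<gamma>0" "snd \<in> borel_measurable \<gamma>0"
    "distr \<gamma>0 borel fst = \<nu>" "distr \<gamma>0 borel snd = \<mu>"
    by (rule P2_coupling_exists[OF P2(2,1)])
  have "integrable \<gamma>0 (\<lambda>z. (norm (fst z - snd z))\<^sup>2)"
    by (rule square_integrable_diff[OF \<gamma>0(2,3) P2_law(1)[OF \<gamma>0(2,4) P2(2)] P2_law(1)[OF \<gamma>0(3,5) P2(1)]])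
  note q = quadratic_cost_distr_Pair[OF \<gamma>0(2,3) this]
  have "(INF \<gamma>\<in>couplings2 \<nu> \<mu>. quadratic_cost \<gamma>) \<le> quadratic_cost (distr \<gamma>0 borel (\<lambda>z. (fst z, snd z)))"
    by (rule INF_lower[OF distr_Pair_in_couplings2[OF \<gamma>0]])
  also have "\<dots> < \<infinity>" unfolding q by simp
  finally have "(INF \<gamma>\<in>couplings2 \<nu> \<mu>. quadratic_cost \<gamma>) = ennreal ((W2 \<nu> \<mu>)\<^sup>2)"
    by (simp add: W2_sq)
  \<comment> \<open>The slack 1 makes the bound strict; some coupling then lies below it although no
    minimiser is available.\<close>
  also have "\<dots> < ennreal (C\<^sup>2 + 1)"
    using power_mono[OF le W2_nonneg, of 2] by (intro ennreal_lessI) (auto intro: add_nonneg_pos)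
  finally obtain \<gamma> where \<gamma>: "\<gamma> \<in> couplings2 \<nu> \<mu>" "quadratic_cost \<gamma> < ennreal (C\<^sup>2 + 1)"
    by (auto simp: INF_less_iff)
  have [measurable_cong]: "sets \<gamma> = sets borel" and \<gamma>': "prob_space \<gamma>"
    "distr \<gamma> borel fst = \<nu>" "distr \<gamma> borel snd = \<mu>"
    using \<gamma>(1) by (auto simp: couplings2_def)
  have m: "fst \<in> borel_measurable \<gamma>" "snd \<in> borel_measurable \<gamma>" by measurable
  note f = P2_law[OF m(1) \<gamma>'(2) P2(2)] and s = P2_law[OF m(2) \<gamma>'(3) P2(1)]
  note i = square_integrable_diff[OF m f(1) s(1)]
  have "(\<integral>\<^sup>+ z. ennreal ((norm (fst z - snd z))\<^sup>2) \<partial>\<gamma>) \<le> ennreal (C\<^sup>2 + 1)"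
    using \<gamma> by (simp add: quadratic_cost_nn_integral couplings2_def less_imp_le)
  then have c: "(\<integral>z. (norm (fst z - snd z))\<^sup>2 \<partial>\<gamma>) \<le> C\<^sup>2 + 1"
    by (subst (asm) integral_le_iff_nn_integral[symmetric]) auto
  have "second_moment \<mu> = (\<integral>z. (norm (fst z - (fst z - snd z)))\<^sup>2 \<partial>\<gamma>)" using s by simp
  also have "\<dots> \<le> (\<integral>z. 2 * (norm (fst z))\<^sup>2 + 2 * (norm (fst z - snd z))\<^sup>2 \<partial>\<gamma>)"
    by (intro integral_mono norm_diff_sq_le) (use f s i in simp_all)
  also have "\<dots> = 2 * second_moment \<nu> + 2 * (\<integral>z. (norm (fst z - snd z))\<^sup>2 \<partial>\<gamma>)" using f i by simp
  finally show ?thesis using c by simp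
qed

lemma W2_commute: "W2 \<mu> \<nu> = W2 \<nu> \<mu>"
proof -
  have le: "(INF \<gamma>\<in>couplings2 \<nu> \<mu>. quadratic_cost \<gamma>) \<le> (INF \<gamma>\<in>couplings2 \<mu> \<nu>. quadratic_cost \<gamma>)"
    for \<mu> \<nu> :: "'a measure"
  proof (rule INF_mono)
    fix \<gamma> assume \<gamma>: "\<gamma> \<in> couplings2 \<mu> \<nu>"
    then have [measurable_cong]: "sets \<gamma> = sets borel" and "prob_space \<gamma>"
      "distr \<gamma> borel fst = \<mu>" "distr \<gamma> borel snd = \<nu>"
      by (auto simp: couplings2_def)
    then have "distr \<gamma> borel (\<lambda>z. (snd z, fst z)) \<in> couplings2 \<nu> \<mu>"
      by (intro distr_Pair_in_couplings2) auto
    moreover have "quadratic_cost (distr \<gamma> borel (\<lambda>z. (snd z, fst z))) = quadratic_cost \<gamma>"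
      using \<gamma> by (simp add: quadratic_cost_nn_integral nn_integral_distr norm_minus_commute couplings2_def)
    ultimately show "\<exists>\<gamma>'\<in>couplings2 \<nu> \<mu>. quadratic_cost \<gamma>' \<le> quadratic_cost \<gamma>"
      by (intro bexI[of _ "distr \<gamma> borel (\<lambda>z. (snd z, fst z))"]) auto
  qed
  show ?thesis unfolding W2_def using antisym[OF le[of \<mu> \<nu>] le[of \<nu> \<mu>]] by simp
qed

lemma W2_self:
  assumes "\<mu> \<in> P2"
  shows "W2 \<mu> \<mu> = 0"
proof -
  have m: "(\<lambda>x. x) \<in> borel_measurable \<mu>"
    using P2D(1)[OF assms] by (simp add: measurable_cong_sets[of \<mu> borel borel borel])
  have "(W2 \<mu> \<mu>)\<^sup>2 \<le> (\<integral>x. (norm (x - x))\<^sup>2 \<partial>\<mu>)"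
    by (rule W2_sq_le[OF P2D(2)[OF assms] m m]) (use P2D(1)[OF assms] in \<open>auto intro: distr_id2\<close>)
  then show ?thesis by simp
qed

text \<open>An optimal plan of cost 0 is carried by the diagonal. It is a hypothesis here, to be
  supplied later by convexity along generalized geodesics.\<close>

lemma W2_zero_imp_eq:
  assumes P2: "\<mu> \<in> P2" "\<nu> \<in> P2" and \<gamma>: "\<gamma> \<in> optimal_plans \<mu> \<nu>" and "W2 \<mu> \<nu> = 0"
  shows "\<mu> = \<nu>"
proof -
  have s [measurable_cong]: "sets \<gamma> = sets borel" and law: "distr \<gamma> borel fst = \<mu>" "distr \<gamma> borel snd = \<nu>"
    using \<gamma> by (auto simp: optimal_plans_def couplings2_def)
  have m: "fst \<in> borel_measurable \<gamma>" "snd \<in> borel_measurable \<gamma>" by measurable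
  have i: "integrable \<gamma> (\<lambda>z. (norm (fst z - snd z))\<^sup>2)"
    by (rule square_integrable_diff[OF m P2_law(1)[OF m(1) law(1) P2(1)] P2_law(1)[OF m(2) law(2) P2(2)]])
  have "distr \<gamma> borel (\<lambda>z. (fst z, snd z)) = \<gamma>" by (simp add: distr_id2 s)
  then have "(\<integral>z. (norm (fst z - snd z))\<^sup>2 \<partial>\<gamma>) = 0"
    using W2_sq_optimal[OF m _ i, of \<mu> \<nu>] \<gamma> \<open>W2 \<mu> \<nu> = 0\<close> by simp
  then have "AE z in \<gamma>. fst z = snd z"
    using integral_nonneg_eq_0_iff_AE[OF i] by simp
  then have "distr \<gamma> borel fst = distr \<gamma> borel snd" by (intro distr_cong_AE) (use m in auto)
  then show ?thesis by (simp add: law)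
qed

section \<open>Limits of plans\<close>

lemma limitin_P2w_const:
  assumes "\<nu> \<in> P2"
  shows "limitin P2w (\<lambda>n. \<nu>) \<nu> sequentially"
  by (subst limitin_P2w_iff) (use assms in auto)

lemma weakly_tendsto_fst:
  assumes "weakly_tendsto z l"
  shows "weakly_tendsto (\<lambda>n. fst (z n)) (fst l)"
proof -
  have "(\<lambda>n. inner (z n) (y, 0)) \<longlonglongrightarrow> inner l (y, 0)" for y
    using assms unfolding weakly_tendsto_def by blast
  then show ?thesis unfolding weakly_tendsto_def by (simp add: inner_prod_def)
qed

lemma weakly_tendsto_snd:
  assumes "weakly_tendsto z l"
  shows "weakly_tendsto (\<lambda>n. snd (z n)) (snd l)"
proof -
  have "(\<lambda>n. inner (z n) (0, y)) \<longlonglongrightarrow> inner l (0, y)" for y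
    using assms unfolding weakly_tendsto_def by blast
  then show ?thesis unfolding weakly_tendsto_def by (simp add: inner_prod_def)
qed

lemma norm_prod_sq: "(norm z)\<^sup>2 = (norm (fst z))\<^sup>2 + (norm (snd z))\<^sup>2"
  by (simp add: norm_prod_def)

lemma law_of_weak_limit:
  fixes X :: "nat \<Rightarrow> 'b \<Rightarrow> 'a::{real_inner, polish_space}"
  assumes "prob_space \<Omega>" "\<And>n. X n \<in> borel_measurable \<Omega>" "Y \<in> borel_measurable \<Omega>"
    and "\<And>n. distr \<Omega> borel (X n) = M n" and P2: "\<And>n. M n \<in> P2"
    and "\<And>n. second_moment (M n) \<le> C"
    and "AE \<omega> in \<Omega>. weakly_tendsto (\<lambda>n. X n \<omega>) (Y \<omega>)"
    and lim: "limitin P2w M \<mu> sequentially"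
  shows "distr \<Omega> borel Y = \<mu>"
proof (rule limitin_P2w_unique[OF P2 _ lim])
  show "limitin P2w M (distr \<Omega> borel Y) sequentially"
    by (rule limitin_P2w_weak_limit[of \<Omega> X Y M C]) (use assms in \<open>auto simp: second_moment_def\<close>)
qed

text \<open>A constant sequence of laws can only converge to itself, so no second moment is lost in
  the limit and weak convergence improves to convergence in L2.\<close>

lemma strong_limit_of_equal_laws:
  fixes X :: "nat \<Rightarrow> 'b \<Rightarrow> 'a::{real_inner, polish_space}"
  assumes "prob_space \<Omega>" and X: "\<And>n. X n \<in> borel_measurable \<Omega>" and Y: "Y \<in> borel_measurable \<Omega>"
    and law: "\<And>n. distr \<Omega> borel (X n) = \<nu>" and P2: "\<nu> \<in> P2"
    and weak: "AE \<omega> in \<Omega>. weakly_tendsto (\<lambda>n. X n \<omega>) (Y \<omega>)"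
  shows "distr \<Omega> borel Y = \<nu>" "(\<lambda>n. \<integral>\<omega>. (norm (X n \<omega> - Y \<omega>))\<^sup>2 \<partial>\<Omega>) \<longlonglongrightarrow> 0"
proof -
  show lY: "distr \<Omega> borel Y = \<nu>"
    by (rule law_of_weak_limit[OF assms(1) X Y law P2 order_refl weak limitin_P2w_const[OF P2]])
  show "(\<lambda>n. \<integral>\<omega>. (norm (X n \<omega> - Y \<omega>))\<^sup>2 \<partial>\<Omega>) \<longlonglongrightarrow> 0"
    by (rule Radon_Riesz[OF X Y P2_law(1)[OF X law P2] P2_law(1)[OF Y lY P2] _ weak])
      (simp add: P2_law(2)[OF X law P2] P2_law(2)[OF Y lY P2])
qed

lemma limitin_P2w_subseq:
  assumes P2: "\<And>n. M n \<in> P2" and lim: "limitin P2w M \<mu> sequentially" and r: "strict_mono r"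
  shows "limitin P2w (\<lambda>n. M (r n)) \<mu> sequentially"
proof -
  note * = lim[unfolded limitin_P2w_iff[OF P2]]
  have "(\<lambda>n. \<integral>x. \<zeta> x \<partial>M (r n)) \<longlonglongrightarrow> (\<integral>x. \<zeta> x \<partial>\<mu>)" if "\<zeta> \<in> weak_test_functions" for \<zeta>
    using LIMSEQ_subseq_LIMSEQ[OF conjunct2[OF *, rule_format, OF that] r] by (simp add: comp_def)
  then show ?thesis using conjunct1[OF *] by (simp add: limitin_P2w_iff[OF P2])
qed

text \<open>A plan is represented as one random triple; bounded marginal moments bound its own. The
  first coordinate converges only weakly, while those with a fixed law converge in L2.\<close>

lemma plan_limit:
  fixes M :: "nat \<Rightarrow> 'a::{real_inner, polish_space} measure"
  assumes P2: "\<And>n. M n \<in> P2" "\<nu>0 \<in> P2" "\<nu>1 \<in> P2" and moment: "\<And>n. second_moment (M n) \<le> C"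
    and lim: "limitin P2w M \<mu> sequentially" and \<gamma>: "\<And>n. \<gamma> n \<in> couplings3 (M n) \<nu>0 \<nu>1"
  obtains r :: "nat \<Rightarrow> nat" and \<Omega> :: "real measure" and X A B X' A' B'
  where "strict_mono r" "prob_space \<Omega>"
    "\<And>n. X n \<in> borel_measurable \<Omega>" "\<And>n. A n \<in> borel_measurable \<Omega>" "\<And>n. B n \<in> borel_measurable \<Omega>"
    "\<And>n. distr \<Omega> borel (\<lambda>\<omega>. (X n \<omega>, A n \<omega>, B n \<omega>)) = \<gamma> (r n)"
    "\<And>n. distr \<Omega> borel (X n) = M (r n)" "\<And>n. distr \<Omega> borel (A n) = \<nu>0" "\<And>n. distr \<Omega> borel (B n) = \<nu>1"
    "X' \<in> borel_measurable \<Omega>" "A' \<in> borel_measurable \<Omega>" "B' \<in> borel_measurable \<Omega>"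
    "distr \<Omega> borel X' = \<mu>" "distr \<Omega> borel A' = \<nu>0" "distr \<Omega> borel B' = \<nu>1"
    "AE \<omega> in \<Omega>. weakly_tendsto (\<lambda>n. X n \<omega>) (X' \<omega>)"
    "(\<lambda>n. \<integral>\<omega>. (norm (A n \<omega> - A' \<omega>))\<^sup>2 \<partial>\<Omega>) \<longlonglongrightarrow> 0"
    "(\<lambda>n. \<integral>\<omega>. (norm (B n \<omega> - B' \<omega>))\<^sup>2 \<partial>\<Omega>) \<longlonglongrightarrow> 0"
proof -
  have p: "sets (\<gamma> n) = sets borel" "prob_space (\<gamma> n)" "distr (\<gamma> n) borel fst = M n"
    "distr (\<gamma> n) borel (\<lambda>z. fst (snd z)) = \<nu>0" "distr (\<gamma> n) borel (\<lambda>z. snd (snd z)) = \<nu>1" for n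
    using \<gamma>[of n] unfolding couplings3_def case_prod_unfold by auto
  note [measurable_cong] = p(1)
  have m: "fst \<in> borel_measurable (\<gamma> n)" "(\<lambda>z. fst (snd z)) \<in> borel_measurable (\<gamma> n)"
    "(\<lambda>z. snd (snd z)) \<in> borel_measurable (\<gamma> n)" for n
    by measurable
  note l = P2_law[OF m(1) p(3) P2(1)] P2_law[OF m(2) p(4) P2(2)] P2_law[OF m(3) p(5) P2(3)]
  have \<gamma>_P2: "\<gamma> n \<in> P2" for n
    unfolding P2_def norm_prod_sq using p l by simp
  have \<gamma>_moment: "(\<integral>z. (norm z)\<^sup>2 \<partial>\<gamma> n) \<le> C + (second_moment \<nu>0 + second_moment \<nu>1)" for n
    unfolding norm_prod_sq using l moment[of n] by simp
  obtain r :: "nat \<Rightarrow> nat" and \<Omega> :: "real measure" and Z and Y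
    where r: "strict_mono r" and \<Omega>: "prob_space \<Omega>" and Z [measurable]: "\<And>n. Z n \<in> borel_measurable \<Omega>"
    and law_Z: "\<And>n. distr \<Omega> borel (Z n) = \<gamma> (r n)"
    and Y [measurable]: "Y \<in> borel_measurable \<Omega>"
    and weak: "AE \<omega> in \<Omega>. weakly_tendsto (\<lambda>n. Z n \<omega>) (Y \<omega>)"
    by (rule weak_Skorohod_Prokhorov[of \<gamma>, OF \<gamma>_P2 \<gamma>_moment]) blast
  have law1: "distr \<Omega> borel (\<lambda>\<omega>. fst (Z n \<omega>)) = M (r n)" for n
    using p(3)[of "r n"] by (simp add: law_Z[symmetric] distr_distr comp_def)
  have law2: "distr \<Omega> borel (\<lambda>\<omega>. fst (snd (Z n \<omega>))) = \<nu>0" for n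
    using p(4)[of "r n"] by (simp add: law_Z[symmetric] distr_distr comp_def)
  have law3: "distr \<Omega> borel (\<lambda>\<omega>. snd (snd (Z n \<omega>))) = \<nu>1" for n
    using p(5)[of "r n"] by (simp add: law_Z[symmetric] distr_distr comp_def)
  have weak1: "AE \<omega> in \<Omega>. weakly_tendsto (\<lambda>n. fst (Z n \<omega>)) (fst (Y \<omega>))"
    using weak by eventually_elim (rule weakly_tendsto_fst)
  have weak2: "AE \<omega> in \<Omega>. weakly_tendsto (\<lambda>n. fst (snd (Z n \<omega>))) (fst (snd (Y \<omega>)))"
    using weak by eventually_elim (intro weakly_tendsto_fst weakly_tendsto_snd)
  have weak3: "AE \<omega> in \<Omega>. weakly_tendsto (\<lambda>n. snd (snd (Z n \<omega>))) (snd (snd (Y \<omega>)))"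
    using weak by eventually_elim (intro weakly_tendsto_snd)
  show ?thesis
  proof (rule that[of r \<Omega> "\<lambda>n \<omega>. fst (Z n \<omega>)" "\<lambda>n \<omega>. fst (snd (Z n \<omega>))" "\<lambda>n \<omega>. snd (snd (Z n \<omega>))"
      "\<lambda>\<omega>. fst (Y \<omega>)" "\<lambda>\<omega>. fst (snd (Y \<omega>))" "\<lambda>\<omega>. snd (snd (Y \<omega>))"])
    show "distr \<Omega> borel (\<lambda>\<omega>. fst (Y \<omega>)) = \<mu>"
      by (rule law_of_weak_limit[OF \<Omega> _ _ law1 P2(1) moment weak1 limitin_P2w_subseq[OF P2(1) lim r]])
        measurable
    show "distr \<Omega> borel (\<lambda>\<omega>. fst (snd (Y \<omega>))) = \<nu>0"
      "(\<lambda>n. \<integral>\<omega>. (norm (fst (snd (Z n \<omega>)) - fst (snd (Y \<omega>))))\<^sup>2 \<partial>\<Omega>) \<longlonglongrightarrow> 0"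
      by (rule strong_limit_of_equal_laws[OF \<Omega> _ _ law2 P2(2) weak2]; measurable)+
    show "distr \<Omega> borel (\<lambda>\<omega>. snd (snd (Y \<omega>))) = \<nu>1"
      "(\<lambda>n. \<integral>\<omega>. (norm (snd (snd (Z n \<omega>)) - snd (snd (Y \<omega>))))\<^sup>2 \<partial>\<Omega>) \<longlonglongrightarrow> 0"
      by (rule strong_limit_of_equal_laws[OF \<Omega> _ _ law3 P2(3) weak3]; measurable)+
  qed (use r \<Omega> law1 law2 law3 law_Z weak1 in simp_all)
qed

lemma W2_sq_le_law:
  fixes X Y :: "'b \<Rightarrow> 'a::{real_inner, polish_space}"
  assumes "prob_space \<Omega>" "X \<in> borel_measurable \<Omega>" "Y \<in> borel_measurable \<Omega>"
    and law: "distr \<Omega> borel X = \<mu>" "distr \<Omega> borel Y = \<nu>" and P2: "\<mu> \<in> P2" "\<nu> \<in> P2"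
  shows "(W2 \<mu> \<nu>)\<^sup>2 \<le> (\<integral>\<omega>. (norm (X \<omega> - Y \<omega>))\<^sup>2 \<partial>\<Omega>)"
  by (rule W2_sq_le[OF assms(1-5) square_integrable_diff[OF assms(2,3)
      P2_law(1)[OF assms(2) law(1) P2(1)] P2_law(1)[OF assms(3) law(2) P2(2)]]])

lemma W2_sq_optimal_law:
  fixes X Y :: "'b \<Rightarrow> 'a::{real_inner, polish_space}"
  assumes m: "X \<in> borel_measurable \<Omega>" "Y \<in> borel_measurable \<Omega>"
    and law: "distr \<Omega> borel X = \<mu>" "distr \<Omega> borel Y = \<nu>" and P2: "\<mu> \<in> P2" "\<nu> \<in> P2"
    and opt: "distr \<Omega> borel (\<lambda>\<omega>. (X \<omega>, Y \<omega>)) \<in> optimal_plans \<mu> \<nu>"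
  shows "(W2 \<mu> \<nu>)\<^sup>2 = (\<integral>\<omega>. (norm (X \<omega> - Y \<omega>))\<^sup>2 \<partial>\<Omega>)"
  by (rule W2_sq_optimal[OF m opt square_integrable_diff[OF m
      P2_law(1)[OF m(1) law(1) P2(1)] P2_law(1)[OF m(2) law(2) P2(2)]]])

lemma convex_along_generalized_geodesicsE:
  assumes conv: "convex_along_generalized_geodesics \<phi>" and \<nu>: "\<nu> \<in> eff_domain \<phi>"
    and \<mu>0: "\<mu>0 \<in> P2" "\<phi> \<mu>0 \<le> ereal c0" and \<mu>1: "\<mu>1 \<in> P2" "\<phi> \<mu>1 \<le> ereal c1"
  obtains \<gamma> where "\<gamma> \<in> couplings3 \<nu> \<mu>0 \<mu>1"
    "distr \<gamma> borel (\<lambda>z. (fst z, fst (snd z))) \<in> optimal_plans \<nu> \<mu>0"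
    "distr \<gamma> borel (\<lambda>z. (fst z, snd (snd z))) \<in> optimal_plans \<nu> \<mu>1"
    "\<And>t. 0 \<le> t \<Longrightarrow> t \<le> 1 \<Longrightarrow>
      \<phi> (distr \<gamma> borel (\<lambda>z. (1 - t) *\<^sub>R fst (snd z) + t *\<^sub>R snd (snd z))) \<le> ereal ((1 - t) * c0 + t * c1)"
proof -
  have "\<mu>0 \<in> eff_domain \<phi>" "\<mu>1 \<in> eff_domain \<phi>"
    using \<mu>0 \<mu>1 by (auto simp: eff_domain_def)
  with conv \<nu> obtain \<gamma> where \<gamma>: "\<gamma> \<in> couplings3 \<nu> \<mu>0 \<mu>1"
    "distr \<gamma> borel (\<lambda>(x1, x2, x3). (x1, x2)) \<in> optimal_plans \<nu> \<mu>0"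
    "distr \<gamma> borel (\<lambda>(x1, x2, x3). (x1, x3)) \<in> optimal_plans \<nu> \<mu>1"
    "\<And>t. t \<in> {0..1} \<Longrightarrow> \<phi> (distr \<gamma> borel (\<lambda>(x1, x2, x3). (1 - t) *\<^sub>R x2 + t *\<^sub>R x3))
       \<le> ereal (1 - t) * \<phi> \<mu>0 + ereal t * \<phi> \<mu>1"
    unfolding convex_along_generalized_geodesics_def by blast
  have "\<phi> (distr \<gamma> borel (\<lambda>z. (1 - t) *\<^sub>R fst (snd z) + t *\<^sub>R snd (snd z))) \<le> ereal ((1 - t) * c0 + t * c1)"
    if "0 \<le> t" "t \<le> 1" for t
  proof -
    have "ereal (1 - t) * \<phi> \<mu>0 + ereal t * \<phi> \<mu>1 \<le> ereal (1 - t) * ereal c0 + ereal t * ereal c1"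
      using that \<mu>0(2) \<mu>1(2) by (intro add_mono ereal_mult_left_mono) auto
    then show ?thesis using \<gamma>(4)[of t] that unfolding case_prod_unfold by simp
  qed
  then show ?thesis using that[of \<gamma>] \<gamma>(1-3) unfolding case_prod_unfold by blast
qed

lemma W2_lsc_limit:
  assumes lsc: "W2_lsc \<phi>" and \<mu>: "\<mu> \<in> P2" and N: "\<And>n. N n \<in> P2" "\<And>n. \<phi> (N n) \<le> ereal c"
    and lim: "(\<lambda>n. (W2 \<mu> (N n))\<^sup>2) \<longlonglongrightarrow> 0"
  shows "\<phi> \<mu> \<le> ereal c"
proof (rule ccontr)
  assume "\<not> ?thesis"
  then have "ereal c < \<phi> \<mu>" by simp
  then obtain \<delta> where \<delta>: "\<delta> > 0" "\<And>\<nu>. \<nu> \<in> P2 \<Longrightarrow> W2 \<mu> \<nu> < \<delta> \<Longrightarrow> ereal c < \<phi> \<nu>"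
    using lsc \<mu> unfolding W2_lsc_def by blast
  have "\<forall>\<^sub>F n in sequentially. (W2 \<mu> (N n))\<^sup>2 < \<delta>\<^sup>2"
    by (rule order_tendstoD(2)[OF lim]) (use \<delta> in simp)
  then obtain n where "(W2 \<mu> (N n))\<^sup>2 < \<delta>\<^sup>2" by (auto simp: eventually_sequentially)
  then have "W2 \<mu> (N n) < \<delta>" using \<delta>(1) by (meson less_imp_le power_less_imp_less_base)
  then show False using \<delta>(2)[OF N(1)] N(2)[of n] by (meson leD)
qed

text \<open>Along a segment the squared distance is quadratic with a known leading coefficient. The
  negative last term is the gain exploited both in the variational inequality and for weak
  closedness.\<close>

lemma norm_diff_convex_combination_sq:
  fixes x a b :: "'a::real_inner"
  shows "(norm (x - ((1 - t) *\<^sub>R a + t *\<^sub>R b)))\<^sup>2 =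
    (1 - t) * (norm (x - a))\<^sup>2 + t * (norm (x - b))\<^sup>2 - t * (1 - t) * (norm (a - b))\<^sup>2"
  unfolding power2_norm_eq_inner
  by (simp add: inner_diff_left inner_diff_right inner_add_left inner_add_right inner_commute algebra_simps)

lemma integral_norm_diff_convex_combination_sq:
  fixes X A B :: "'b \<Rightarrow> 'a::{real_inner, second_countable_topology}"
  assumes m: "X \<in> borel_measurable \<Omega>" "A \<in> borel_measurable \<Omega>" "B \<in> borel_measurable \<Omega>"
    and int: "integrable \<Omega> (\<lambda>\<omega>. (norm (X \<omega>))\<^sup>2)" "integrable \<Omega> (\<lambda>\<omega>. (norm (A \<omega>))\<^sup>2)"
      "integrable \<Omega> (\<lambda>\<omega>. (norm (B \<omega>))\<^sup>2)"
  shows "(\<integral>\<omega>. (norm (X \<omega> - ((1 - t) *\<^sub>R A \<omega> + t *\<^sub>R B \<omega>)))\<^sup>2 \<partial>\<Omega>) =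
    (1 - t) * (\<integral>\<omega>. (norm (X \<omega> - A \<omega>))\<^sup>2 \<partial>\<Omega>) + t * (\<integral>\<omega>. (norm (X \<omega> - B \<omega>))\<^sup>2 \<partial>\<Omega>)
      - t * (1 - t) * (\<integral>\<omega>. (norm (A \<omega> - B \<omega>))\<^sup>2 \<partial>\<Omega>)"
  unfolding norm_diff_convex_combination_sq
  using square_integrable_diff[OF m(1,2) int(1,2)] square_integrable_diff[OF m(1,3) int(1,3)]
    square_integrable_diff[OF m(2,3) int(2,3)]
  by simp

text \<open>After subtraction of the second moments, the squared distance is governed by the pairing of a
  weakly convergent with a strongly convergent factor.\<close>

lemma cost_limit:
  fixes X A :: "nat \<Rightarrow> 'b \<Rightarrow> 'a::{real_inner, polish_space}"
  assumes X: "\<And>n. X n \<in> borel_measurable \<Omega>" "X' \<in> borel_measurable \<Omega>"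
    and A: "\<And>n. A n \<in> borel_measurable \<Omega>" "A' \<in> borel_measurable \<Omega>"
    and lX: "\<And>n. distr \<Omega> borel (X n) = M n" "distr \<Omega> borel X' = \<mu>"
    and lA: "\<And>n. distr \<Omega> borel (A n) = \<nu>" "distr \<Omega> borel A' = \<nu>"
    and P2: "\<And>n. M n \<in> P2" "\<mu> \<in> P2" "\<nu> \<in> P2" and moment: "\<And>n. second_moment (M n) \<le> C"
    and weak: "AE \<omega> in \<Omega>. weakly_tendsto (\<lambda>n. X n \<omega>) (X' \<omega>)"
    and strong: "(\<lambda>n. \<integral>\<omega>. (norm (A n \<omega> - A' \<omega>))\<^sup>2 \<partial>\<Omega>) \<longlonglongrightarrow> 0"
  shows "(\<lambda>n. (\<integral>\<omega>. (norm (X n \<omega> - A n \<omega>))\<^sup>2 \<partial>\<Omega>) - second_moment (M n))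
    \<longlonglongrightarrow> (\<integral>\<omega>. (norm (X' \<omega> - A' \<omega>))\<^sup>2 \<partial>\<Omega>) - second_moment \<mu>"
proof -
  note iX = P2_law[OF X(1) lX(1) P2(1)] and iX' = P2_law[OF X(2) lX(2) P2(2)]
  note iA = P2_law[OF A(1) lA(1) P2(3)] and iA' = P2_law[OF A(2) lA(2) P2(3)]
  have "(\<lambda>n. \<integral>\<omega>. inner (X n \<omega>) (A n \<omega>) \<partial>\<Omega>) \<longlonglongrightarrow> (\<integral>\<omega>. inner (X' \<omega>) (A' \<omega>) \<partial>\<Omega>)"
    by (rule inner_weak_strong_limit[OF X A iX(1) _ weak iA(1) iA'(1) strong, of C])
      (simp add: iX(2) moment)
  then have "(\<lambda>n. second_moment \<nu> - 2 * (\<integral>\<omega>. inner (X n \<omega>) (A n \<omega>) \<partial>\<Omega>))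
      \<longlonglongrightarrow> second_moment \<nu> - 2 * (\<integral>\<omega>. inner (X' \<omega>) (A' \<omega>) \<partial>\<Omega>)"
    by (intro tendsto_intros)
  then show ?thesis
    by (simp add: integral_norm_diff_sq[OF X(1) A(1) iX(1) iA(1)] integral_norm_diff_sq[OF X(2) A(2) iX'(1) iA'(1)]
      iX(2) iX'(2) iA(2) iA'(2))
qed

lemma limitin_P2w_Skorohod:
  fixes M :: "nat \<Rightarrow> 'a::{real_inner, polish_space} measure"
  assumes P2: "\<And>n. M n \<in> P2" and moment: "\<And>n. second_moment (M n) \<le> C"
    and lim: "limitin P2w M \<mu> sequentially"
  obtains r :: "nat \<Rightarrow> nat" and \<Omega> :: "real measure" and X Y
  where "strict_mono r" "prob_space \<Omega>" "\<And>n. X n \<in> borel_measurable \<Omega>" "Y \<in> borel_measurable \<Omega>"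
    "\<And>n. distr \<Omega> borel (X n) = M (r n)" "distr \<Omega> borel Y = \<mu>"
    "AE \<omega> in \<Omega>. weakly_tendsto (\<lambda>n. X n \<omega>) (Y \<omega>)"
proof -
  obtain r :: "nat \<Rightarrow> nat" and \<Omega> :: "real measure" and X and Y
    where r: "strict_mono r" and \<Omega>: "prob_space \<Omega>" and X: "\<And>n. X n \<in> borel_measurable \<Omega>"
    and law: "\<And>n. distr \<Omega> borel (X n) = M (r n)"
    and Y: "Y \<in> borel_measurable \<Omega>"
    and weak: "AE \<omega> in \<Omega>. weakly_tendsto (\<lambda>n. X n \<omega>) (Y \<omega>)"
    by (rule weak_Skorohod_Prokhorov[of M, OF P2 moment[unfolded second_moment_def]]) blast
  have "distr \<Omega> borel Y = \<mu>"
    by (rule law_of_weak_limit[OF \<Omega> X Y law P2 moment weak limitin_P2w_subseq[OF P2 lim r]])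
  then show ?thesis using that[OF r \<Omega> X Y law _ weak] by blast
qed

text \<open>Optimal plans converge to a plan between the limits, which competes for
  \<open>W2 \<mu> \<nu>\<close>; by \<open>cost_limit\<close> its cost is exactly
  \<open>l + second_moment \<mu>\<close>.\<close>

lemma W2_weak_liminf:
  fixes M :: "nat \<Rightarrow> 'a::{real_inner, polish_space} measure"
  assumes P2: "\<And>n. M n \<in> P2" "\<nu> \<in> P2" and moment: "\<And>n. second_moment (M n) \<le> C"
    and lim: "limitin P2w M \<mu> sequentially" and opt: "\<And>n. \<exists>\<gamma>. \<gamma> \<in> optimal_plans (M n) \<nu>"
    and l: "(\<lambda>n. (W2 (M n) \<nu>)\<^sup>2 - second_moment (M n)) \<longlonglongrightarrow> l"
  shows "(W2 \<mu> \<nu>)\<^sup>2 \<le> l + second_moment \<mu>"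
proof -
  obtain \<gamma> where \<gamma>: "\<And>n. \<gamma> n \<in> optimal_plans (M n) \<nu>" using opt by metis
  have p: "sets (\<gamma> n) = sets borel" "prob_space (\<gamma> n)" "distr (\<gamma> n) borel fst = M n"
    "distr (\<gamma> n) borel snd = \<nu>" for n
    using \<gamma>[of n] by (auto simp: optimal_plans_def couplings2_def)
  note [measurable_cong] = p(1)
  have \<mu>: "\<mu> \<in> P2" using lim[unfolded limitin_P2w_iff[OF P2(1)]] by (rule conjunct1)
  \<comment> \<open>\<open>plan_limit\<close> is about triples, so the second coordinate is
    doubled.\<close>
  define \<gamma>3 where "\<gamma>3 n = distr (\<gamma> n) borel (\<lambda>z. (fst z, snd z, snd z))" for n
  have "\<gamma>3 n \<in> couplings3 (M n) \<nu> \<nu>" for n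
    unfolding couplings3_def \<gamma>3_def case_prod_unfold using p
    by (auto simp: distr_distr comp_def prob_space.prob_space_distr)
  then obtain r :: "nat \<Rightarrow> nat" and \<Omega> :: "real measure" and X A B X' A' B'
  where r: "strict_mono r" and \<Omega>: "prob_space \<Omega>"
    and X [measurable]: "\<And>n. X n \<in> borel_measurable \<Omega>" and A [measurable]: "\<And>n. A n \<in> borel_measurable \<Omega>"
    and B [measurable]: "\<And>n. B n \<in> borel_measurable \<Omega>"
    and tri: "\<And>n. distr \<Omega> borel (\<lambda>\<omega>. (X n \<omega>, A n \<omega>, B n \<omega>)) = \<gamma>3 (r n)"
    and lX: "\<And>n. distr \<Omega> borel (X n) = M (r n)" and lA: "\<And>n. distr \<Omega> borel (A n) = \<nu>"
    and X' [measurable]: "X' \<in> borel_measurable \<Omega>" and A' [measurable]: "A' \<in> borel_measurable \<Omega>"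
    and lX': "distr \<Omega> borel X' = \<mu>" and lA': "distr \<Omega> borel A' = \<nu>"
    and weak: "AE \<omega> in \<Omega>. weakly_tendsto (\<lambda>n. X n \<omega>) (X' \<omega>)"
    and strong: "(\<lambda>n. \<integral>\<omega>. (norm (A n \<omega> - A' \<omega>))\<^sup>2 \<partial>\<Omega>) \<longlonglongrightarrow> 0"
    by (rule plan_limit[OF P2(1,2,2) moment lim]) blast
  have "distr \<Omega> borel (\<lambda>\<omega>. (X n \<omega>, A n \<omega>)) = \<gamma> (r n)" for n
  proof -
    have "distr \<Omega> borel (\<lambda>\<omega>. (X n \<omega>, A n \<omega>)) = distr (\<gamma>3 (r n)) borel (\<lambda>z. (fst z, fst (snd z)))"
      by (simp add: tri[symmetric] distr_distr comp_def)
    also have "\<dots> = distr (\<gamma> (r n)) borel (\<lambda>z. (fst z, snd z))"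
      unfolding \<gamma>3_def by (subst distr_distr) (auto simp: comp_def)
    also have "\<dots> = \<gamma> (r n)" by (simp add: distr_id2 p)
    finally show ?thesis .
  qed
  then have cost: "(W2 (M (r n)) \<nu>)\<^sup>2 = (\<integral>\<omega>. (norm (X n \<omega> - A n \<omega>))\<^sup>2 \<partial>\<Omega>)" for n
    by (intro W2_sq_optimal_law[OF X A lX lA P2]) (simp add: \<gamma>)
  have "(\<lambda>n. (W2 (M (r n)) \<nu>)\<^sup>2 - second_moment (M (r n)))
      \<longlonglongrightarrow> (\<integral>\<omega>. (norm (X' \<omega> - A' \<omega>))\<^sup>2 \<partial>\<Omega>) - second_moment \<mu>"
    unfolding cost by (rule cost_limit[OF X X' A A' lX lX' lA lA' P2(1) \<mu> P2(2) moment weak strong])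
  then have "l = (\<integral>\<omega>. (norm (X' \<omega> - A' \<omega>))\<^sup>2 \<partial>\<Omega>) - second_moment \<mu>"
    using LIMSEQ_subseq_LIMSEQ[OF l r] by (auto simp: comp_def intro: LIMSEQ_unique)
  then show ?thesis using W2_sq_le_law[OF \<Omega> X' A' lX' lA' \<mu> P2(2)] by simp
qed

text \<open>A generalized geodesic with base \<mu> and both endpoints \<nu> carries an optimal plan
  as a projection.\<close>

lemma optimal_plans_exist:
  assumes "convex_along_generalized_geodesics \<phi>" "\<mu> \<in> P2" "\<phi> \<mu> \<le> ereal c" "\<nu> \<in> P2" "\<phi> \<nu> \<le> ereal c'"
  shows "\<exists>\<gamma>. \<gamma> \<in> optimal_plans \<mu> \<nu>"
  by (rule convex_along_generalized_geodesicsE[OF assms(1) _ assms(4,5,4,5), of \<mu>])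
    (use assms in \<open>auto simp: eff_domain_def\<close>)

text \<open>The interpolations from \<open>\<nu>0\<close> to \<open>\<nu>1\<close> may change with the base \<open>M n\<close>, but the plans between
  \<open>\<nu>0\<close> and \<open>\<nu>1\<close> that induce them have fixed marginals, so that they converge strongly along a
  subsequence.\<close>

lemma generalized_geodesic_weak_base:
  fixes M :: "nat \<Rightarrow> 'a::{real_inner, polish_space} measure"
  assumes lsc: "W2_lsc \<phi>" and conv: "convex_along_generalized_geodesics \<phi>"
    and P2: "\<And>n. M n \<in> P2" "\<nu>0 \<in> P2" "\<nu>1 \<in> P2" and moment: "\<And>n. second_moment (M n) \<le> C"
    and c: "\<And>n. \<phi> (M n) \<le> ereal c" "\<phi> \<nu>0 \<le> ereal c" "\<phi> \<nu>1 \<le> ereal c"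
    and lim: "limitin P2w M \<mu> sequentially" and t: "0 \<le> t" "t \<le> 1"
    and l0: "(\<lambda>n. (W2 (M n) \<nu>0)\<^sup>2 - second_moment (M n)) \<longlonglongrightarrow> l0"
    and l1: "(\<lambda>n. W n - second_moment (M n)) \<longlonglongrightarrow> l1" "\<And>n. (W2 (M n) \<nu>1)\<^sup>2 \<le> W n"
  obtains \<nu> r l where "\<nu> \<in> P2" "\<phi> \<nu> \<le> ereal c" "strict_mono (r :: nat \<Rightarrow> nat)"
    "(\<lambda>n. (W2 (M (r n)) \<nu>)\<^sup>2 - second_moment (M (r n))) \<longlonglongrightarrow> l"
    "l \<le> (1 - t) * l0 + t * l1 - t * (1 - t) * (W2 \<nu>0 \<nu>1)\<^sup>2"
proof -
  have M: "M n \<in> eff_domain \<phi>" for n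
    using P2(1) c(1)[of n] by (auto simp: eff_domain_def)
  define geo where "geo s z = (1 - s) *\<^sub>R fst (snd z) + s *\<^sub>R snd (snd z)" for s and z :: "'a \<times> 'a \<times> 'a"
  have geo_m: "geo s \<in> borel_measurable borel" for s unfolding geo_def by measurable
  have "\<forall>n. \<exists>\<gamma>. \<gamma> \<in> couplings3 (M n) \<nu>0 \<nu>1 \<and>
    distr \<gamma> borel (\<lambda>z. (fst z, fst (snd z))) \<in> optimal_plans (M n) \<nu>0 \<and>
    distr \<gamma> borel (\<lambda>z. (fst z, snd (snd z))) \<in> optimal_plans (M n) \<nu>1 \<and>
    \<phi> (distr \<gamma> borel (geo t)) \<le> ereal c"
  proof
    fix n
    obtain \<gamma> where \<gamma>: "\<gamma> \<in> couplings3 (M n) \<nu>0 \<nu>1"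
      "distr \<gamma> borel (\<lambda>z. (fst z, fst (snd z))) \<in> optimal_plans (M n) \<nu>0"
      "distr \<gamma> borel (\<lambda>z. (fst z, snd (snd z))) \<in> optimal_plans (M n) \<nu>1"
      "\<And>t. 0 \<le> t \<Longrightarrow> t \<le> 1 \<Longrightarrow>
      \<phi> (distr \<gamma> borel (\<lambda>z. (1 - t) *\<^sub>R fst (snd z) + t *\<^sub>R snd (snd z))) \<le> ereal ((1 - t) * c + t * c)"
      by (rule convex_along_generalized_geodesicsE[OF conv M P2(2) c(2) P2(3) c(3)]) blast
    then show "\<exists>\<gamma>. \<gamma> \<in> couplings3 (M n) \<nu>0 \<nu>1 \<and>
      distr \<gamma> borel (\<lambda>z. (fst z, fst (snd z))) \<in> optimal_plans (M n) \<nu>0 \<and>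
      distr \<gamma> borel (\<lambda>z. (fst z, snd (snd z))) \<in> optimal_plans (M n) \<nu>1 \<and>
      \<phi> (distr \<gamma> borel (geo t)) \<le> ereal c"
      using \<gamma>(4)[OF t] by (intro exI[of _ \<gamma>]) (simp add: geo_def[abs_def] algebra_simps)
  qed
  from choice[OF this] obtain \<gamma> where \<gamma>: "\<And>n. \<gamma> n \<in> couplings3 (M n) \<nu>0 \<nu>1"
    "\<And>n. distr (\<gamma> n) borel (\<lambda>z. (fst z, fst (snd z))) \<in> optimal_plans (M n) \<nu>0"
    "\<And>n. distr (\<gamma> n) borel (\<lambda>z. (fst z, snd (snd z))) \<in> optimal_plans (M n) \<nu>1"
    "\<And>n. \<phi> (distr (\<gamma> n) borel (geo t)) \<le> ereal c"
    by blast
  have \<mu>: "\<mu> \<in> P2" using lim[unfolded limitin_P2w_iff[OF P2(1)]] by (rule conjunct1)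
  obtain r :: "nat \<Rightarrow> nat" and \<Omega> :: "real measure" and X A B X' A' B'
  where r: "strict_mono r" and \<Omega>: "prob_space \<Omega>"
    and X [measurable]: "\<And>n. X n \<in> borel_measurable \<Omega>" and A [measurable]: "\<And>n. A n \<in> borel_measurable \<Omega>"
    and B [measurable]: "\<And>n. B n \<in> borel_measurable \<Omega>"
    and tri: "\<And>n. distr \<Omega> borel (\<lambda>\<omega>. (X n \<omega>, A n \<omega>, B n \<omega>)) = \<gamma> (r n)"
    and lX: "\<And>n. distr \<Omega> borel (X n) = M (r n)" and lA: "\<And>n. distr \<Omega> borel (A n) = \<nu>0"
    and lB: "\<And>n. distr \<Omega> borel (B n) = \<nu>1"
    and X' [measurable]: "X' \<in> borel_measurable \<Omega>" and A' [measurable]: "A' \<in> borel_measurable \<Omega>"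
    and B' [measurable]: "B' \<in> borel_measurable \<Omega>"
    and lX': "distr \<Omega> borel X' = \<mu>" and lA': "distr \<Omega> borel A' = \<nu>0" and lB': "distr \<Omega> borel B' = \<nu>1"
    and weak: "AE \<omega> in \<Omega>. weakly_tendsto (\<lambda>n. X n \<omega>) (X' \<omega>)"
    and sA: "(\<lambda>n. \<integral>\<omega>. (norm (A n \<omega> - A' \<omega>))\<^sup>2 \<partial>\<Omega>) \<longlonglongrightarrow> 0"
    and sB: "(\<lambda>n. \<integral>\<omega>. (norm (B n \<omega> - B' \<omega>))\<^sup>2 \<partial>\<Omega>) \<longlonglongrightarrow> 0"
    by (rule plan_limit[OF P2 moment lim \<gamma>(1)]) blast
  note iX = P2_law[OF X lX P2(1)] and iX' = P2_law[OF X' lX' \<mu>]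
  note iA = P2_law[OF A lA P2(2)] and iA' = P2_law[OF A' lA' P2(2)]
  note iB = P2_law[OF B lB P2(3)] and iB' = P2_law[OF B' lB' P2(3)]
  have cA: "(\<lambda>n. (\<integral>\<omega>. (norm (X n \<omega> - A n \<omega>))\<^sup>2 \<partial>\<Omega>) - second_moment (M (r n)))
      \<longlonglongrightarrow> (\<integral>\<omega>. (norm (X' \<omega> - A' \<omega>))\<^sup>2 \<partial>\<Omega>) - second_moment \<mu>"
    by (rule cost_limit[OF X X' A A' lX lX' lA lA' P2(1) \<mu> P2(2) moment weak sA])
  have cB: "(\<lambda>n. (\<integral>\<omega>. (norm (X n \<omega> - B n \<omega>))\<^sup>2 \<partial>\<Omega>) - second_moment (M (r n)))
      \<longlonglongrightarrow> (\<integral>\<omega>. (norm (X' \<omega> - B' \<omega>))\<^sup>2 \<partial>\<Omega>) - second_moment \<mu>"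
    by (rule cost_limit[OF X X' B B' lX lX' lB lB' P2(1) \<mu> P2(3) moment weak sB])
  have optA: "(W2 (M (r n)) \<nu>0)\<^sup>2 = (\<integral>\<omega>. (norm (X n \<omega> - A n \<omega>))\<^sup>2 \<partial>\<Omega>)" for n
    by (intro W2_sq_optimal_law[OF X A lX lA P2(1,2)])
      (use \<gamma>(2)[of "r n"] in \<open>simp add: tri[symmetric] distr_distr comp_def\<close>)
  have optB: "(W2 (M (r n)) \<nu>1)\<^sup>2 = (\<integral>\<omega>. (norm (X n \<omega> - B n \<omega>))\<^sup>2 \<partial>\<Omega>)" for n
    by (intro W2_sq_optimal_law[OF X B lX lB P2(1,3)])
      (use \<gamma>(3)[of "r n"] in \<open>simp add: tri[symmetric] distr_distr comp_def\<close>)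
  have l0_eq: "(\<integral>\<omega>. (norm (X' \<omega> - A' \<omega>))\<^sup>2 \<partial>\<Omega>) - second_moment \<mu> = l0"
    using LIMSEQ_unique[OF cA] LIMSEQ_subseq_LIMSEQ[OF l0 r] by (simp add: comp_def optA)
  \<comment> \<open>\<open>W\<close> merely dominates the distances to \<open>\<nu>1\<close>, hence
    an inequality where \<open>l0_eq\<close> has an identity.\<close>
  have l1_le: "(\<integral>\<omega>. (norm (X' \<omega> - B' \<omega>))\<^sup>2 \<partial>\<Omega>) - second_moment \<mu> \<le> l1"
  proof (rule LIMSEQ_le[OF cB])
    show "(\<lambda>n. W (r n) - second_moment (M (r n))) \<longlonglongrightarrow> l1"
      using LIMSEQ_subseq_LIMSEQ[OF l1(1) r] by (simp add: comp_def)
    show "\<exists>N. \<forall>n\<ge>N. (\<integral>\<omega>. (norm (X n \<omega> - B n \<omega>))\<^sup>2 \<partial>\<Omega>) - second_moment (M (r n))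
        \<le> W (r n) - second_moment (M (r n))"
      using l1(2)[of "r _"] by (simp add: optB)
  qed
  have AB: "(W2 \<nu>0 \<nu>1)\<^sup>2 \<le> (\<integral>\<omega>. (norm (A' \<omega> - B' \<omega>))\<^sup>2 \<partial>\<Omega>)"
    by (rule W2_sq_le_law[OF \<Omega> A' B' lA' lB' P2(2,3)])
  \<comment> \<open>The interpolation of the limits \<open>A'\<close> and \<open>B'\<close>: its law
    no longer depends on the base. It stays in the sublevel because it is the L2 limit of the
    interpolations along the sequence.\<close>
  define D where "D \<omega> = (1 - t) *\<^sub>R A' \<omega> + t *\<^sub>R B' \<omega>" for \<omega>
  define \<nu> where "\<nu> = distr \<Omega> borel D"
  have D [measurable]: "D \<in> borel_measurable \<Omega>" unfolding D_def by measurable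
  have iD: "integrable \<Omega> (\<lambda>\<omega>. (norm (D \<omega>))\<^sup>2)"
    unfolding D_def by (intro square_integrable_add square_integrable_scaleR iA'(1) iB'(1)) measurable
  have \<nu>: "\<nu> \<in> P2" unfolding \<nu>_def by (rule distr_in_P2[OF \<Omega> D iD])
  have \<nu>_le: "\<phi> \<nu> \<le> ereal c"
  proof (rule W2_lsc_limit[OF lsc \<nu>])
    define Dn where "Dn n \<omega> = (1 - t) *\<^sub>R A n \<omega> + t *\<^sub>R B n \<omega>" for n \<omega>
    have Dn [measurable]: "Dn n \<in> borel_measurable \<Omega>" for n unfolding Dn_def by measurable
    have iDn: "integrable \<Omega> (\<lambda>\<omega>. (norm (Dn n \<omega>))\<^sup>2)" for n
      unfolding Dn_def by (intro square_integrable_add square_integrable_scaleR iA(1) iB(1)) measurable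
    have eq: "distr (\<gamma> (r n)) borel (geo t) = distr \<Omega> borel (Dn n)" for n
      unfolding tri[symmetric] using geo_m by (subst distr_distr) (auto simp: comp_def geo_def Dn_def[abs_def])
    show "distr (\<gamma> (r n)) borel (geo t) \<in> P2" for n
      unfolding eq by (rule distr_in_P2[OF \<Omega> Dn iDn])
    show "\<phi> (distr (\<gamma> (r n)) borel (geo t)) \<le> ereal c" for n by (rule \<gamma>(4))
    have bound: "(W2 \<nu> (distr (\<gamma> (r n)) borel (geo t)))\<^sup>2
        \<le> 2 * (\<integral>\<omega>. (norm (A n \<omega> - A' \<omega>))\<^sup>2 \<partial>\<Omega>) + 2 * (\<integral>\<omega>. (norm (B n \<omega> - B' \<omega>))\<^sup>2 \<partial>\<Omega>)" for n
    proof -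
      note dA = square_integrable_diff[OF A A' iA(1) iA'(1)] and dB = square_integrable_diff[OF B B' iB(1) iB'(1)]
      have "(W2 \<nu> (distr (\<gamma> (r n)) borel (geo t)))\<^sup>2 \<le> (\<integral>\<omega>. (norm (D \<omega> - Dn n \<omega>))\<^sup>2 \<partial>\<Omega>)"
        unfolding \<nu>_def eq by (rule W2_sq_le[OF \<Omega> D Dn refl refl square_integrable_diff[OF D Dn iD iDn]])
      also have "\<dots> \<le> (\<integral>\<omega>. 2 * (norm (A n \<omega> - A' \<omega>))\<^sup>2 + 2 * (norm (B n \<omega> - B' \<omega>))\<^sup>2 \<partial>\<Omega>)"
      proof (rule integral_mono)
        fix \<omega>
        have e: "Dn n \<omega> - D \<omega> = (1 - t) *\<^sub>R (A n \<omega> - A' \<omega>) + t *\<^sub>R (B n \<omega> - B' \<omega>)"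
          by (simp add: Dn_def D_def algebra_simps)
        have s: "(1 - t)\<^sup>2 \<le> 1" "t\<^sup>2 \<le> 1" using t by (auto simp: power_le_one)
        have "(norm (D \<omega> - Dn n \<omega>))\<^sup>2 \<le> 2 * ((1 - t)\<^sup>2 * (norm (A n \<omega> - A' \<omega>))\<^sup>2) + 2 * (t\<^sup>2 * (norm (B n \<omega> - B' \<omega>))\<^sup>2)"
          unfolding norm_minus_commute[of "D \<omega>"] e
          by (rule order_trans[OF norm_add_sq_le]) (simp add: power_mult_distrib)
        also have "\<dots> \<le> 2 * (norm (A n \<omega> - A' \<omega>))\<^sup>2 + 2 * (norm (B n \<omega> - B' \<omega>))\<^sup>2"
          using mult_right_mono[OF s(1), of "(norm (A n \<omega> - A' \<omega>))\<^sup>2"]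
            mult_right_mono[OF s(2), of "(norm (B n \<omega> - B' \<omega>))\<^sup>2"] by simp
        finally show "(norm (D \<omega> - Dn n \<omega>))\<^sup>2 \<le> 2 * (norm (A n \<omega> - A' \<omega>))\<^sup>2 + 2 * (norm (B n \<omega> - B' \<omega>))\<^sup>2" .
      qed (use dA dB square_integrable_diff[OF D Dn iD iDn] in auto)
      also have "\<dots> = 2 * (\<integral>\<omega>. (norm (A n \<omega> - A' \<omega>))\<^sup>2 \<partial>\<Omega>) + 2 * (\<integral>\<omega>. (norm (B n \<omega> - B' \<omega>))\<^sup>2 \<partial>\<Omega>)"
        using dA dB by simp
      finally show ?thesis .
    qed
    have "(\<lambda>n. 2 * (\<integral>\<omega>. (norm (A n \<omega> - A' \<omega>))\<^sup>2 \<partial>\<Omega>) + 2 * (\<integral>\<omega>. (norm (B n \<omega> - B' \<omega>))\<^sup>2 \<partial>\<Omega>))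
        \<longlonglongrightarrow> 2 * 0 + 2 * 0"
      by (intro tendsto_intros sA sB)
    then have lim0: "(\<lambda>n. 2 * (\<integral>\<omega>. (norm (A n \<omega> - A' \<omega>))\<^sup>2 \<partial>\<Omega>) + 2 * (\<integral>\<omega>. (norm (B n \<omega> - B' \<omega>))\<^sup>2 \<partial>\<Omega>))
        \<longlonglongrightarrow> 0" by (simp only: mult_zero_right add_0_right)
    show "(\<lambda>n. (W2 \<nu> (distr (\<gamma> (r n)) borel (geo t)))\<^sup>2) \<longlonglongrightarrow> 0"
      by (rule tendsto_sandwich[OF _ _ tendsto_const lim0]; intro always_eventually allI zero_le_power2 bound)
  qed
  have upper: "(W2 (M (r n)) \<nu>)\<^sup>2 \<le> (\<integral>\<omega>. (norm (X n \<omega> - D \<omega>))\<^sup>2 \<partial>\<Omega>)" for n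
    by (rule W2_sq_le_law[OF \<Omega> X D lX \<nu>_def[symmetric] P2(1) \<nu>])
  have cD: "(\<lambda>n. (\<integral>\<omega>. (norm (X n \<omega> - D \<omega>))\<^sup>2 \<partial>\<Omega>) - second_moment (M (r n)))
      \<longlonglongrightarrow> (\<integral>\<omega>. (norm (X' \<omega> - D \<omega>))\<^sup>2 \<partial>\<Omega>) - second_moment \<mu>"
    by (rule cost_limit[OF X X' D D lX lX' \<nu>_def[symmetric] \<nu>_def[symmetric] P2(1) \<mu> \<nu> moment weak]) simp
  \<comment> \<open>The distances from \<open>M (r n)\<close> to the new \<nu> need not converge;
    boundedness gives a cluster value along a further subsequence.\<close>
  have "bounded (range (\<lambda>n. (W2 (M (r n)) \<nu>)\<^sup>2 - second_moment (M (r n))))"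
  proof (rule boundedI, clarify)
    fix n
    show "norm ((W2 (M (r n)) \<nu>)\<^sup>2 - second_moment (M (r n))) \<le> 2 * C + 2 * second_moment \<nu>"
      using W2_sq_le_moments[OF P2(1) \<nu>, of "r n"] moment[of "r n"]
        second_moment_nonneg[of "M (r n)"] second_moment_nonneg[of \<nu>] zero_le_power2[of "W2 (M (r n)) \<nu>"]
      unfolding real_norm_def by linarith
  qed
  then obtain l q where q: "strict_mono (q :: nat \<Rightarrow> nat)"
    "(\<lambda>n. (W2 (M (r (q n))) \<nu>)\<^sup>2 - second_moment (M (r (q n)))) \<longlonglongrightarrow> l"
    using bounded_imp_convergent_subsequence by (force simp: comp_def)
  have "l \<le> (\<integral>\<omega>. (norm (X' \<omega> - D \<omega>))\<^sup>2 \<partial>\<Omega>) - second_moment \<mu>"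
  proof (rule LIMSEQ_le[OF q(2)])
    show "(\<lambda>n. (\<integral>\<omega>. (norm (X (q n) \<omega> - D \<omega>))\<^sup>2 \<partial>\<Omega>) - second_moment (M (r (q n))))
      \<longlonglongrightarrow> (\<integral>\<omega>. (norm (X' \<omega> - D \<omega>))\<^sup>2 \<partial>\<Omega>) - second_moment \<mu>"
      using LIMSEQ_subseq_LIMSEQ[OF cD q(1)] by (simp add: comp_def)
  qed (use upper in auto)
  also have "(\<integral>\<omega>. (norm (X' \<omega> - D \<omega>))\<^sup>2 \<partial>\<Omega>) = (1 - t) * (\<integral>\<omega>. (norm (X' \<omega> - A' \<omega>))\<^sup>2 \<partial>\<Omega>)
      + t * (\<integral>\<omega>. (norm (X' \<omega> - B' \<omega>))\<^sup>2 \<partial>\<Omega>) - t * (1 - t) * (\<integral>\<omega>. (norm (A' \<omega> - B' \<omega>))\<^sup>2 \<partial>\<Omega>)"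
    unfolding D_def by (rule integral_norm_diff_convex_combination_sq[OF X' A' B' iX'(1) iA'(1) iB'(1)])
  also have "\<dots> - second_moment \<mu> = (1 - t) * l0 + t * ((\<integral>\<omega>. (norm (X' \<omega> - B' \<omega>))\<^sup>2 \<partial>\<Omega>) - second_moment \<mu>)
      - t * (1 - t) * (\<integral>\<omega>. (norm (A' \<omega> - B' \<omega>))\<^sup>2 \<partial>\<Omega>)"
    unfolding l0_eq[symmetric] by (simp add: algebra_simps)
  also have "\<dots> \<le> (1 - t) * l0 + t * l1 - t * (1 - t) * (W2 \<nu>0 \<nu>1)\<^sup>2"
    using mult_left_mono[OF l1_le t(1)] mult_left_mono[OF AB, of "t * (1 - t)"] t by simp
  finally have "l \<le> (1 - t) * l0 + t * l1 - t * (1 - t) * (W2 \<nu>0 \<nu>1)\<^sup>2" .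
  then show ?thesis
    using that[OF \<nu> \<nu>_le strict_mono_o[OF r q(1)]] q(2) by (simp add: comp_def)
qed

section \<open>Weak closedness of sublevels\<close>

text \<open>\<open>L\<close> collects the cluster values of \<open>W2 (N n) \<nu>\<^sup>2 - second_moment (N n)\<close> over all \<open>\<nu>\<close> in the
  sublevel; they dominate \<open>W2 \<mu> \<nu>\<^sup>2 - second_moment \<mu>\<close>. Interpolating, with base \<open>N n\<close>, from a nearly
  optimal \<open>\<nu>\<close> to \<open>N (s j)\<close> and letting first \<open>n\<close>, then \<open>j\<close> tend to infinity shows that the infimum
  of \<open>L\<close> is \<open>- second_moment \<mu>\<close>, so that the sublevel contains measures arbitrarily \<open>W2\<close>-close
  to \<open>\<mu>\<close>.\<close>

lemma sublevel_weakly_closed: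
  fixes M :: "nat \<Rightarrow> 'a::{real_inner, polish_space} measure"
  assumes lsc: "W2_lsc \<phi>" and conv: "convex_along_generalized_geodesics \<phi>"
    and P2M: "\<And>n. M n \<in> P2" and momentM: "\<And>n. second_moment (M n) \<le> C"
    and cM: "\<And>n. \<phi> (M n) \<le> ereal c" and limM: "limitin P2w M \<mu> sequentially"
  shows "\<phi> \<mu> \<le> ereal c"
proof -
  have \<mu>: "\<mu> \<in> P2" using limM[unfolded limitin_P2w_iff[OF P2M]] by (rule conjunct1)
  obtain r :: "nat \<Rightarrow> nat" and \<Omega> :: "real measure" and X Y
  where r: "strict_mono r" and \<Omega>: "prob_space \<Omega>" and X: "\<And>n. X n \<in> borel_measurable \<Omega>"
    and Y: "Y \<in> borel_measurable \<Omega>"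
    and lX: "\<And>n. distr \<Omega> borel (X n) = M (r n)" and lY: "distr \<Omega> borel Y = \<mu>"
    and weak: "AE \<omega> in \<Omega>. weakly_tendsto (\<lambda>n. X n \<omega>) (Y \<omega>)"
    by (rule limitin_P2w_Skorohod[OF P2M momentM limM]) blast
  \<comment> \<open>From here on only the subsequence with the representation \<open>X\<close> is
    considered; all its members live on one probability space together with the limit
    \<open>Y\<close>.\<close>
  define N where "N n = M (r n)" for n
  have P2: "N n \<in> P2" and moment: "second_moment (N n) \<le> C" and c: "\<phi> (N n) \<le> ereal c" for n
    using P2M momentM cM by (auto simp: N_def)
  have lim: "limitin P2w N \<mu> sequentially"
    unfolding N_def using limitin_P2w_subseq[OF P2M limM r] .
  have lX: "distr \<Omega> borel (X n) = N n" for n using lX by (simp add: N_def)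
  define m where "m = second_moment \<mu>"
  define a where "a n \<nu> = (W2 (N n) \<nu>)\<^sup>2 - second_moment (N n)" for n \<nu>
  define L where "L = {l. \<exists>\<nu> s. \<nu> \<in> P2 \<and> \<phi> \<nu> \<le> ereal c \<and> strict_mono (s :: nat \<Rightarrow> nat) \<and>
    (\<lambda>n. a (s n) \<nu>) \<longlonglongrightarrow> l}"
  have L_ge: "(W2 \<mu> \<nu>)\<^sup>2 \<le> l + m" if "\<nu> \<in> P2" "\<phi> \<nu> \<le> ereal c" "strict_mono s" "(\<lambda>n. a (s n) \<nu>) \<longlonglongrightarrow> l" for \<nu> s l
    unfolding m_def
    by (rule W2_weak_liminf[OF P2 that(1) moment limitin_P2w_subseq[OF P2 lim that(3)]
          optimal_plans_exist[OF conv P2 c that(1,2)] that(4)[unfolded a_def]])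
  have lower: "- m \<le> l" if "l \<in> L" for l
  proof -
    obtain \<nu> s where "\<nu> \<in> P2" "\<phi> \<nu> \<le> ereal c" "strict_mono s" "(\<lambda>n. a (s n) \<nu>) \<longlonglongrightarrow> l"
      using \<open>l \<in> L\<close> unfolding L_def by blast
    from L_ge[OF this] show ?thesis using zero_le_power2[of "W2 \<mu> \<nu>"] by linarith
  qed
  have "L \<noteq> {}"
  proof -
    have "bounded (range (\<lambda>n. a n (N 0)))"
    proof (rule boundedI, clarify)
      fix n
      show "norm (a n (N 0)) \<le> 2 * C + 2 * second_moment (N 0)"
        using W2_sq_le_moments[OF P2 P2, of n 0] moment[of n]
          second_moment_nonneg[of "N n"] second_moment_nonneg[of "N 0"] zero_le_power2[of "W2 (N n) (N 0)"]
        unfolding real_norm_def a_def by linarith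
    qed
    then obtain l s where "strict_mono (s :: nat \<Rightarrow> nat)" "((\<lambda>n. a n (N 0)) \<circ> s) \<longlonglongrightarrow> l"
      using bounded_imp_convergent_subsequence by blast
    then have "l \<in> L" using P2[of 0] c[of 0] unfolding L_def comp_def by blast
    then show ?thesis by blast
  qed
  have bdd: "bdd_below L" using lower by (rule bdd_belowI)
  define d where "d = Inf L"
  have d_le: "d \<le> l" if "l \<in> L" for l unfolding d_def by (rule cInf_lower[OF that bdd])
  have d_less: "\<exists>l\<in>L. l < x" if "d < x" for x
    using cInf_lessD[OF \<open>L \<noteq> {}\<close>] that unfolding d_def by blast
  have key: "2 * (d + m) \<le> t * (2 + d + C)" if t: "0 < t" "t < 1" for t
  proof -
    \<comment> \<open>The slack is of order t^2, so that it is still small after the division by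
      \<open>t\<close> at the end.\<close>
    obtain l where l: "l \<in> L" "l < d + t\<^sup>2" using d_less[of "d + t\<^sup>2"] t by auto
    then obtain \<nu> s where \<nu>: "\<nu> \<in> P2" "\<phi> \<nu> \<le> ereal c" and s: "strict_mono s"
      and al: "(\<lambda>n. a (s n) \<nu>) \<longlonglongrightarrow> l"
      unfolding L_def by blast
    \<comment> \<open>The limit in \<open>n\<close> of the cost of the coupling of
      \<open>X (s n)\<close> with \<open>X (s j)\<close>, minus the second moment of
      \<open>N (s n)\<close>. This coupling bounds the distance from above, and its limit in
      \<open>j\<close> can be computed through \<open>Y\<close>.\<close>
    define b where "b j = (\<integral>\<omega>. (norm (Y \<omega> - X (s j) \<omega>))\<^sup>2 \<partial>\<Omega>) - m" for j
    define W where "W j = (W2 \<nu> (N (s j)))\<^sup>2" for j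
    have weak': "AE \<omega> in \<Omega>. weakly_tendsto (\<lambda>n. X (s n) \<omega>) (Y \<omega>)"
      using weak
    proof eventually_elim
      case (elim \<omega>)
      have "(\<lambda>n. inner (X (s n) \<omega>) y) \<longlonglongrightarrow> inner (Y \<omega>) y" for y
        using LIMSEQ_subseq_LIMSEQ[OF elim[unfolded weakly_tendsto_def, rule_format, of y] s]
        by (simp add: comp_def)
      then show ?case by (simp add: weakly_tendsto_def)
    qed
    have dj: "d \<le> (1 - t) * l + t * b j - t * (1 - t) * W j" for j
    proof -
      have "(\<lambda>n. (\<integral>\<omega>. (norm (X (s n) \<omega> - X (s j) \<omega>))\<^sup>2 \<partial>\<Omega>) - second_moment (N (s n))) \<longlonglongrightarrow> b j"
        unfolding b_def m_def
        by (rule cost_limit[OF X Y X X lX lY lX lX P2 \<mu> P2 moment weak']) simp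
      moreover have "(W2 (N (s n)) (N (s j)))\<^sup>2 \<le> (\<integral>\<omega>. (norm (X (s n) \<omega> - X (s j) \<omega>))\<^sup>2 \<partial>\<Omega>)" for n
        by (rule W2_sq_le_law[OF \<Omega> X X lX lX P2 P2])
      ultimately obtain \<nu>' q l' where "\<nu>' \<in> P2" "\<phi> \<nu>' \<le> ereal c" "strict_mono (q :: nat \<Rightarrow> nat)"
        "(\<lambda>n. (W2 (N (s (q n))) \<nu>')\<^sup>2 - second_moment (N (s (q n)))) \<longlonglongrightarrow> l'"
        and l': "l' \<le> (1 - t) * l + t * b j - t * (1 - t) * (W2 \<nu> (N (s j)))\<^sup>2"
        by (rule generalized_geodesic_weak_base[OF lsc conv P2 \<nu>(1) P2 moment c \<nu>(2) c
              limitin_P2w_subseq[OF P2 lim s] less_imp_le[OF t(1)] less_imp_le[OF t(2)]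
              al[unfolded a_def]]) blast
      then have "l' \<in> L"
        unfolding L_def a_def using strict_mono_o[OF s \<open>strict_mono q\<close>]
        by (intro CollectI exI[of _ \<nu>'] exI[of _ "s \<circ> q"]) (simp add: comp_def)
      then show ?thesis using d_le l' by (force simp: W_def)
    qed
    have "(\<lambda>j. (\<integral>\<omega>. (norm (X (s j) \<omega> - Y \<omega>))\<^sup>2 \<partial>\<Omega>) - second_moment (N (s j)))
        \<longlonglongrightarrow> (\<integral>\<omega>. (norm (Y \<omega> - Y \<omega>))\<^sup>2 \<partial>\<Omega>) - m"
      unfolding m_def by (rule cost_limit[OF X Y Y Y lX lY lY lY P2 \<mu> \<mu> moment weak']) simp
    then have blim: "(\<lambda>j. b j + m - second_moment (N (s j))) \<longlonglongrightarrow> - m"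
      by (simp add: b_def norm_minus_commute)
    have Wlim: "(\<lambda>j. W j - second_moment (N (s j))) \<longlonglongrightarrow> l"
      using al by (simp add: a_def W_def W2_commute)
    \<comment> \<open>Neither \<open>b j\<close> nor \<open>W j\<close> need converge, but both
      differ from the second moment of \<open>N (s j)\<close> by a convergent sequence, so it
      cancels in the terms of order \<open>t\<close>. In the term of order t^2 it is replaced by its
      bound \<open>C\<close>.\<close>
    have "(\<lambda>j. (1 - t) * l + t * ((b j + m - second_moment (N (s j))) - m - (W j - second_moment (N (s j))))
        + t\<^sup>2 * ((W j - second_moment (N (s j))) + C)) \<longlonglongrightarrow> (1 - t) * l + t * (- m - m - l) + t\<^sup>2 * (l + C)"
      by (intro tendsto_intros blim Wlim)
    moreover have "d \<le> (1 - t) * l + t * ((b j + m - second_moment (N (s j))) - m - (W j - second_moment (N (s j))))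
        + t\<^sup>2 * ((W j - second_moment (N (s j))) + C)" for j
    proof -
      have "t\<^sup>2 * second_moment (N (s j)) \<le> t\<^sup>2 * C" by (intro mult_left_mono moment) simp
      then show ?thesis using dj[of j] by (simp add: algebra_simps power2_eq_square)
    qed
    ultimately have "d \<le> (1 - t) * l + t * (- m - m - l) + t\<^sup>2 * (l + C)"
      by (intro LIMSEQ_le_const) auto
    then have 1: "2 * t * (l + m) \<le> (l - d) + t\<^sup>2 * (l + C)" by (simp add: algebra_simps)
    have "t\<^sup>2 \<le> 1" using t by (simp add: power_le_one)
    then have "t\<^sup>2 * (l + C) \<le> t\<^sup>2 * (d + 1 + C)" using l by (intro mult_left_mono) auto
    moreover have "t * (2 * (d + m)) \<le> 2 * t * (l + m)"
      using d_le[OF l(1)] t by (simp add: algebra_simps)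
    ultimately have "t * (2 * (d + m)) \<le> t * (t * (2 + d + C))"
      using 1 l(2) by (simp add: algebra_simps power2_eq_square)
    then show ?thesis using t by simp
  qed
  have "d + m \<le> 0"
  proof (rule ccontr)
    assume "\<not> d + m \<le> 0"
    then have pos: "d + m > 0" by simp
    \<comment> \<open>Chosen so that the right-hand side of \<open>key\<close> is at most
      \<open>d + m\<close>, half of its left-hand side. The added 1 makes \<open>K\<close> positive,
      and the bound 1/2 in \<open>t\<close> keeps it below 1.\<close>
    define K where "K = \<bar>2 + d + C\<bar> + 1"
    define t where "t = min (1 / 2) ((d + m) / K)"
    have K: "K > 0" by (simp add: K_def)
    have t: "0 < t" "t < 1" using pos K by (auto simp: t_def)
    have "t * (2 + d + C) \<le> t * K" using t by (intro mult_left_mono) (auto simp: K_def)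
    also have "\<dots> \<le> (d + m) / K * K" using K by (intro mult_right_mono) (auto simp: t_def)
    also have "\<dots> = d + m" using K by simp
    finally have "2 * (d + m) \<le> d + m" by (rule order_trans[OF key[OF t]])
    then show False using pos by simp
  qed
  have "\<exists>\<nu>. \<nu> \<in> P2 \<and> \<phi> \<nu> \<le> ereal c \<and> (W2 \<mu> \<nu>)\<^sup>2 \<le> 1 / Suc n" for n
  proof -
    have "0 < 1 / real (Suc n)" by simp
    then have "d < - m + 1 / Suc n" using \<open>d + m \<le> 0\<close> by linarith
    then obtain l where l: "l \<in> L" "l < - m + 1 / Suc n" using d_less by blast
    then obtain \<nu> s where \<nu>: "\<nu> \<in> P2" "\<phi> \<nu> \<le> ereal c" "strict_mono s" "(\<lambda>n. a (s n) \<nu>) \<longlonglongrightarrow> l"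
      unfolding L_def by blast
    have "(W2 \<mu> \<nu>)\<^sup>2 \<le> 1 / Suc n" using L_ge[OF \<nu>] l(2) by linarith
    then show ?thesis using \<nu>(1,2) by blast
  qed
  then obtain \<nu> where \<nu>: "\<And>n. \<nu> n \<in> P2" "\<And>n. \<phi> (\<nu> n) \<le> ereal c" "\<And>n. (W2 \<mu> (\<nu> n))\<^sup>2 \<le> 1 / Suc n"
    by metis
  have "(\<lambda>n. (W2 \<mu> (\<nu> n))\<^sup>2) \<longlonglongrightarrow> 0"
    by (rule tendsto_sandwich[OF _ _ tendsto_const LIMSEQ_Suc[OF lim_inverse_n']];
        intro always_eventually allI zero_le_power2 \<nu>(3))
  then show ?thesis by (rule W2_lsc_limit[OF lsc \<mu> \<nu>(1,2)])
qed

section \<open>The proximal point algorithm\<close>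

text \<open>Compare \<open>\<mu>'\<close> with the point at time \<open>t\<close> on a generalized geodesic to \<open>\<nu>\<close> with base \<open>\<mu>\<close> and let
  \<open>t\<close> tend to 0.\<close>

lemma prox_evi:
  fixes \<mu> :: "'a::{real_inner, polish_space} measure"
  assumes conv: "convex_along_generalized_geodesics \<phi>" and "\<tau> > 0"
    and \<mu>: "\<mu> \<in> eff_domain \<phi>" and prox: "\<mu>' \<in> prox \<phi> \<tau> \<mu>" and f: "\<phi> \<mu>' = ereal f"
    and \<nu>: "\<nu> \<in> P2" "\<phi> \<nu> \<le> ereal c"
  shows "2 * \<tau> * (f - c) \<le> (W2 \<mu> \<nu>)\<^sup>2 - (W2 \<mu>' \<nu>)\<^sup>2"
proof -
  have P2: "\<mu> \<in> P2" using \<mu> by (simp add: eff_domain_def)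
  have P2': "\<mu>' \<in> P2" using prox by (simp add: prox_def argmin_P2_def)
  have min: "\<phi> \<mu>' + ereal (1 / (2 * \<tau>) * (W2 \<mu>' \<mu>)\<^sup>2) \<le> \<phi> \<rho> + ereal (1 / (2 * \<tau>) * (W2 \<rho> \<mu>)\<^sup>2)"
    if "\<rho> \<in> P2" for \<rho>
    using prox that by (simp add: prox_def argmin_P2_def prox_functional_def)
  obtain \<gamma> where \<gamma>: "\<gamma> \<in> couplings3 \<mu> \<mu>' \<nu>"
    "distr \<gamma> borel (\<lambda>z. (fst z, fst (snd z))) \<in> optimal_plans \<mu> \<mu>'"
    "distr \<gamma> borel (\<lambda>z. (fst z, snd (snd z))) \<in> optimal_plans \<mu> \<nu>"
    "\<And>t. 0 \<le> t \<Longrightarrow> t \<le> 1 \<Longrightarrow>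
      \<phi> (distr \<gamma> borel (\<lambda>z. (1 - t) *\<^sub>R fst (snd z) + t *\<^sub>R snd (snd z))) \<le> ereal ((1 - t) * f + t * c)"
    by (rule convex_along_generalized_geodesicsE[OF conv \<mu> P2' eq_refl[OF f] \<nu>]) blast
  have p: "sets \<gamma> = sets borel" "prob_space \<gamma>" "distr \<gamma> borel fst = \<mu>"
    "distr \<gamma> borel (\<lambda>z. fst (snd z)) = \<mu>'" "distr \<gamma> borel (\<lambda>z. snd (snd z)) = \<nu>"
    using \<gamma>(1) unfolding couplings3_def case_prod_unfold by auto
  note [measurable_cong] = p(1)
  have m: "fst \<in> borel_measurable \<gamma>" "(\<lambda>z. fst (snd z)) \<in> borel_measurable \<gamma>"
    "(\<lambda>z. snd (snd z)) \<in> borel_measurable \<gamma>"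
    by measurable
  note i = P2_law(1)[OF m(1) p(3) P2] P2_law(1)[OF m(2) p(4) P2'] P2_law(1)[OF m(3) p(5) \<nu>(1)]
  have c12: "(W2 \<mu> \<mu>')\<^sup>2 = (\<integral>z. (norm (fst z - fst (snd z)))\<^sup>2 \<partial>\<gamma>)"
    by (rule W2_sq_optimal_law[OF m(1,2) p(3,4) P2 P2' \<gamma>(2)])
  have c13: "(W2 \<mu> \<nu>)\<^sup>2 = (\<integral>z. (norm (fst z - snd (snd z)))\<^sup>2 \<partial>\<gamma>)"
    by (rule W2_sq_optimal_law[OF m(1,3) p(3,5) P2 \<nu>(1) \<gamma>(3)])
  have c23: "(W2 \<mu>' \<nu>)\<^sup>2 \<le> (\<integral>z. (norm (fst (snd z) - snd (snd z)))\<^sup>2 \<partial>\<gamma>)"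
    by (rule W2_sq_le_law[OF p(2) m(2,3) p(4,5) P2' \<nu>(1)])
  have step: "2 * \<tau> * (f - c) - (W2 \<mu> \<nu>)\<^sup>2 + (W2 \<mu>' \<nu>)\<^sup>2 \<le> t * (W2 \<mu>' \<nu>)\<^sup>2" if t: "0 < t" "t \<le> 1" for t
  proof -
    define D where "D z = (1 - t) *\<^sub>R fst (snd z) + t *\<^sub>R snd (snd z)" for z :: "'a \<times> 'a \<times> 'a"
    have D: "D \<in> borel_measurable \<gamma>" unfolding D_def by measurable
    have iD: "integrable \<gamma> (\<lambda>z. (norm (D z))\<^sup>2)"
      unfolding D_def by (intro square_integrable_add square_integrable_scaleR i) measurable
    define \<rho> where "\<rho> = distr \<gamma> borel D"
    have \<rho>: "\<rho> \<in> P2" unfolding \<rho>_def by (rule distr_in_P2[OF p(2) D iD])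
    have "ereal f + ereal (1 / (2 * \<tau>) * (W2 \<mu>' \<mu>)\<^sup>2) \<le> \<phi> \<rho> + ereal (1 / (2 * \<tau>) * (W2 \<rho> \<mu>)\<^sup>2)"
      using min[OF \<rho>] f by simp
    also have "\<dots> \<le> ereal ((1 - t) * f + t * c) + ereal (1 / (2 * \<tau>) * (W2 \<rho> \<mu>)\<^sup>2)"
      using \<gamma>(4)[of t] t by (intro add_right_mono) (simp add: \<rho>_def D_def[abs_def])
    finally have "f + (W2 \<mu>' \<mu>)\<^sup>2 / (2 * \<tau>) \<le> (1 - t) * f + t * c + (W2 \<rho> \<mu>)\<^sup>2 / (2 * \<tau>)"
      by simp
    then have "(f + (W2 \<mu>' \<mu>)\<^sup>2 / (2 * \<tau>)) * (2 * \<tau>) \<le> ((1 - t) * f + t * c + (W2 \<rho> \<mu>)\<^sup>2 / (2 * \<tau>)) * (2 * \<tau>)"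
      using \<open>\<tau> > 0\<close> by (intro mult_right_mono) auto
    moreover have "(x + y / (2 * \<tau>)) * (2 * \<tau>) = 2 * \<tau> * x + y" for x y
      using \<open>\<tau> > 0\<close> by (simp add: field_simps)
    ultimately have "2 * \<tau> * f + (W2 \<mu> \<mu>')\<^sup>2 \<le> 2 * \<tau> * ((1 - t) * f + t * c) + (W2 \<mu> \<rho>)\<^sup>2"
      by (simp only: W2_commute[of \<mu>])
    moreover have "(W2 \<mu> \<rho>)\<^sup>2 \<le> (\<integral>z. (norm (fst z - D z))\<^sup>2 \<partial>\<gamma>)"
      by (rule W2_sq_le_law[OF p(2) m(1) D p(3) \<rho>_def[symmetric] P2 \<rho>])
    moreover have "(\<integral>z. (norm (fst z - D z))\<^sup>2 \<partial>\<gamma>) = (1 - t) * (W2 \<mu> \<mu>')\<^sup>2 + t * (W2 \<mu> \<nu>)\<^sup>2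
        - t * (1 - t) * (\<integral>z. (norm (fst (snd z) - snd (snd z)))\<^sup>2 \<partial>\<gamma>)"
      unfolding D_def c12 c13 by (rule integral_norm_diff_convex_combination_sq[OF m i])
    \<comment> \<open>The plan between the last two coordinates need not be optimal, but its cost
      enters with a negative sign, so the bound from below by \<open>W2\<close> suffices.\<close>
    moreover have "t * (1 - t) * (W2 \<mu>' \<nu>)\<^sup>2 \<le> t * (1 - t) * (\<integral>z. (norm (fst (snd z) - snd (snd z)))\<^sup>2 \<partial>\<gamma>)"
      using t by (intro mult_left_mono c23) auto
    ultimately have "2 * \<tau> * f + (W2 \<mu> \<mu>')\<^sup>2 \<le> 2 * \<tau> * ((1 - t) * f + t * c) + (1 - t) * (W2 \<mu> \<mu>')\<^sup>2
        + t * (W2 \<mu> \<nu>)\<^sup>2 - t * (1 - t) * (W2 \<mu>' \<nu>)\<^sup>2" by linarith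
    then have "t * (2 * \<tau> * (f - c) - (W2 \<mu> \<nu>)\<^sup>2 + (W2 \<mu>' \<nu>)\<^sup>2 + (W2 \<mu> \<mu>')\<^sup>2) \<le> t * (t * (W2 \<mu>' \<nu>)\<^sup>2)"
      by (simp add: algebra_simps)
    then have "2 * \<tau> * (f - c) - (W2 \<mu> \<nu>)\<^sup>2 + (W2 \<mu>' \<nu>)\<^sup>2 + (W2 \<mu> \<mu>')\<^sup>2 \<le> t * (W2 \<mu>' \<nu>)\<^sup>2"
      using t by simp
    then show ?thesis using zero_le_power2[of "W2 \<mu> \<mu>'"] by linarith
  qed
  have "2 * \<tau> * (f - c) - (W2 \<mu> \<nu>)\<^sup>2 + (W2 \<mu>' \<nu>)\<^sup>2 \<le> 0 * (W2 \<mu>' \<nu>)\<^sup>2"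
  proof (rule LIMSEQ_le_const)
    show "(\<lambda>n. 1 / real (Suc n) * (W2 \<mu>' \<nu>)\<^sup>2) \<longlonglongrightarrow> 0 * (W2 \<mu>' \<nu>)\<^sup>2"
      by (intro tendsto_intros LIMSEQ_Suc[OF lim_inverse_n'])
    show "\<exists>N. \<forall>n\<ge>N. 2 * \<tau> * (f - c) - (W2 \<mu> \<nu>)\<^sup>2 + (W2 \<mu>' \<nu>)\<^sup>2 \<le> 1 / real (Suc n) * (W2 \<mu>' \<nu>)\<^sup>2"
      by (intro exI[of _ 0] allI impI step) auto
  qed
  then show ?thesis by simp
qed

section \<open>Limit points of the iterates\<close>

lemma weakly_convergent_subsequence:
  fixes N :: "nat \<Rightarrow> 'a::{real_inner, polish_space} measure"
  assumes P2: "\<And>n. N n \<in> P2" and moment: "\<And>n. second_moment (N n) \<le> C"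
  obtains r \<mu> where "strict_mono (r :: nat \<Rightarrow> nat)" "limitin P2w (\<lambda>n. N (r n)) \<mu> sequentially"
proof -
  obtain r :: "nat \<Rightarrow> nat" and \<Omega> :: "real measure" and X and Y
    where r: "strict_mono r" and \<Omega>: "prob_space \<Omega>" and X: "\<And>n. X n \<in> borel_measurable \<Omega>"
    and law: "\<And>n. distr \<Omega> borel (X n) = N (r n)"
    and Y: "Y \<in> borel_measurable \<Omega>"
    and weak: "AE \<omega> in \<Omega>. weakly_tendsto (\<lambda>n. X n \<omega>) (Y \<omega>)"
    by (rule weak_Skorohod_Prokhorov[of N, OF P2 moment[unfolded second_moment_def]]) blast
  from limitin_P2w_weak_limit[OF \<Omega> X Y law P2 moment[unfolded second_moment_def] weak]
  show ?thesis using that r by blast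
qed

text \<open>The coupling of \<open>X n\<close> with the limit \<open>Y\<close> bounds the distances
  to \<mu> from above, and \<open>W2_weak_liminf\<close> bounds those to \<open>\<mu>'\<close> from
  below, both after subtraction of second moments. These converge along a subsequence to some
  \<open>e\<close>, which cancels when the two bounds are added.\<close>

lemma Opial:
  fixes N :: "nat \<Rightarrow> 'a::{real_inner, polish_space} measure"
  assumes P2: "\<And>n. N n \<in> P2" "\<mu>' \<in> P2" and moment: "\<And>n. second_moment (N n) \<le> C"
    and lim: "limitin P2w N \<mu> sequentially" and opt: "\<And>n. \<exists>\<gamma>. \<gamma> \<in> optimal_plans (N n) \<mu>'"
    and a: "(\<lambda>n. (W2 (N n) \<mu>)\<^sup>2) \<longlonglongrightarrow> a" and b: "(\<lambda>n. (W2 (N n) \<mu>')\<^sup>2) \<longlonglongrightarrow> b"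
  shows "a + (W2 \<mu> \<mu>')\<^sup>2 \<le> b"
proof -
  have \<mu>: "\<mu> \<in> P2" using lim[unfolded limitin_P2w_iff[OF P2(1)]] by (rule conjunct1)
  obtain r :: "nat \<Rightarrow> nat" and \<Omega> :: "real measure" and X Y
  where r: "strict_mono r" and \<Omega>: "prob_space \<Omega>" and X: "\<And>n. X n \<in> borel_measurable \<Omega>"
    and Y: "Y \<in> borel_measurable \<Omega>"
    and lX: "\<And>n. distr \<Omega> borel (X n) = N (r n)" and lY: "distr \<Omega> borel Y = \<mu>"
    and weak: "AE \<omega> in \<Omega>. weakly_tendsto (\<lambda>n. X n \<omega>) (Y \<omega>)"
    by (rule limitin_P2w_Skorohod[OF P2(1) moment lim]) blast
  have "bounded (range (\<lambda>n. second_moment (N (r n))))"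
    using moment by (auto intro!: boundedI[of _ C] simp: abs_of_nonneg second_moment_nonneg)
  then obtain e q where q: "strict_mono (q :: nat \<Rightarrow> nat)" "(\<lambda>n. second_moment (N (r (q n)))) \<longlonglongrightarrow> e"
    using bounded_imp_convergent_subsequence by (force simp: comp_def)
  note rq = strict_mono_o[OF r q(1)]
  have ae: "(\<lambda>n. (W2 (N (r (q n))) \<mu>)\<^sup>2 - second_moment (N (r (q n)))) \<longlonglongrightarrow> a - e"
    using tendsto_diff[OF LIMSEQ_subseq_LIMSEQ[OF a rq] q(2)] by (simp add: comp_def)
  have be: "(\<lambda>n. (W2 (N ((r \<circ> q) n)) \<mu>')\<^sup>2 - second_moment (N ((r \<circ> q) n))) \<longlonglongrightarrow> b - e"
    using tendsto_diff[OF LIMSEQ_subseq_LIMSEQ[OF b rq] q(2)] by (simp add: comp_def)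
  have "(\<lambda>n. (\<integral>\<omega>. (norm (X n \<omega> - Y \<omega>))\<^sup>2 \<partial>\<Omega>) - second_moment (N (r n)))
      \<longlonglongrightarrow> (\<integral>\<omega>. (norm (Y \<omega> - Y \<omega>))\<^sup>2 \<partial>\<Omega>) - second_moment \<mu>"
    by (rule cost_limit[OF X Y Y Y lX lY lY lY P2(1) \<mu> \<mu> moment weak]) simp
  then have "(\<lambda>n. (\<integral>\<omega>. (norm (X n \<omega> - Y \<omega>))\<^sup>2 \<partial>\<Omega>) - second_moment (N (r n))) \<longlonglongrightarrow> - second_moment \<mu>"
    by simp
  from LIMSEQ_subseq_LIMSEQ[OF this q(1)]
  have "(\<lambda>n. (\<integral>\<omega>. (norm (X (q n) \<omega> - Y \<omega>))\<^sup>2 \<partial>\<Omega>) - second_moment (N (r (q n)))) \<longlonglongrightarrow> - second_moment \<mu>"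
    by (simp add: comp_def)
  then have "a - e \<le> - second_moment \<mu>"
    by (rule LIMSEQ_le[OF ae]) (use W2_sq_le_law[OF \<Omega> X Y lX lY P2(1) \<mu>] in auto)
  moreover have "(W2 \<mu> \<mu>')\<^sup>2 \<le> (b - e) + second_moment \<mu>"
    by (rule W2_weak_liminf[OF P2 moment limitin_P2w_subseq[OF P2(1) lim rq] opt be])
  ultimately show ?thesis by linarith
qed

lemma tendsto_if_subsequences:
  fixes x :: "nat \<Rightarrow> real"
  assumes "\<And>s. strict_mono (s :: nat \<Rightarrow> nat) \<Longrightarrow> \<exists>r. strict_mono (r :: nat \<Rightarrow> nat) \<and> (\<lambda>n. x (s (r n))) \<longlonglongrightarrow> l"
  shows "x \<longlonglongrightarrow> l"
proof (rule ccontr)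
  assume "\<not> x \<longlonglongrightarrow> l"
  then obtain e where e: "e > 0" "\<not> (\<forall>\<^sub>F n in sequentially. dist (x n) l < e)"
    unfolding tendsto_iff by blast
  then have "infinite {n. \<not> dist (x n) l < e}"
    unfolding cofinite_eq_sequentially[symmetric] eventually_cofinite by blast
  then obtain s where s: "strict_mono (s :: nat \<Rightarrow> nat)" "\<And>n. \<not> dist (x (s n)) l < e"
    using infinite_enumerate by blast
  obtain r where "strict_mono (r :: nat \<Rightarrow> nat)" "(\<lambda>n. x (s (r n))) \<longlonglongrightarrow> l" using assms[OF s(1)] by blast
  then have "\<forall>\<^sub>F n in sequentially. dist (x (s (r n))) l < e" using e(1) by (intro tendstoD)
  then show False using s(2) by simp
qed

theorem theorem6p7:
  fixes \<phi> :: "'a::{real_inner, polish_space} measure \<Rightarrow> ereal"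
    and \<tau> :: real
    and \<mu>0 :: "'a measure"
    and M :: "nat \<Rightarrow> 'a measure"
  assumes "\<forall>\<mu>\<in>P2. \<phi> \<mu> > -\<infinity>"
    and "proper \<phi>"
    and "W2_lsc \<phi>"
    and "convex_along_generalized_geodesics \<phi>"
    and "\<tau> > 0"
    and "\<mu>0 \<in> P2"
    and "M 0 = \<mu>0"
    and "\<forall>k. M (Suc k) \<in> prox \<phi> \<tau> (M k)"
  shows "(argmin_P2 \<phi> \<noteq> {} \<longleftrightarrow> W2_bounded (range M)) \<and>
    (W2_bounded (range M) \<longrightarrow>
       (\<exists>\<mu>. limitin P2w M \<mu> sequentially \<and>
            (\<forall>\<nu>. limitin P2w M \<nu> sequentially \<longrightarrow> \<nu> = \<mu>) \<and>
            \<mu> \<in> argmin_P2 \<phi>))"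
proof -
  note lsc = assms(3) and conv = assms(4)
  have prox: "M (Suc k) \<in> prox \<phi> \<tau> (M k)" for k using assms(8) by blast
  have M_P2: "M k \<in> P2" for k
    using prox assms(6,7) by (cases k) (auto simp: prox_def argmin_P2_def)
  obtain \<nu>0 where \<nu>0: "\<nu>0 \<in> P2" "\<phi> \<nu>0 < \<infinity>"
    using assms(2) by (auto simp: proper_def eff_domain_def)
  \<comment> \<open>The starting point may have infinite \<phi>, whereas every proximal step has
    finite \<phi>; hence the shift by one.\<close>
  define N where "N k = M (Suc k)" for k
  have N_P2: "N k \<in> P2" for k by (simp add: N_def M_P2)
  have N_fin: "\<phi> (N k) < \<infinity>" for k
  proof -
    have "\<phi> (N k) + ereal (1 / (2 * \<tau>) * (W2 (N k) (M k))\<^sup>2) \<le> \<phi> \<nu>0 + ereal (1 / (2 * \<tau>) * (W2 \<nu>0 (M k))\<^sup>2)"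
      using prox[of k] \<nu>0(1) by (simp add: N_def prox_def argmin_P2_def prox_functional_def)
    then show ?thesis using \<nu>0(2) by (cases "\<phi> (N k)"; cases "\<phi> \<nu>0") auto
  qed
  define f where "f k = real_of_ereal (\<phi> (N k))" for k
  have f: "\<phi> (N k) = ereal (f k)" for k
  proof -
    have "\<phi> (N k) > -\<infinity>" using assms(1) N_P2 by blast
    then show ?thesis unfolding f_def using N_fin[of k] by (cases "\<phi> (N k)") auto
  qed
  have N_dom: "N k \<in> eff_domain \<phi>" for k
    using N_P2 N_fin by (simp add: eff_domain_def)
  have evi: "2 * \<tau> * (f (Suc k) - c) \<le> (W2 (N k) \<nu>)\<^sup>2 - (W2 (N (Suc k)) \<nu>)\<^sup>2"
    if "\<nu> \<in> P2" "\<phi> \<nu> \<le> ereal c" for k \<nu> c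
    by (rule prox_evi[OF conv assms(5) N_dom _ f that]) (unfold N_def, rule prox)
  have f_dec: "f (Suc k) \<le> f k" for k
  proof -
    have "(W2 (N k) (N k))\<^sup>2 = 0" by (simp add: W2_self[OF N_P2])
    then have "2 * \<tau> * (f (Suc k) - f k) \<le> 0"
      using evi[OF N_P2[of k] eq_refl[OF f], of k] zero_le_power2[of "W2 (N (Suc k)) (N k)"]
      by linarith
    then show ?thesis using assms(5) by (simp add: mult_le_0_iff)
  qed
  \<comment> \<open>The inequalities telescope, and as \<open>f\<close> decreases its last value
    bounds all the earlier ones from below. Dividing by \<open>n\<close> later yields convergence of
    the values to the infimum.\<close>
  have f_sum: "2 * \<tau> * (real n * (f n - c)) \<le> (W2 (N 0) \<nu>)\<^sup>2 - (W2 (N n) \<nu>)\<^sup>2"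
    if \<nu>: "\<nu> \<in> P2" "\<phi> \<nu> \<le> ereal c" for n \<nu> c
  proof (induction n)
    case (Suc n)
    have "\<tau> * (real n * f (Suc n)) \<le> \<tau> * (real n * f n)"
      using assms(5) f_dec by (intro mult_left_mono) auto
    then show ?case using Suc evi[OF \<nu>, of n] by (simp add: algebra_simps)
  qed simp
  have f_limit: "\<exists>n0. \<forall>n\<ge>n0. f n \<le> c'" if \<nu>: "\<nu> \<in> P2" "\<phi> \<nu> \<le> ereal c" and "c < c'" for \<nu> c c'
  proof -
    have pos: "2 * \<tau> * (c' - c) > 0" using assms(5) \<open>c < c'\<close> by simp
    obtain n0 where n0: "(W2 (N 0) \<nu>)\<^sup>2 / (2 * \<tau> * (c' - c)) < real n0" using reals_Archimedean2 by blast
    have "f n \<le> c'" if "n \<ge> n0" for n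
    proof (rule ccontr)
      assume "\<not> f n \<le> c'"
      then have "real n * (c' - c) \<le> real n * (f n - c)" by (intro mult_left_mono) auto
      then have "2 * \<tau> * (real n * (c' - c)) \<le> 2 * \<tau> * (real n * (f n - c))"
        by (rule mult_left_mono) (use assms(5) in simp)
      also have "\<dots> \<le> (W2 (N 0) \<nu>)\<^sup>2" using f_sum[OF \<nu>, of n] zero_le_power2[of "W2 (N n) \<nu>"] by linarith
      also have "\<dots> < real n0 * (2 * \<tau> * (c' - c))" using n0 pos by (simp add: divide_less_eq)
      also have "\<dots> \<le> real n * (2 * \<tau> * (c' - c))" using pos that by (intro mult_right_mono) auto
      finally show False by (simp add: algebra_simps)
    qed
    then show ?thesis by blast
  qed
  have fejer: "(W2 (N (Suc k)) \<nu>)\<^sup>2 \<le> (W2 (N k) \<nu>)\<^sup>2" if "\<nu> \<in> argmin_P2 \<phi>" for k \<nu>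
  proof -
    \<comment> \<open>With \<open>c = f (Suc k)\<close> the left-hand side of \<open>evi\<close>
      vanishes.\<close>
    have "\<phi> \<nu> \<le> ereal (f (Suc k))" "\<nu> \<in> P2"
      using that N_P2[of "Suc k"] f[of "Suc k"] by (auto simp: argmin_P2_def)
    from evi[OF this(2,1), of k] show ?thesis by simp
  qed
  have fejer0: "(W2 (N k) \<nu>)\<^sup>2 \<le> (W2 (N 0) \<nu>)\<^sup>2" if "\<nu> \<in> argmin_P2 \<phi>" for k \<nu>
    by (induction k) (use fejer[OF that] order_trans in blast)+
  have argmin_bounded: "W2_bounded (range M)" if "\<nu> \<in> argmin_P2 \<phi>" for \<nu>
  proof -
    have "\<nu> \<in> P2" using that by (simp add: argmin_P2_def)
    \<comment> \<open>Monotonicity starts at \<open>M 1\<close>, so \<open>M 0\<close> enters the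
      bound separately.\<close>
    moreover have "W2 \<nu> (M k) \<le> max (W2 \<nu> (M 0)) (W2 \<nu> (M 1))" for k
    proof (cases k)
      case (Suc k')
      have "W2 (N k') \<nu> \<le> W2 (N 0) \<nu>" using fejer0[OF that] W2_nonneg by (rule power2_le_imp_le)
      then show ?thesis by (simp add: Suc N_def W2_commute[of \<nu>])
    qed simp
    ultimately show ?thesis unfolding W2_bounded_def using M_P2 by blast
  qed
  have weak_limit: "\<exists>\<mu>. limitin P2w M \<mu> sequentially \<and> \<mu> \<in> argmin_P2 \<phi>" if bdd: "W2_bounded (range M)"
  proof -
    obtain \<nu> C0 where \<nu>: "\<nu> \<in> P2" "\<And>k. W2 \<nu> (M k) \<le> C0"
      using bdd unfolding W2_bounded_def by blast
    define C where "C = 2 * second_moment \<nu> + 2 * (C0\<^sup>2 + 1)"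
    have moment: "second_moment (N k) \<le> C" for k
      unfolding C_def N_def by (rule second_moment_le_W2[OF M_P2 \<nu>])
    have minimal: "\<mu> \<in> argmin_P2 \<phi>"
      if s: "strict_mono s" and lim: "limitin P2w (\<lambda>n. N (s n)) \<mu> sequentially" for s \<mu>
    proof -
      have \<mu>: "\<mu> \<in> P2" using lim[unfolded limitin_P2w_iff[OF N_P2]] by (rule conjunct1)
      have "\<phi> \<mu> \<le> \<phi> \<rho>" if \<rho>: "\<rho> \<in> P2" for \<rho>
      proof (rule ccontr)
        assume less: "\<not> \<phi> \<mu> \<le> \<phi> \<rho>"
        then have "\<phi> \<rho> < \<phi> \<mu>" by simp
        then obtain c where c: "\<phi> \<rho> < ereal c" "ereal c < \<phi> \<mu>" using ereal_dense2 by blast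
        \<comment> \<open>A second level is needed because \<open>f_limit\<close> brings the values
          only below numbers strictly above \<open>c\<close>. The tail of the subsequence then lies
          in the sublevel at \<open>c'\<close>, and so would its weak limit.\<close>
        obtain c' where c': "ereal c < ereal c'" "ereal c' < \<phi> \<mu>" using ereal_dense2[OF c(2)] by blast
        obtain n0 where n0: "\<And>n. n \<ge> n0 \<Longrightarrow> f n \<le> c'"
          using f_limit[OF \<rho> less_imp_le[OF c(1)], of c'] c'(1) by auto
        have sn: "strict_mono (\<lambda>n. n + n0)" by (simp add: strict_mono_def)
        have "n0 \<le> s (n + n0)" for n using seq_suble[OF s, of "n + n0"] by simp
        then have "\<phi> (N (s (n + n0))) \<le> ereal c'" for n using n0 by (simp add: f)
        from sublevel_weakly_closed[OF lsc conv N_P2 moment this limitin_P2w_subseq[OF N_P2 lim sn]]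
        show False using c'(2) by simp
      qed
      then show ?thesis using \<mu> by (simp add: argmin_P2_def)
    qed
    have unique: "\<mu> = \<mu>'"
      if s: "strict_mono s" "limitin P2w (\<lambda>n. N (s n)) \<mu> sequentially"
        and s': "strict_mono s'" "limitin P2w (\<lambda>n. N (s' n)) \<mu>' sequentially" for s s' \<mu> \<mu>'
    proof -
      note min = minimal[OF s] minimal[OF s']
      have P2: "\<mu> \<in> P2" "\<mu>' \<in> P2" using min by (auto simp: argmin_P2_def)
      \<comment> \<open>Finite values at both limit points provide the optimal plans needed for
        \<open>Opial\<close> and \<open>W2_zero_imp_eq\<close>.\<close>
      have le: "\<phi> \<mu> \<le> ereal (f 0)" "\<phi> \<mu>' \<le> ereal (f 0)"
        using min N_P2[of 0] f[of 0] by (auto simp: argmin_P2_def)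
      have conv_dist: "\<exists>a. (\<lambda>n. (W2 (N n) \<rho>)\<^sup>2) \<longlonglongrightarrow> a" if "\<rho> \<in> argmin_P2 \<phi>" for \<rho>
      proof -
        have "decseq (\<lambda>n. (W2 (N n) \<rho>)\<^sup>2)" by (rule decseq_SucI) (rule fejer[OF that])
        then show ?thesis using decseq_convergent[of "\<lambda>n. (W2 (N n) \<rho>)\<^sup>2" 0] zero_le_power2 by blast
      qed
      obtain a b where a: "(\<lambda>n. (W2 (N n) \<mu>)\<^sup>2) \<longlonglongrightarrow> a" and b: "(\<lambda>n. (W2 (N n) \<mu>')\<^sup>2) \<longlonglongrightarrow> b"
        using conv_dist[OF min(1)] conv_dist[OF min(2)] by blast
      \<comment> \<open>By monotonicity \<open>a\<close> and \<open>b\<close> are limits along the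
        whole sequence. Hence they can be compared along \<open>s\<close>, where \<mu> is the weak
        limit, and along \<open>s'\<close>, where \<open>\<mu>'\<close> is.\<close>
      have "a + (W2 \<mu> \<mu>')\<^sup>2 \<le> b"
        by (rule Opial[OF N_P2 P2(2) moment s(2) optimal_plans_exist[OF conv N_P2 eq_refl[OF f] P2(2) le(2)]])
          (use LIMSEQ_subseq_LIMSEQ[OF a s(1)] LIMSEQ_subseq_LIMSEQ[OF b s(1)] in \<open>simp_all add: comp_def\<close>)
      moreover have "b + (W2 \<mu>' \<mu>)\<^sup>2 \<le> a"
        by (rule Opial[OF N_P2 P2(1) moment s'(2) optimal_plans_exist[OF conv N_P2 eq_refl[OF f] P2(1) le(1)]])
          (use LIMSEQ_subseq_LIMSEQ[OF a s'(1)] LIMSEQ_subseq_LIMSEQ[OF b s'(1)] in \<open>simp_all add: comp_def\<close>)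
      ultimately have "(W2 \<mu> \<mu>')\<^sup>2 \<le> 0" using zero_le_power2[of "W2 \<mu>' \<mu>"] by linarith
      then have "W2 \<mu> \<mu>' = 0" by simp
      moreover obtain \<gamma> where "\<gamma> \<in> optimal_plans \<mu> \<mu>'"
        using optimal_plans_exist[OF conv P2(1) le(1) P2(2) le(2)] by blast
      ultimately show ?thesis by (intro W2_zero_imp_eq[OF P2])
    qed
    obtain r \<mu> where r: "strict_mono (r :: nat \<Rightarrow> nat)" "limitin P2w (\<lambda>n. N (r n)) \<mu> sequentially"
      by (rule weakly_convergent_subsequence[OF N_P2 moment])
    have \<mu>: "\<mu> \<in> argmin_P2 \<phi>" by (rule minimal[OF r])
    \<comment> \<open>The subsequence argument is run on the real integrals of each test function,
      so that no metric for the weak topology is involved.\<close>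
    have "(\<lambda>n. \<integral>x. \<zeta> x \<partial>M n) \<longlonglongrightarrow> (\<integral>x. \<zeta> x \<partial>\<mu>)" if \<zeta>: "\<zeta> \<in> weak_test_functions" for \<zeta>
    proof (rule LIMSEQ_imp_Suc, rule tendsto_if_subsequences)
      fix s :: "nat \<Rightarrow> nat" assume s: "strict_mono s"
      obtain q \<mu>' where q: "strict_mono (q :: nat \<Rightarrow> nat)" "limitin P2w (\<lambda>n. N (s (q n))) \<mu>' sequentially"
        by (rule weakly_convergent_subsequence[of "\<lambda>n. N (s n)", OF N_P2 moment])
      have "\<mu>' = \<mu>"
        using unique[OF strict_mono_o[OF s q(1)] _ r] q(2) by (simp add: comp_def)
      then have "(\<lambda>n. \<integral>x. \<zeta> x \<partial>N (s (q n))) \<longlonglongrightarrow> (\<integral>x. \<zeta> x \<partial>\<mu>)"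
        using q(2) \<zeta> by (simp add: limitin_P2w_iff[OF N_P2])
      then show "\<exists>q. strict_mono q \<and> (\<lambda>n. \<integral>x. \<zeta> x \<partial>M (Suc (s (q n)))) \<longlonglongrightarrow> (\<integral>x. \<zeta> x \<partial>\<mu>)"
        using q(1) unfolding N_def by blast
    qed
    then have "limitin P2w M \<mu> sequentially"
      using \<mu> by (simp add: limitin_P2w_iff[OF M_P2] argmin_P2_def)
    then show ?thesis using \<mu> by blast
  qed
  have uniq: "\<nu> = \<mu>" if "limitin P2w M \<mu> sequentially" "limitin P2w M \<nu> sequentially" for \<mu> \<nu>
    by (rule limitin_P2w_unique[OF M_P2 that(2,1)])
  show ?thesis
  proof (intro conjI iffI impI)
    assume "argmin_P2 \<phi> \<noteq> {}"
    then show "W2_bounded (range M)" using argmin_bounded by blast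
  next
    assume "W2_bounded (range M)"
    then show "argmin_P2 \<phi> \<noteq> {}" using weak_limit by blast
  next
    assume "W2_bounded (range M)"
    then obtain \<mu> where "limitin P2w M \<mu> sequentially" "\<mu> \<in> argmin_P2 \<phi>" using weak_limit by blast
    then show "\<exists>\<mu>. limitin P2w M \<mu> sequentially \<and> (\<forall>\<nu>. limitin P2w M \<nu> sequentially \<longrightarrow> \<nu> = \<mu>) \<and>
        \<mu> \<in> argmin_P2 \<phi>"
      using uniq by blast
  qed
qed

end
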